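(* Let $X_8=\mathrm{conv}\{(\pm1,\pm1)\}\subset\mathbb{R}^2$ (all four sign choices) and $X_9=\mathrm{conv}\{(-1,-1),(2,-1),(-1,2)\}\subset\mathbb{R}^2$. Then the double cones $D(X_8)$ and $D(X_9)$ in $\mathbb{R}^3$ are asymptotically Chow polystable.
   Context: For an integral polytope $Q\subset\mathbb{R}^m$, the double cone is $D(Q)=\mathrm{conv}\big(\{(0,\dots,0,1),(0,\dots,0,-1)\}\cup\{(p,0):p\in Q\}\big)\subset\mathbb{R}^{m+1}$. Chow stability: let $P\subset\mathbb{R}^n$ be an $n$-dimensional integral convex polytope, and let $G$ be the largest (finite) subgroup of $SL(n,\mathbb{Z})$ preserving $P$. Write $\chi(kP)=\#(kP\cap\mathbb{Z}^n)$ and let $\mathrm{Vol}$, $dV$ be Lebesgue measure. $P$ (or the polarized toric variety $X_P$) is asymptotically Chow semistable if there is a constant $C$ such that for all integers $k\ge C$ and all $G$-invariant convex functions $f:kP\to\mathbb{R}$, $$\frac{1}{\mathrm{Vol}(kP)}\int_{kP}f\,dV\le\frac{1}{\chi(kP)}\sum_{p\in kP\cap\mathbb{Z}^n}f(p).$$ It is asymptotically Chow polystable if in addition, for all $k\ge C$, equality holds only when $f$ is affine. *)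

theory Defs
  imports "HOL-Analysis.Analysis"
begin

definition int_lattice :: "(real ^ 'n) set" where
  "int_lattice = {p. \<forall>i. p $ i \<in> \<int>}"

definition integral_polytope :: "(real ^ 'n) set \<Rightarrow> bool" where
  "integral_polytope P \<longleftrightarrow> (\<exists>V. finite V \<and> V \<subseteq> int_lattice \<and> P = convex hull V)"

definition dilate :: "nat \<Rightarrow> (real ^ 'n) set \<Rightarrow> (real ^ 'n) set" where
  "dilate k P = (\<lambda>x. real k *\<^sub>R x) ` P"

definition SL_int :: "(real ^ 'n ^ 'n) set" where
  "SL_int = {A. (\<forall>i j. A $ i $ j \<in> \<int>) \<and> det A = 1}"

text \<open>The largest subgroup of \<open>SL(n,\<int>)\<close> preserving \<open>P\<close> is the setwise stabilizer of \<open>P\<close>.\<close>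

definition sym_group :: "(real ^ 'n) set \<Rightarrow> (real ^ 'n ^ 'n) set" where
  "sym_group P = {A \<in> SL_int. (\<lambda>x. A *v x) ` P = P}"

text \<open>
  A function \<open>kP \<rightarrow> \<real>\<close> is represented by a total function of which only the values on \<open>kP\<close> matter.
  The group is that of \<open>P\<close>; it preserves every dilate of \<open>P\<close>.
\<close>

definition invariant_convex :: "(real ^ 'n) set \<Rightarrow> nat \<Rightarrow> (real ^ 'n \<Rightarrow> real) \<Rightarrow> bool" where
  "invariant_convex P k f \<longleftrightarrow>
     convex_on (dilate k P) f \<and> (\<forall>A\<in>sym_group P. \<forall>x\<in>dilate k P. f (A *v x) = f x)"

definition affine_fun_on :: "(real ^ 'n) set \<Rightarrow> (real ^ 'n \<Rightarrow> real) \<Rightarrow> bool" where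
  "affine_fun_on S f \<longleftrightarrow> (\<exists>a b. \<forall>x\<in>S. f x = a \<bullet> x + b)"

text \<open>
  The two averages compared by Chow stability. A convex function on a polytope is bounded, and it is
  continuous in the interior, so the integral below is always that of an integrable function.
\<close>

definition continuous_average :: "(real ^ 'n) set \<Rightarrow> (real ^ 'n \<Rightarrow> real) \<Rightarrow> real" where
  "continuous_average S f = 1 / measure lebesgue S * (LINT x:S|lebesgue. f x)"

definition lattice_average :: "(real ^ 'n) set \<Rightarrow> (real ^ 'n \<Rightarrow> real) \<Rightarrow> real" where
  "lattice_average S f =
     1 / real (card (S \<inter> int_lattice)) * (\<Sum>p\<in>S \<inter> int_lattice. f p)"

text \<open>
  Both notions concern full-dimensional integral polytopes only, and are false for other sets.
  In the second one the same constant \<open>C\<close> serves the inequality and the equality case.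
\<close>

definition asymptotically_Chow_semistable :: "(real ^ 'n) set \<Rightarrow> bool" where
  "asymptotically_Chow_semistable P \<longleftrightarrow>
     integral_polytope P \<and> aff_dim P = int CARD('n) \<and>
     (\<exists>C. \<forall>k\<ge>C. \<forall>f. invariant_convex P k f \<longrightarrow>
        continuous_average (dilate k P) f \<le> lattice_average (dilate k P) f)"

definition asymptotically_Chow_polystable :: "(real ^ 'n) set \<Rightarrow> bool" where
  "asymptotically_Chow_polystable P \<longleftrightarrow>
     integral_polytope P \<and> aff_dim P = int CARD('n) \<and>
     (\<exists>C. \<forall>k\<ge>C. \<forall>f. invariant_convex P k f \<longrightarrow>
        continuous_average (dilate k P) f \<le> lattice_average (dilate k P) f \<and>
        (continuous_average (dilate k P) f = lattice_average (dilate k P) f \<longrightarrow>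
           affine_fun_on (dilate k P) f))"

lemma asymptotically_Chow_polystable_imp_semistable:
  "asymptotically_Chow_polystable P \<Longrightarrow> asymptotically_Chow_semistable P"
  unfolding asymptotically_Chow_polystable_def asymptotically_Chow_semistable_def by meson

text \<open>
  \<open>\<real>\<^bsup>m+1\<^esup>\<close> is \<open>real ^ 'm option\<close>, where the index \<open>None\<close> stands for the last coordinate:
  \<open>append_coord p t\<close> is the point \<open>(p, t)\<close>.
\<close>

definition append_coord :: "real ^ 'm \<Rightarrow> real \<Rightarrow> real ^ 'm option" where
  "append_coord p t = (\<chi> i. case i of None \<Rightarrow> t | Some j \<Rightarrow> p $ j)"

definition double_cone :: "(real ^ 'm) set \<Rightarrow> (real ^ 'm option) set" where
  "double_cone Q =
     convex hull ({append_coord 0 1, append_coord 0 (- 1)} \<union> (\<lambda>p. append_coord p 0) ` Q)"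

definition X8 :: "(real ^ 2) set" where
  "X8 = convex hull {vector [1, 1], vector [1, - 1], vector [- 1, 1], vector [- 1, - 1]}"

definition X9 :: "(real ^ 2) set" where
  "X9 = convex hull {vector [- 1, - 1], vector [2, - 1], vector [- 1, 2]}"

end

theory Submission
  imports Defs "HOL-Library.Option_ord"
begin

text \<open>
  Let \<open>P\<close> be the double cone over a reflexive polygon \<open>Q\<close> whose boundary contains the lattice points
  \<open>q 0, \<dots>, q (a - 1)\<close> in cyclic order (\<open>a = 8\<close> for the square, \<open>a = 9\<close> for the triangle). Consecutive ones
  have determinant one, so \<open>k P\<close> is the union of \<open>2 a\<close> images, under unimodular linear maps, of the
  tetrahedron \<open>{x, y, z \<ge> 0, x + y + z \<le> k}\<close>. An invariant convex function \<open>f\<close> on \<open>k P\<close> attains its minimum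
  at the origin, because the symmetry group contains a rotation about the axis and an element exchanging the two apexes,
  and averaging over them moves every point to \<open>0\<close>. After subtracting a constant, \<open>f \<ge> 0\<close> and \<open>f 0 = 0\<close>.

  Let \<open>A\<close> be the sum of \<open>f\<close> over the two apexes of \<open>k P\<close>, let \<open>B\<close> be the sum over the other lattice points of the
  boundary, \<open>T\<close> the sum over all lattice points, and \<open>J\<close> the integral. The proof rests on two inequalities,

    \<open>J \<le> T - B / 2 - (1 - a / 24) A\<close> and \<open>J \<le> (k / 4) (B + (a / 6) A)\<close>.

  The first one is an Euler-Maclaurin type estimate: boundary points count at most one half. Each
  tetrahedron is swept by its horizontal slices, triangles of size \<open>r\<close> when the height is \<open>k - r\<close>, and each
  such triangle is swept by the segments \<open>x + y = j\<close>. Replacing a convex function by its chords between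
  consecutive integers, for the weights \<open>r\<^sup>2\<close>, \<open>s\<close> and \<open>1\<close> of the three steps, yields weight one at the
  interior lattice points up to a few excesses: at the points of the axis (weight \<open>a / 6\<close>) and a factor
  \<open>1 + 1 / (6 r\<^sup>2)\<close> for each slice. Within a slice these excesses are moved to the rim, whose weight
  \<open>1 / 2 - 1 / (6 r)\<close> leaves room for them; this uses that the value at the centre is at most the mean over
  the rim (\<open>disc_integral_le_lattice_sum\<close>). The second inequality sweeps the tetrahedra from the origin instead:
  \<open>f (r p) \<le> r f p\<close> gives the factor \<open>\<integral>r\<^sup>3 = 1 / 4\<close>, where a constant function would only give \<open>1 / 3\<close>.

  The quotient of the number of lattice points by the volume is \<open>1 + 3 / (2 k) + O(1 / k\<^sup>2)\<close>. By the second
  inequality, the excess \<open>3 J / (2 k)\<close> is at most \<open>3 / 8 (B + (a / 6) A)\<close> up to an error \<open>O(1 / k)\<close>, which is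
  strictly less than the amount \<open>B / 2 + (1 - a / 24) A\<close> gained in the first one, since \<open>3 / 8 < 1 / 2\<close> and,
  for \<open>a \<le> 9\<close>, \<open>(3 / 8) (a / 6) < 1 - a / 24\<close>. Equality therefore forces \<open>A = B = 0\<close>, then \<open>J = 0\<close> by the second
  inequality, then \<open>T = 0\<close>; so \<open>f\<close> vanishes at the vertices and hence everywhere.
\<close>

section \<open>Trapezoid rules for convex functions of one variable\<close>

lemma convex_on_le_chord:
  fixes \<phi> :: "real \<Rightarrow> real"
  assumes "convex_on S \<phi>" "p \<in> S" "p + 1 \<in> S" "p \<le> x" "x \<le> p + 1"
  shows "\<phi> x \<le> (p + 1 - x) * \<phi> p + (x - p) * \<phi> (p + 1)"
proof -
  have "\<phi> ((1 - (x - p)) *\<^sub>R p + (x - p) *\<^sub>R (p + 1))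
      \<le> (1 - (x - p)) * \<phi> p + (x - p) * \<phi> (p + 1)"
    using assms by (intro convex_onD[OF assms(1)]) auto
  moreover have "(1 - (x - p)) *\<^sub>R p + (x - p) *\<^sub>R (p + 1) = x"
    by (simp add: algebra_simps)
  moreover have "1 - (x - p) = p + 1 - x" by simp
  ultimately show ?thesis by metis
qed

text \<open>On each unit interval a convex function lies below its chord, so the integral is at most that of the
  chord; \<open>A j\<close> and \<open>B j\<close> are the moments of the weight against the two halves of the hat functions.\<close>

lemma integral_le_weighted_trapezoid:
  fixes \<phi> w :: "real \<Rightarrow> real" and A B :: "nat \<Rightarrow> real"
  assumes conv: "convex_on {0..real n} \<phi>" and cont: "continuous_on {0..real n} \<phi>"
    and w: "continuous_on {0..real n} w" "\<And>x. x \<in> {0..real n} \<Longrightarrow> 0 \<le> w x"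
    and A: "\<And>j. ((\<lambda>x. w x * (real j + 1 - x)) has_integral A j) {real j..real j + 1}"
    and B: "\<And>j. ((\<lambda>x. w x * (x - real j)) has_integral B j) {real j..real j + 1}"
  shows "integral {0..real n} (\<lambda>x. w x * \<phi> x) \<le> (\<Sum>j<n. A j * \<phi> (real j) + B j * \<phi> (real j + 1))"
proof -
  have "integral {0..real m} (\<lambda>x. w x * \<phi> x) \<le> (\<Sum>j<m. A j * \<phi> (real j) + B j * \<phi> (real j + 1))"
    if "m \<le> n" for m
    using that
  proof (induction m)
    case 0 then show ?case by simp
  next
    case (Suc m)
    have cwf: "continuous_on {0..real n} (\<lambda>x. w x * \<phi> x)"
      by (intro continuous_intros cont w)
    have int: "(\<lambda>x. w x * \<phi> x) integrable_on {0..real (Suc m)}"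
      by (rule integrable_continuous_real, rule continuous_on_subset[OF cwf]) (use Suc.prems in auto)
    have "integral {real m..real m + 1} (\<lambda>x. w x * \<phi> x) \<le> A m * \<phi> (real m) + B m * \<phi> (real m + 1)"
    proof (rule has_integral_le)
      show "((\<lambda>x. w x * \<phi> x) has_integral integral {real m..real m + 1} (\<lambda>x. w x * \<phi> x)) {real m..real m + 1}"
        by (intro integrable_integral integrable_continuous_real continuous_on_subset[OF cwf])
           (use Suc.prems in auto)
      show "((\<lambda>x. w x * (real m + 1 - x) * \<phi> (real m) + w x * (x - real m) * \<phi> (real m + 1))
          has_integral A m * \<phi> (real m) + B m * \<phi> (real m + 1)) {real m..real m + 1}"
        by (intro has_integral_add has_integral_mult_left A B)
      fix x assume x: "x \<in> {real m..real m + 1}"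
      have "\<phi> x \<le> (real m + 1 - x) * \<phi> (real m) + (x - real m) * \<phi> (real m + 1)"
        by (rule convex_on_le_chord[OF conv]) (use x Suc.prems in auto)
      then have "w x * \<phi> x \<le> w x * ((real m + 1 - x) * \<phi> (real m) + (x - real m) * \<phi> (real m + 1))"
        by (rule mult_left_mono) (use x w(2)[of x] Suc.prems in auto)
      then show "w x * \<phi> x \<le> w x * (real m + 1 - x) * \<phi> (real m) + w x * (x - real m) * \<phi> (real m + 1)"
        by (simp add: algebra_simps)
    qed
    moreover have "integral {0..real m} (\<lambda>x. w x * \<phi> x) + integral {real m..real (Suc m)} (\<lambda>x. w x * \<phi> x)
      = integral {0..real (Suc m)} (\<lambda>x. w x * \<phi> x)"
      by (rule Henstock_Kurzweil_Integration.integral_combine) (use int in auto)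
    ultimately show ?case using Suc by (simp add: add.commute)
  qed
  then show ?thesis by simp
qed

lemma has_integral_power_segment:
  fixes p q :: real
  assumes "p \<le> q"
  shows "((\<lambda>x. x ^ d) has_integral (q ^ Suc d - p ^ Suc d) / real (Suc d)) {p..q}"
proof -
  have "((\<lambda>x. x ^ d) has_integral q ^ Suc d / real (Suc d) - p ^ Suc d / real (Suc d)) {p..q}"
    by (rule fundamental_theorem_of_calculus[OF assms])
       (auto intro!: derivative_eq_intros simp flip: has_real_derivative_iff_has_vector_derivative
             simp del: power_Suc)
  then show ?thesis by (simp add: diff_divide_distrib)
qed

lemma integral_rescale:
  fixes \<phi> :: "real \<Rightarrow> real"
  assumes n: "n > 0"
  shows "n ^ Suc d * integral {0..1} (\<lambda>s. s ^ d * \<phi> (n * s)) = integral {0..n} (\<lambda>x. x ^ d * \<phi> x)"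
proof -
  have im: "(\<lambda>x. x / n) ` {0..n} = {0..1}"
    using n image_divide_atLeastAtMost[of n 0 n] by simp
  have "integral {0..1} (\<lambda>s. (n * s) ^ d * \<phi> (n * s)) = (1 / n) * integral {0..n} (\<lambda>x. x ^ d * \<phi> x)"
    using integral_stretch_real[of n 0 n "\<lambda>x. x ^ d * \<phi> x"] n by (simp add: im)
  moreover have "integral {0..1} (\<lambda>s. (n * s) ^ d * \<phi> (n * s)) = n ^ d * integral {0..1} (\<lambda>s. s ^ d * \<phi> (n * s))"
    by (subst integral_mult_right[symmetric]) (simp add: power_mult_distrib mult.assoc)
  ultimately show ?thesis using n by (simp add: field_simps)
qed

lemma power_weight_integrals:
  fixes p :: real
  shows "((\<lambda>x. x ^ d * (p + 1 - x)) has_integral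
      (p + 1) * (((p + 1) ^ Suc d - p ^ Suc d) / real (Suc d))
      - ((p + 1) ^ Suc (Suc d) - p ^ Suc (Suc d)) / real (Suc (Suc d))) {p..p + 1}"
    and "((\<lambda>x. x ^ d * (x - p)) has_integral
      ((p + 1) ^ Suc (Suc d) - p ^ Suc (Suc d)) / real (Suc (Suc d))
      - p * (((p + 1) ^ Suc d - p ^ Suc d) / real (Suc d))) {p..p + 1}"
proof -
  have 0: "((\<lambda>x. x ^ d) has_integral ((p + 1) ^ Suc d - p ^ Suc d) / real (Suc d)) {p..p + 1}"
    and 1: "((\<lambda>x. x ^ Suc d) has_integral ((p + 1) ^ Suc (Suc d) - p ^ Suc (Suc d)) / real (Suc (Suc d))) {p..p + 1}"
    by (rule has_integral_power_segment, simp)+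
  show "((\<lambda>x. x ^ d * (p + 1 - x)) has_integral
      (p + 1) * (((p + 1) ^ Suc d - p ^ Suc d) / real (Suc d))
      - ((p + 1) ^ Suc (Suc d) - p ^ Suc (Suc d)) / real (Suc (Suc d))) {p..p + 1}"
    using has_integral_diff[OF has_integral_mult_right[OF 0, of "p + 1"] 1]
    by (simp add: algebra_simps)
  show "((\<lambda>x. x ^ d * (x - p)) has_integral
      ((p + 1) ^ Suc (Suc d) - p ^ Suc (Suc d)) / real (Suc (Suc d))
      - p * (((p + 1) ^ Suc d - p ^ Suc d) / real (Suc d))) {p..p + 1}"
    using has_integral_diff[OF 1 has_integral_mult_right[OF 0, of p]]
    by (simp add: algebra_simps)
qed

lemma sum_split_endpoints:
  fixes \<phi> c e :: "nat \<Rightarrow> real"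
  assumes "n > 0"
  shows "(\<Sum>j<n. c j * \<phi> j + e j * \<phi> (Suc j))
    = c 0 * \<phi> 0 + (\<Sum>j=1..<n. (c j + e (j - 1)) * \<phi> j) + e (n - 1) * \<phi> n"
  using assms
proof (induction n rule: nat_induct_non_zero)
  case 1 then show ?case by simp
next
  case (Suc n)
  then show ?case by (cases n) (simp_all add: algebra_simps)
qed

text \<open>The weight \<open>s ^ d\<close> is the density of the layers of a \<open>(d + 1)\<close>-dimensional cone at distance \<open>s\<close> from its apex.
  The integral is scaled to the unit interval so that, in iterated integrals over cones, the domains of
  integration do not depend on the outer variables.\<close>

lemma trapezoid_power_weight:
  fixes \<phi> :: "real \<Rightarrow> real" and c e :: "nat \<Rightarrow> real"
  assumes n: "n > 0" and conv: "convex_on {0..real n} \<phi>" and cont: "continuous_on {0..real n} \<phi>"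
    and c: "\<And>j. c j = (real j + 1) * (((real j + 1) ^ Suc d - real j ^ Suc d) / real (Suc d))
      - ((real j + 1) ^ Suc (Suc d) - real j ^ Suc (Suc d)) / real (Suc (Suc d))"
    and e: "\<And>j. e j = ((real j + 1) ^ Suc (Suc d) - real j ^ Suc (Suc d)) / real (Suc (Suc d))
      - real j * (((real j + 1) ^ Suc d - real j ^ Suc d) / real (Suc d))"
  shows "real n ^ Suc d * integral {0..1} (\<lambda>s. s ^ d * \<phi> (real n * s))
    \<le> c 0 * \<phi> 0 + (\<Sum>j=1..<n. (c j + e (j - 1)) * \<phi> (real j)) + e (n - 1) * \<phi> (real n)"
proof -
  have "real n ^ Suc d * integral {0..1} (\<lambda>s. s ^ d * \<phi> (real n * s)) = integral {0..real n} (\<lambda>x. x ^ d * \<phi> x)"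
    using n by (intro integral_rescale) simp
  also have "\<dots> \<le> (\<Sum>j<n. c j * \<phi> (real j) + e j * \<phi> (real j + 1))"
  proof (rule integral_le_weighted_trapezoid[OF conv cont])
    show "((\<lambda>x. x ^ d * (real j + 1 - x)) has_integral c j) {real j..real j + 1}"
      and "((\<lambda>x. x ^ d * (x - real j)) has_integral e j) {real j..real j + 1}" for j
      unfolding c e by (rule power_weight_integrals)+
  qed (auto intro!: continuous_intros)
  also have "\<dots> = c 0 * \<phi> 0 + (\<Sum>j=1..<n. (c j + e (j - 1)) * \<phi> (real j)) + e (n - 1) * \<phi> (real n)"
    using sum_split_endpoints[OF n, of c "\<lambda>j. \<phi> (real j)" e] by (simp add: add.commute)
  finally show ?thesis .
qed

lemma trapezoid:
  fixes \<phi> :: "real \<Rightarrow> real"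
  assumes "n > 0" "convex_on {0..real n} \<phi>" "continuous_on {0..real n} \<phi>"
  shows "real n * integral {0..1} (\<lambda>s. \<phi> (real n * s)) \<le> \<phi> 0 / 2 + (\<Sum>j=1..<n. \<phi> (real j)) + \<phi> (real n) / 2"
proof -
  have eq: "(real j + 1) * ((real j + 1 - real j) / 1) - ((real j + 1)\<^sup>2 - (real j)\<^sup>2) / 2 = 1 / 2"
    "((real j + 1)\<^sup>2 - (real j)\<^sup>2) / 2 - real j * ((real j + 1 - real j) / 1) = 1 / 2" for j
    by (simp_all add: power2_eq_square field_simps)
  show ?thesis
    using trapezoid_power_weight[OF assms, of "\<lambda>_. 1/2" 0 "\<lambda>_. 1/2"] eq
    by (simp add: numeral_2_eq_2)
qed

text \<open>In the layers with \<open>0 < j < n\<close> the coefficient is exactly the weight \<open>j\<close>; the defect sits at the two ends.\<close>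

lemma trapezoid_linear_weight:
  fixes \<phi> :: "real \<Rightarrow> real"
  assumes n: "n > 0" and "convex_on {0..real n} \<phi>" "continuous_on {0..real n} \<phi>"
  shows "real n ^ 2 * integral {0..1} (\<lambda>s. s * \<phi> (real n * s))
    \<le> \<phi> 0 / 6 + (\<Sum>j=1..<n. real j * \<phi> (real j)) + (real n / 2 - 1 / 6) * \<phi> (real n)"
proof -
  have "real n ^ Suc 1 * integral {0..1} (\<lambda>s. s ^ 1 * \<phi> (real n * s))
    \<le> (real 0 / 2 + 1 / 6) * \<phi> 0
      + (\<Sum>j=1..<n. ((real j / 2 + 1 / 6) + (real (j - 1) / 2 + 1 / 3)) * \<phi> (real j))
      + (real (n - 1) / 2 + 1 / 3) * \<phi> (real n)"
    by (rule trapezoid_power_weight[OF assms, of "\<lambda>j. real j / 2 + 1 / 6" 1 "\<lambda>j. real j / 2 + 1 / 3"])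
       (simp_all add: field_simps power2_eq_square power3_eq_cube numeral_2_eq_2)
  moreover have "(\<Sum>j=1..<n. ((real j / 2 + 1 / 6) + (real (j - 1) / 2 + 1 / 3)) * \<phi> (real j))
     = (\<Sum>j=1..<n. real j * \<phi> (real j))"
    by (intro sum.cong) (auto simp: of_nat_diff field_simps)
  ultimately show ?thesis using n by (simp add: of_nat_diff field_simps numeral_2_eq_2)
qed

lemma trapezoid_square_weight:
  fixes \<phi> :: "real \<Rightarrow> real"
  assumes n: "n > 0" and "convex_on {0..real n} \<phi>" "continuous_on {0..real n} \<phi>"
  shows "real n ^ 3 * integral {0..1} (\<lambda>s. s ^ 2 * \<phi> (real n * s))
    \<le> \<phi> 0 / 12 + (\<Sum>j=1..<n. (real j ^ 2 + 1 / 6) * \<phi> (real j))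
      + (real n ^ 2 / 2 - real n / 3 + 1 / 12) * \<phi> (real n)"
proof -
  define c where "c = (\<lambda>j. real j ^ 2 / 2 + real j / 3 + 1 / 12)"
  define e where "e = (\<lambda>j. real j ^ 2 / 2 + 2 * real j / 3 + 1 / 4)"
  have "real n ^ Suc 2 * integral {0..1} (\<lambda>s. s ^ 2 * \<phi> (real n * s))
    \<le> c 0 * \<phi> 0 + (\<Sum>j=1..<n. (c j + e (j - 1)) * \<phi> (real j)) + e (n - 1) * \<phi> (real n)"
    by (rule trapezoid_power_weight[OF assms])
       (simp_all add: c_def e_def field_simps power2_eq_square eval_nat_numeral)
  moreover have "(\<Sum>j=1..<n. (c j + e (j - 1)) * \<phi> (real j)) = (\<Sum>j=1..<n. (real j ^ 2 + 1 / 6) * \<phi> (real j))"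
    by (intro sum.cong) (auto simp: c_def e_def of_nat_diff field_simps power2_eq_square)
  moreover have "e (n - 1) = real n ^ 2 / 2 - real n / 3 + 1 / 12"
    using n by (simp add: e_def of_nat_diff field_simps power2_eq_square)
  ultimately show ?thesis by (simp add: c_def numeral_3_eq_3)
qed

section \<open>Convex functions on triangles and tetrahedra\<close>

lemma convex_on_integral_param:
  fixes F :: "'a::real_vector \<Rightarrow> real \<Rightarrow> real"
  assumes A: "convex A" and conv: "\<And>u. u \<in> {0..1} \<Longrightarrow> convex_on A (\<lambda>x. F x u)"
    and int: "\<And>x. x \<in> A \<Longrightarrow> F x integrable_on {0..1}"
  shows "convex_on A (\<lambda>x. integral {0..1} (F x))"
proof (rule convex_onI[OF _ A])
  fix t x y assume t: "0 < t" "t < (1::real)" and xy: "x \<in> A" "y \<in> A"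
  have m: "(1 - t) *\<^sub>R x + t *\<^sub>R y \<in> A"
    using A xy t by (intro convexD_alt) auto
  have "integral {0..1} (F ((1 - t) *\<^sub>R x + t *\<^sub>R y))
    \<le> integral {0..1} (\<lambda>u. (1 - t) * F x u + t * F y u)"
  proof (rule integral_le[OF int[OF m]])
    show "(\<lambda>u. (1 - t) * F x u + t * F y u) integrable_on {0..1}"
      by (intro integrable_add integrable_on_mult_right int xy)
    show "F ((1 - t) *\<^sub>R x + t *\<^sub>R y) u \<le> (1 - t) * F x u + t * F y u" if "u \<in> {0..1}" for u
      using convex_onD[OF conv[OF that], of t x y] t xy by simp
  qed
  also have "\<dots> = (1 - t) * integral {0..1} (F x) + t * integral {0..1} (F y)"
    by (subst integral_add) (simp_all add: int xy integrable_on_mult_right)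
  finally show "integral {0..1} (F ((1 - t) *\<^sub>R x + t *\<^sub>R y)) \<le> \<dots>" .
qed

lemma continuous_on_integral_param:
  fixes F :: "'a::topological_space \<Rightarrow> real \<Rightarrow> real"
  assumes "continuous_on (A \<times> {0..1}) (\<lambda>(x, u). F x u)"
  shows "continuous_on A (\<lambda>x. integral {0..1} (F x))"
  using integral_continuous_on_param[of A 0 1 F] assms by simp

lemma convex_on_compose_affine:
  fixes f :: "'b::real_vector \<Rightarrow> real" and g :: "'a::real_vector \<Rightarrow> 'b"
  assumes f: "convex_on S f" and A: "convex A" and g: "g ` A \<subseteq> S"
    and aff: "\<And>t x y. g ((1 - t) *\<^sub>R x + t *\<^sub>R y) = (1 - t) *\<^sub>R g x + t *\<^sub>R g y"
  shows "convex_on A (\<lambda>x. f (g x))"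
proof (rule convex_onI[OF _ A])
  fix t x y assume "0 < t" "t < (1::real)" "x \<in> A" "y \<in> A"
  then show "f (g ((1 - t) *\<^sub>R x + t *\<^sub>R y)) \<le> (1 - t) * f (g x) + t * f (g y)"
    using convex_onD[OF f, of t "g x" "g y"] g by (auto simp: aff)
qed

definition simplex2 :: "real \<Rightarrow> (real \<times> real) set" where
  "simplex2 r = {(x, y). 0 \<le> x \<and> 0 \<le> y \<and> x + y \<le> r}"

definition simplex3 :: "real \<Rightarrow> (real \<times> real \<times> real) set" where
  "simplex3 r = {(x, y, z). 0 \<le> x \<and> 0 \<le> y \<and> 0 \<le> z \<and> x + y + z \<le> r}"

text \<open>The trapezoidal sum over the lattice points of the segment \<open>x + y = j\<close> in the first quadrant.\<close>

definition edge_sum :: "nat \<Rightarrow> (real \<times> real \<Rightarrow> real) \<Rightarrow> real" where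
  "edge_sum j H = H (0, real j) / 2 + (\<Sum>v=1..<j. H (real v, real j - real v)) + H (real j, 0) / 2"

text \<open>The mean over the segment \<open>x + y = r\<close>, parametrised so that it extends to \<open>r = 0\<close>, with value \<open>H (0, 0)\<close>, and
  inherits convexity in \<open>r\<close> from \<open>H\<close>.\<close>

definition edge_mean :: "(real \<times> real \<Rightarrow> real) \<Rightarrow> real \<Rightarrow> real" where
  "edge_mean H r = integral {0..1} (\<lambda>u. H (r * u, r * (1 - u)))"

text \<open>The integral of \<open>H\<close> over \<open>simplex2 r\<close>, written as an iterated integral over the segments \<open>x + y = r * s\<close>.\<close>

definition triangle_integral :: "real \<Rightarrow> (real \<times> real \<Rightarrow> real) \<Rightarrow> real" where
  "triangle_integral r H = r ^ 2 * integral {0..1} (\<lambda>s. s * edge_mean H (r * s))"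

lemma unit_interval_products:
  fixes u s :: real
  assumes "0 \<le> u" "u \<le> 1" "0 \<le> r"
  shows "0 \<le> r * u" "0 \<le> r * (1 - u)" "r * u + r * (1 - u) = r"
  using assms by (simp_all add: algebra_simps mult_left_le)

lemma edge_point_in_simplex2:
  assumes "0 \<le> u" "u \<le> 1" "0 \<le> r" "r \<le> n"
  shows "(r * u, r * (1 - u)) \<in> simplex2 n"
  using unit_interval_products[of u r] assms by (simp add: simplex2_def)

lemma edge_mean_continuous_convex:
  assumes conv: "convex_on (simplex2 n) H" and cont: "continuous_on (simplex2 n) H"
  shows "continuous_on {0..n} (edge_mean H)" "convex_on {0..n} (edge_mean H)"
proof -
  have "continuous_on ({0..n} \<times> {0..1}) (\<lambda>(r, u). H (r * u, r * (1 - u)))"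
    unfolding case_prod_unfold
    by (rule continuous_on_compose2[OF cont])
       (auto intro!: continuous_intros edge_point_in_simplex2)
  then show "continuous_on {0..n} (edge_mean H)"
    unfolding edge_mean_def by (rule continuous_on_integral_param)
  show "convex_on {0..n} (edge_mean H)"
    unfolding edge_mean_def
  proof (rule convex_on_integral_param)
    show "convex {0..n}" by simp
    fix u :: real assume u: "u \<in> {0..1}"
    show "convex_on {0..n} (\<lambda>r. H (r * u, r * (1 - u)))"
      by (rule convex_on_compose_affine[OF conv])
         (simp, use u in \<open>auto intro!: edge_point_in_simplex2\<close>, simp_all add: algebra_simps)
  next
    fix r :: real assume r: "r \<in> {0..n}"
    show "(\<lambda>u. H (r * u, r * (1 - u))) integrable_on {0..1}"
      by (rule integrable_continuous_real, rule continuous_on_compose2[OF cont])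
         (use r in \<open>auto intro!: continuous_intros edge_point_in_simplex2\<close>)
  qed
qed

lemma edge_mean_le_edge_sum:
  assumes conv: "convex_on (simplex2 (real n)) H" and cont: "continuous_on (simplex2 (real n)) H"
    and j: "0 < j" "j \<le> n"
  shows "real j * edge_mean H (real j) \<le> edge_sum j H"
proof -
  define \<eta> where "\<eta> = (\<lambda>v. H (v, real j - v))"
  have "convex_on {0..real j} \<eta>"
    unfolding \<eta>_def
    by (rule convex_on_compose_affine[OF conv]) (use j in \<open>auto simp: simplex2_def algebra_simps\<close>)
  moreover have "continuous_on {0..real j} \<eta>"
    unfolding \<eta>_def
    by (rule continuous_on_compose2[OF cont]) (use j in \<open>auto intro!: continuous_intros simp: simplex2_def\<close>)
  ultimately have "real j * integral {0..1} (\<lambda>u. \<eta> (real j * u))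
      \<le> \<eta> 0 / 2 + (\<Sum>v=1..<j. \<eta> (real v)) + \<eta> (real j) / 2"
    by (rule trapezoid[OF j(1)])
  then show ?thesis
    by (simp add: \<eta>_def edge_mean_def edge_sum_def algebra_simps)
qed

lemma triangle_integral_le_edge_sums:
  assumes conv: "convex_on (simplex2 (real n)) H" and cont: "continuous_on (simplex2 (real n)) H"
    and n: "0 < n"
  shows "triangle_integral (real n) H
    \<le> H (0, 0) / 6 + (\<Sum>j=1..<n. edge_sum j H) + (1 / 2 - 1 / (6 * real n)) * edge_sum n H"
proof -
  note em = edge_mean_continuous_convex[OF conv cont]
  have "triangle_integral (real n) H
    \<le> edge_mean H 0 / 6 + (\<Sum>j=1..<n. real j * edge_mean H (real j)) + (real n / 2 - 1 / 6) * edge_mean H (real n)"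
    unfolding triangle_integral_def by (rule trapezoid_linear_weight[OF n em(2,1)])
  also have "edge_mean H 0 = H (0, 0)" by (simp add: edge_mean_def)
  also have "(\<Sum>j=1..<n. real j * edge_mean H (real j)) \<le> (\<Sum>j=1..<n. edge_sum j H)"
    by (intro sum_mono edge_mean_le_edge_sum[OF conv cont]) auto
  also have "(real n / 2 - 1 / 6) * edge_mean H (real n) = (1 / 2 - 1 / (6 * real n)) * (real n * edge_mean H (real n))"
    using n by (simp add: field_simps)
  also have "\<dots> \<le> (1 / 2 - 1 / (6 * real n)) * edge_sum n H"
    using n by (intro mult_left_mono edge_mean_le_edge_sum[OF conv cont]) (auto simp: field_simps)
  finally show ?thesis by simp
qed

text \<open>A cruder bound than \<open>triangle_integral_le_edge_sums\<close> that only involves the vertex \<open>(0, 0)\<close> and the opposite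
  edge; it controls the small multiple \<open>1 / (6 r\<^sup>2)\<close> of a slice by the rim of that slice.\<close>

lemma triangle_integral_le_chord:
  assumes conv: "convex_on (simplex2 (real n)) H" and cont: "continuous_on (simplex2 (real n)) H"
    and n: "0 < n"
  shows "triangle_integral (real n) H \<le> real n ^ 2 / 6 * H (0, 0) + real n / 3 * edge_sum n H"
proof -
  note em = edge_mean_continuous_convex[OF conv cont]
  have pw: "((\<lambda>s. s ^ d) has_integral 1 / real (Suc d)) {0..1::real}" for d
    using has_integral_power_segment[of 0 1 d] by simp
  have "integral {0..1} (\<lambda>s. s * edge_mean H (real n * s))
    \<le> integral {0..1} (\<lambda>s. edge_mean H 0 * (s ^ 1 - s ^ 2) + edge_mean H (real n) * s ^ 2)"
  proof (rule integral_le)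
    show "(\<lambda>s. s * edge_mean H (real n * s)) integrable_on {0..1}"
      by (intro integrable_continuous_real continuous_intros continuous_on_compose2[OF em(1)])
         (auto simp: mult_left_le)
    show "(\<lambda>s. edge_mean H 0 * (s ^ 1 - s ^ 2) + edge_mean H (real n) * s ^ 2) integrable_on {0..1}"
      by (intro integrable_continuous_real continuous_intros)
    fix s :: real assume s: "s \<in> {0..1}"
    have "edge_mean H ((1 - s) *\<^sub>R 0 + s *\<^sub>R real n) \<le> (1 - s) * edge_mean H 0 + s * edge_mean H (real n)"
      using s by (intro convex_onD[OF em(2)]) auto
    then have "s * edge_mean H (real n * s) \<le> s * ((1 - s) * edge_mean H 0 + s * edge_mean H (real n))"
      using s by (intro mult_left_mono) (auto simp: mult.commute)
    then show "s * edge_mean H (real n * s) \<le> edge_mean H 0 * (s ^ 1 - s ^ 2) + edge_mean H (real n) * s ^ 2"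
      by (simp add: algebra_simps power2_eq_square)
  qed
  also have "\<dots> = edge_mean H 0 * (1 / 2 - 1 / 3) + edge_mean H (real n) * (1 / 3)"
    by (rule integral_unique)
       (use pw[of 1] pw[of 2] in \<open>intro has_integral_add has_integral_mult_right has_integral_diff, simp_all\<close>)
  finally have "triangle_integral (real n) H
      \<le> real n ^ 2 * (edge_mean H 0 * (1 / 2 - 1 / 3) + edge_mean H (real n) * (1 / 3))"
    unfolding triangle_integral_def by (intro mult_left_mono) auto
  also have "\<dots> = real n ^ 2 / 6 * H (0, 0) + real n / 3 * (real n * edge_mean H (real n))"
    by (simp add: edge_mean_def power2_eq_square field_simps)
  also have "\<dots> \<le> real n ^ 2 / 6 * H (0, 0) + real n / 3 * edge_sum n H"
    using n edge_mean_le_edge_sum[OF conv cont n] by (intro add_left_mono mult_left_mono) auto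
  finally show ?thesis .
qed

text \<open>The following two expressions are both the integral of \<open>h\<close> over \<open>simplex3 k\<close>
  (see \<open>has_integral_simplex3\<close> for \<open>k = 1\<close>). Here the tetrahedron is the cone with apex \<open>(0, 0, k)\<close> over its horizontal
  face, and \<open>k * r\<close> is the size of the slice at height \<open>k - k * r\<close>.\<close>

definition apex_cone_integral :: "real \<Rightarrow> (real \<times> real \<times> real \<Rightarrow> real) \<Rightarrow> real" where
  "apex_cone_integral k h = k ^ 3 * integral {0..1} (\<lambda>r. r ^ 2 * integral {0..1} (\<lambda>s. s *
     integral {0..1} (\<lambda>u. h (k * r * s * u, k * r * s * (1 - u), k * (1 - r)))))"

text \<open>Here the tetrahedron is the cone with apex \<open>0\<close> over the face \<open>x + y + z = k\<close>.\<close>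

definition origin_cone_integral :: "real \<Rightarrow> (real \<times> real \<times> real \<Rightarrow> real) \<Rightarrow> real" where
  "origin_cone_integral k h = k ^ 3 * integral {0..1} (\<lambda>r. r ^ 2 * integral {0..1} (\<lambda>s. s *
     integral {0..1} (\<lambda>u. h (k * r * s * u, k * r * s * (1 - u), k * r * (1 - s)))))"

lemma apex_point_in_simplex3:
  assumes "u \<in> {0..1}" "s \<in> {0..1}" "0 \<le> r" "r \<le> k"
  shows "(r * s * u, r * s * (1 - u), k - r) \<in> simplex3 k"
proof -
  have "r * s \<le> r" using assms by (simp add: mult_left_le)
  then show ?thesis
    using unit_interval_products[of u "r * s"] assms by (simp add: simplex3_def)
qed

lemma origin_point_in_simplex3:
  assumes "u \<in> {0..1}" "s \<in> {0..1}" "0 \<le> r" "r \<le> k"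
  shows "(r * s * u, r * s * (1 - u), r * (1 - s)) \<in> simplex3 k"
  using unit_interval_products[of u "r * s"] unit_interval_products[of s r] assms
  by (simp add: simplex3_def)

text \<open>The mean of \<open>h\<close> over the slice of size \<open>r\<close> is convex in \<open>r\<close>, because the slices are scaled towards the
  apex by affine maps. The square weight trapezoid rule then applies; its coefficient \<open>r\<^sup>2 + 1 / 6\<close> makes the
  factor \<open>1 + 1 / (6 r\<^sup>2)\<close>.\<close>

lemma apex_cone_integral_le_slices:
  assumes conv: "convex_on (simplex3 (real k)) h" and cont: "continuous_on (simplex3 (real k)) h"
    and k: "0 < k"
  shows "apex_cone_integral (real k) h \<le> h (0, 0, real k) / 24
    + (\<Sum>r=1..<k. (1 + 1 / (6 * real r ^ 2)) * triangle_integral (real r) (\<lambda>(x, y). h (x, y, real k - real r)))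
    + (1 / 2 - 1 / (3 * real k) + 1 / (12 * real k ^ 2)) * triangle_integral (real k) (\<lambda>(x, y). h (x, y, 0))"
proof -
  define \<phi> where "\<phi> = (\<lambda>r. integral {0..1} (\<lambda>s. s *
     integral {0..1} (\<lambda>u. h (r * s * u, r * s * (1 - u), real k - r))))"
  have c3: "continuous_on (({0..real k} \<times> {0..1}) \<times> {0..1})
      (\<lambda>x. h (fst (fst x) * snd (fst x) * snd x, fst (fst x) * snd (fst x) * (1 - snd x), real k - fst (fst x)))"
    by (rule continuous_on_compose2[OF cont])
       (auto intro!: continuous_intros apex_point_in_simplex3)
  have c2: "continuous_on ({0..real k} \<times> {0..1})
     (\<lambda>x. integral {0..1} (\<lambda>u. h (fst x * snd x * u, fst x * snd x * (1 - u), real k - fst x)))"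
    by (rule continuous_on_integral_param) (use c3 in \<open>simp add: case_prod_unfold\<close>)
  have c1: "continuous_on {0..real k} \<phi>"
    unfolding \<phi>_def
    by (rule continuous_on_integral_param) (use c2 in \<open>auto simp: case_prod_unfold intro!: continuous_intros\<close>)
  have conv1: "convex_on {0..real k} (\<lambda>r. h (r * s * u, r * s * (1 - u), real k - r))"
    if "s \<in> {0..1}" "u \<in> {0..1}" for s u
    by (rule convex_on_compose_affine[OF conv])
       (simp, use that in \<open>auto intro!: apex_point_in_simplex3\<close>, simp_all add: algebra_simps)
  have i3: "(\<lambda>u. h (r * s * u, r * s * (1 - u), real k - r)) integrable_on {0..1}"
    if "r \<in> {0..real k}" "s \<in> {0..1}" for r s
    by (rule integrable_continuous_real, rule continuous_on_compose2[OF cont])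
       (use that in \<open>auto intro!: continuous_intros apex_point_in_simplex3\<close>)
  have conv2: "convex_on {0..real k} (\<lambda>r. integral {0..1} (\<lambda>u. h (r * s * u, r * s * (1 - u), real k - r)))"
    if "s \<in> {0..1}" for s
    by (rule convex_on_integral_param[OF _ conv1[OF that] i3]) (use that in auto)
  have i2: "(\<lambda>s. s * integral {0..1} (\<lambda>u. h (r * s * u, r * s * (1 - u), real k - r))) integrable_on {0..1}"
    if "r \<in> {0..real k}" for r
    by (intro integrable_continuous_real continuous_intros
          continuous_on_compose2[OF c2, where f = "\<lambda>s. (r, s)", simplified])
       (use that in auto)
  have conv3: "convex_on {0..real k} \<phi>"
    unfolding \<phi>_def
    by (rule convex_on_integral_param[OF _ _ i2]) (auto intro!: convex_on_cmul conv2)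
  have "apex_cone_integral (real k) h = real k ^ 3 * integral {0..1} (\<lambda>r. r ^ 2 * \<phi> (real k * r))"
    by (simp add: apex_cone_integral_def \<phi>_def algebra_simps)
  also have "\<dots> \<le> \<phi> 0 / 12 + (\<Sum>r=1..<k. (real r ^ 2 + 1 / 6) * \<phi> (real r))
      + (real k ^ 2 / 2 - real k / 3 + 1 / 12) * \<phi> (real k)"
    by (rule trapezoid_square_weight[OF k conv3 c1])
  also have "\<phi> 0 = h (0, 0, real k) / 2"
    using has_integral_power_segment[of 0 1 1] by (simp add: \<phi>_def integral_unique)
  also have tri: "real r ^ 2 * \<phi> (real r) = triangle_integral (real r) (\<lambda>(x, y). h (x, y, real k - real r))" for r
    by (simp add: \<phi>_def triangle_integral_def edge_mean_def)
  have "(\<Sum>r=1..<k. (real r ^ 2 + 1 / 6) * \<phi> (real r))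
    = (\<Sum>r=1..<k. (1 + 1 / (6 * real r ^ 2)) * triangle_integral (real r) (\<lambda>(x, y). h (x, y, real k - real r)))"
    unfolding tri[symmetric] by (intro sum.cong) (auto simp: field_simps)
  also have "(real k ^ 2 / 2 - real k / 3 + 1 / 12) * \<phi> (real k)
    = (1 / 2 - 1 / (3 * real k) + 1 / (12 * real k ^ 2)) * triangle_integral (real k) (\<lambda>(x, y). h (x, y, 0))"
    using tri[of k] k by (simp add: field_simps power2_eq_square flip: tri[of k, simplified])
  finally show ?thesis by simp
qed

text \<open>Convexity and \<open>h 0 = 0\<close> give \<open>h (r p) \<le> r h p\<close>. The layer at distance \<open>r\<close> has weight \<open>r\<^sup>2\<close>, so the integral is
  at most \<open>\<integral>r\<^sup>3 = 1 / 4\<close> times the contribution of the outer face.\<close>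

lemma origin_cone_integral_le:
  assumes conv: "convex_on (simplex3 (real k)) h" and cont: "continuous_on (simplex3 (real k)) h"
    and h0: "h (0, 0, 0) = 0"
  shows "origin_cone_integral (real k) h \<le> real k / 4 * triangle_integral (real k) (\<lambda>(x, y). h (x, y, real k - x - y))"
proof -
  define \<psi> where "\<psi> = (\<lambda>r s. integral {0..1} (\<lambda>u. h (real k * r * s * u, real k * r * s * (1 - u), real k * r * (1 - s))))"
  define G where "G = (\<lambda>r. integral {0..1} (\<lambda>s. s * \<psi> r s))"
  have kr: "real k * r \<le> real k" if "r \<in> {0..1}" for r using that by (simp add: mult_left_le)
  have c3: "continuous_on (({0..1} \<times> {0..1}) \<times> {0..1})
      (\<lambda>x. h (real k * fst (fst x) * snd (fst x) * snd x, real k * fst (fst x) * snd (fst x) * (1 - snd x),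
        real k * fst (fst x) * (1 - snd (fst x))))"
    by (rule continuous_on_compose2[OF cont])
       (auto intro!: continuous_intros origin_point_in_simplex3 kr)
  have c2: "continuous_on ({0..1} \<times> {0..1}) (\<lambda>x. \<psi> (fst x) (snd x))"
    unfolding \<psi>_def
    by (rule continuous_on_integral_param) (use c3 in \<open>simp add: case_prod_unfold\<close>)
  have c1: "continuous_on {0..1} G"
    unfolding G_def
    by (rule continuous_on_integral_param) (use c2 in \<open>auto simp: case_prod_unfold intro!: continuous_intros\<close>)
  have i3: "(\<lambda>u. h (real k * r * s * u, real k * r * s * (1 - u), real k * r * (1 - s))) integrable_on {0..1}"
    if "r \<in> {0..1}" "s \<in> {0..1}" for r s
    by (rule integrable_continuous_real, rule continuous_on_compose2[OF cont])
       (use that in \<open>auto intro!: continuous_intros origin_point_in_simplex3 kr\<close>)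
  have i2: "(\<lambda>s. s * \<psi> r s) integrable_on {0..1}" if "r \<in> {0..1}" for r
    by (intro integrable_continuous_real continuous_intros
          continuous_on_compose2[OF c2, where f = "\<lambda>s. (r, s)", simplified])
       (use that in auto)
  have \<psi>: "\<psi> r s \<le> r * \<psi> 1 s" if r: "r \<in> {0..1}" and s: "s \<in> {0..1}" for r s
  proof -
    have "\<psi> r s \<le> integral {0..1} (\<lambda>u. r * h (real k * 1 * s * u, real k * 1 * s * (1 - u), real k * 1 * (1 - s)))"
      unfolding \<psi>_def
    proof (rule integral_le[OF i3[OF r s]])
      show "(\<lambda>u. r * h (real k * 1 * s * u, real k * 1 * s * (1 - u), real k * 1 * (1 - s))) integrable_on {0..1}"
        using i3[of 1 s] s by (intro integrable_on_mult_right) auto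
      fix u :: real assume u: "u \<in> {0..1}"
      have "h ((1 - r) *\<^sub>R (0, 0, 0) + r *\<^sub>R (real k * s * u, real k * s * (1 - u), real k * (1 - s)))
         \<le> (1 - r) * h (0, 0, 0) + r * h (real k * s * u, real k * s * (1 - u), real k * (1 - s))"
        using r u s by (intro convex_onD[OF conv] origin_point_in_simplex3) (auto simp: simplex3_def)
      then show "h (real k * r * s * u, real k * r * s * (1 - u), real k * r * (1 - s))
        \<le> r * h (real k * 1 * s * u, real k * 1 * s * (1 - u), real k * 1 * (1 - s))"
        by (simp add: h0 algebra_simps)
    qed
    then show ?thesis by (simp add: \<psi>_def)
  qed
  have G: "G r \<le> r * G 1" if r: "r \<in> {0..1}" for r
  proof -
    have "G r \<le> integral {0..1} (\<lambda>s. r * (s * \<psi> 1 s))"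
      unfolding G_def
    proof (rule integral_le[OF i2[OF r]])
      show "(\<lambda>s. r * (s * \<psi> 1 s)) integrable_on {0..1}"
        by (intro integrable_on_mult_right i2) auto
      show "s * \<psi> r s \<le> r * (s * \<psi> 1 s)" if "s \<in> {0..1}" for s
        using mult_left_mono[OF \<psi>[OF r that], of s] that by (simp add: mult.left_commute)
    qed
    then show ?thesis by (simp add: G_def)
  qed
  have "origin_cone_integral (real k) h = real k ^ 3 * integral {0..1} (\<lambda>r. r ^ 2 * G r)"
    by (simp add: origin_cone_integral_def G_def \<psi>_def)
  also have "integral {0..1} (\<lambda>r. r ^ 2 * G r) \<le> integral {0..1} (\<lambda>r. r ^ 3 * G 1)"
  proof (rule integral_le)
    show "(\<lambda>r. r ^ 2 * G r) integrable_on {0..1}"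
      by (intro integrable_continuous_real continuous_intros c1)
    show "(\<lambda>r. r ^ 3 * G 1) integrable_on {0..1}"
      by (intro integrable_continuous_real continuous_intros)
    show "r ^ 2 * G r \<le> r ^ 3 * G 1" if "r \<in> {0..1}" for r
      using mult_left_mono[OF G[OF that], of "r ^ 2"] by (simp add: power2_eq_square power3_eq_cube)
  qed
  also have "integral {0..1} (\<lambda>r. r ^ 3 * G 1) = G 1 / 4"
    using integral_unique[OF has_integral_mult_left[OF has_integral_power_segment[of 0 1 3], of "G 1"]] by simp
  also have "real k ^ 3 * (G 1 / 4) = real k / 4 * triangle_integral (real k) (\<lambda>(x, y). h (x, y, real k - x - y))"
    by (simp add: G_def \<psi>_def triangle_integral_def edge_mean_def algebra_simps power2_eq_square power3_eq_cube)
  finally show ?thesis by (simp add: mult_left_mono)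
qed

section \<open>Integration over a tetrahedron by cones\<close>

text \<open>Tonelli's theorem after the substitutions \<open>x + y = r s\<close> and \<open>x = r s u\<close>.\<close>

lemma nn_integral_quadrant_polar:
  fixes P :: "real \<Rightarrow> real \<Rightarrow> ennreal"
  assumes meas: "case_prod P \<in> borel_measurable (borel \<Otimes>\<^sub>M borel)" and r: "0 < r"
    and supp: "\<And>x y. (x, y) \<notin> simplex2 r \<Longrightarrow> P x y = 0"
  shows "(\<integral>\<^sup>+x. \<integral>\<^sup>+y. P x y \<partial>lborel \<partial>lborel)
    = ennreal (r ^ 2) * (\<integral>\<^sup>+s\<in>{0..1}. ennreal s * (\<integral>\<^sup>+u\<in>{0..1}. P (r * s * u) (r * s * (1 - u)) \<partial>lborel) \<partial>lborel)"
proof -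
  have Pm [measurable (raw)]: "(\<lambda>x. P (a x) (b x)) \<in> borel_measurable M"
    if "a \<in> borel_measurable M" "b \<in> borel_measurable M" for a b and M :: "'z measure"
    using measurable_compose[OF measurable_Pair[OF that] meas] by simp
  have "(\<integral>\<^sup>+x. \<integral>\<^sup>+y. P x y \<partial>lborel \<partial>lborel) = (\<integral>\<^sup>+x. \<integral>\<^sup>+c. P x (c - x) \<partial>lborel \<partial>lborel)"
  proof (rule nn_integral_cong)
    show "(\<integral>\<^sup>+y. P x y \<partial>lborel) = (\<integral>\<^sup>+c. P x (c - x) \<partial>lborel)" for x
      by (subst nn_integral_real_affine[where c = 1 and t = "- x"]) simp_all
  qed
  also have "\<dots> = (\<integral>\<^sup>+c. \<integral>\<^sup>+x. P x (c - x) \<partial>lborel \<partial>lborel)"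
    by (rule lborel_pair.Fubini') simp
  also have "\<dots> = ennreal r * (\<integral>\<^sup>+s. \<integral>\<^sup>+x. P x (r * s - x) \<partial>lborel \<partial>lborel)"
    by (subst nn_integral_real_affine[where c = r and t = 0]) (use r in simp_all)
  also have "(\<integral>\<^sup>+s. \<integral>\<^sup>+x. P x (r * s - x) \<partial>lborel \<partial>lborel)
    = (\<integral>\<^sup>+s\<in>{0..1}. ennreal r * (ennreal s * (\<integral>\<^sup>+u\<in>{0..1}. P (r * s * u) (r * s * (1 - u)) \<partial>lborel)) \<partial>lborel)"
  proof (rule nn_integral_cong_AE, rule AE_mp[OF AE_lborel_singleton[of 0]], rule AE_I2, intro impI)
    fix s :: real assume s0: "s \<noteq> 0"
    consider "s < 0" | "0 < s" "s \<le> 1" | "1 < s" using s0 by linarith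
    then show "(\<integral>\<^sup>+x. P x (r * s - x) \<partial>lborel)
      = ennreal r * (ennreal s * (\<integral>\<^sup>+u\<in>{0..1}. P (r * s * u) (r * s * (1 - u)) \<partial>lborel)) * indicator {0..1} s"
    proof cases
      case 1
      then have "r * s < 0" using r by (simp add: mult_pos_neg)
      then have "P x (r * s - x) = 0" for x by (intro supp) (auto simp: simplex2_def)
      with 1 show ?thesis by simp
    next
      case 3
      then have "r * s > r" using r by simp
      then have "P x (r * s - x) = 0" for x by (intro supp) (auto simp: simplex2_def)
      with 3 show ?thesis by simp
    next
      case 2
      have "(\<integral>\<^sup>+x. P x (r * s - x) \<partial>lborel) = ennreal (r * s) * (\<integral>\<^sup>+u. P (r * s * u) (r * s - r * s * u) \<partial>lborel)"
        by (subst nn_integral_real_affine[where c = "r * s" and t = 0]) (use r 2 in simp_all)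
      also have "(\<integral>\<^sup>+u. P (r * s * u) (r * s - r * s * u) \<partial>lborel)
         = (\<integral>\<^sup>+u\<in>{0..1}. P (r * s * u) (r * s * (1 - u)) \<partial>lborel)"
      proof (rule nn_integral_cong)
        fix u :: real
        have "P (r * s * u) (r * s - r * s * u) = 0" if "u \<notin> {0..1}"
        proof (rule supp)
          have "0 < r * s" using r 2 by simp
          then have "0 \<le> r * s * u \<longleftrightarrow> 0 \<le> u" "0 \<le> r * s * (1 - u) \<longleftrightarrow> 0 \<le> 1 - u"
            using zero_le_mult_iff[of "r * s" u] zero_le_mult_iff[of "r * s" "1 - u"] by linarith+
          then show "(r * s * u, r * s - r * s * u) \<notin> simplex2 r"
            using that by (auto simp: simplex2_def right_diff_distrib)
        qed
        then show "P (r * s * u) (r * s - r * s * u) = P (r * s * u) (r * s * (1 - u)) * indicator {0..1} u"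
          by (auto simp: right_diff_distrib indicator_def)
      qed
      finally show ?thesis using r 2 by (simp add: ennreal_mult mult.assoc)
    qed
  qed
  also have "\<dots> = ennreal r * (\<integral>\<^sup>+s\<in>{0..1}. ennreal s * (\<integral>\<^sup>+u\<in>{0..1}. P (r * s * u) (r * s * (1 - u)) \<partial>lborel) \<partial>lborel)"
    by (subst nn_integral_cmult[symmetric]) (auto simp: mult.assoc)
  finally show ?thesis using r by (simp add: power2_eq_square ennreal_mult mult.assoc)
qed

lemma nn_integral_unit_interval:
  fixes \<eta> :: "real \<Rightarrow> real"
  assumes "continuous_on {0..1} \<eta>" "\<And>u. u \<in> {0..1} \<Longrightarrow> 0 \<le> \<eta> u"
  shows "(\<integral>\<^sup>+u\<in>{0..1}. ennreal (\<eta> u) \<partial>lborel) = ennreal (integral {0..1} \<eta>)"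
  by (rule nn_integral_has_integral_lebesgue')
     (use assms in \<open>auto intro: integrable_integral integrable_continuous_real\<close>)

lemma nn_integral_iterated_unit_cube:
  fixes F :: "real \<Rightarrow> real \<Rightarrow> real \<Rightarrow> real"
  assumes cont: "continuous_on (({0..1} \<times> {0..1}) \<times> {0..1}) (\<lambda>x. F (fst (fst x)) (snd (fst x)) (snd x))"
    and pos: "\<And>r s u. \<lbrakk>r \<in> {0..1}; s \<in> {0..1}; u \<in> {0..1}\<rbrakk> \<Longrightarrow> 0 \<le> F r s u"
  shows "(\<integral>\<^sup>+r\<in>{0..1}. ennreal (r ^ 2) * (\<integral>\<^sup>+s\<in>{0..1}. ennreal s *
      (\<integral>\<^sup>+u\<in>{0..1}. ennreal (F r s u) \<partial>lborel) \<partial>lborel) \<partial>lborel)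
    = ennreal (integral {0..1} (\<lambda>r. r ^ 2 * integral {0..1} (\<lambda>s. s * integral {0..1} (F r s))))" (is "?lhs = ennreal ?I")
    and "0 \<le> integral {0..1} (\<lambda>r. r ^ 2 * integral {0..1} (\<lambda>s. s * integral {0..1} (F r s)))"
proof -
  define \<psi> where "\<psi> = (\<lambda>r s. integral {0..1} (F r s))"
  define G where "G = (\<lambda>r. integral {0..1} (\<lambda>s. s * \<psi> r s))"
  have c2: "continuous_on ({0..1} \<times> {0..1}) (\<lambda>x. \<psi> (fst x) (snd x))"
    unfolding \<psi>_def
    by (rule continuous_on_integral_param) (use cont in \<open>simp add: case_prod_unfold\<close>)
  have c1: "continuous_on {0..1} G"
    unfolding G_def
    by (rule continuous_on_integral_param) (use c2 in \<open>auto simp: case_prod_unfold intro!: continuous_intros\<close>)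
  have cF: "continuous_on {0..1} (F r s)" if "r \<in> {0..1}" "s \<in> {0..1}" for r s
    by (rule continuous_on_compose2[OF cont, where f = "\<lambda>u. ((r, s), u)", simplified])
       (use that in \<open>auto intro!: continuous_intros\<close>)
  have \<psi>: "(\<integral>\<^sup>+u\<in>{0..1}. ennreal (F r s u) \<partial>lborel) = ennreal (\<psi> r s)" "0 \<le> \<psi> r s"
    if "r \<in> {0..1}" "s \<in> {0..1}" for r s
    unfolding \<psi>_def
    by (rule nn_integral_unit_interval[OF cF[OF that] pos[OF that]], assumption)
       (intro integral_nonneg integrable_continuous_real cF pos that)
  have cp: "continuous_on {0..1} (\<lambda>s. s * \<psi> r s)" if "r \<in> {0..1}" for r
    by (intro continuous_intros continuous_on_compose2[OF c2, where f = "\<lambda>s. (r, s)", simplified])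
       (use that in auto)
  have G: "(\<integral>\<^sup>+s\<in>{0..1}. ennreal (s * \<psi> r s) \<partial>lborel) = ennreal (G r)" "0 \<le> G r"
    if "r \<in> {0..1}" for r
    unfolding G_def
    by (rule nn_integral_unit_interval[OF cp[OF that]], use \<psi>(2)[OF that] in simp)
       (intro integral_nonneg integrable_continuous_real cp mult_nonneg_nonneg \<psi>(2) that, auto)
  have "(\<integral>\<^sup>+r\<in>{0..1}. ennreal (r ^ 2) * (\<integral>\<^sup>+s\<in>{0..1}. ennreal s *
      (\<integral>\<^sup>+u\<in>{0..1}. ennreal (F r s u) \<partial>lborel) \<partial>lborel) \<partial>lborel) = (\<integral>\<^sup>+r\<in>{0..1}. ennreal (r ^ 2 * G r) \<partial>lborel)"
  proof (intro set_nn_integral_cong refl)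
    fix r assume "r \<in> space lborel \<inter> {0..1::real}"
    then have r: "r \<in> {0..1}" by simp
    have "(\<integral>\<^sup>+s\<in>{0..1}. ennreal s * (\<integral>\<^sup>+u\<in>{0..1}. ennreal (F r s u) \<partial>lborel) \<partial>lborel)
      = (\<integral>\<^sup>+s\<in>{0..1}. ennreal (s * \<psi> r s) \<partial>lborel)"
      by (intro set_nn_integral_cong refl) (use r in \<open>simp add: \<psi> ennreal_mult\<close>)
    then show "ennreal (r ^ 2) * (\<integral>\<^sup>+s\<in>{0..1}. ennreal s * (\<integral>\<^sup>+u\<in>{0..1}. ennreal (F r s u) \<partial>lborel) \<partial>lborel)
      = ennreal (r ^ 2 * G r)"
      using G[OF r] by (simp add: ennreal_mult)
  qed
  also have "\<dots> = ennreal (integral {0..1} (\<lambda>r. r ^ 2 * G r))"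
    by (rule nn_integral_unit_interval) (intro continuous_intros c1 mult_nonneg_nonneg G(2) zero_le_power2 | assumption)+
  finally show "?lhs = ennreal ?I" by (simp add: G_def \<psi>_def)
  have "0 \<le> integral {0..1} (\<lambda>r. r ^ 2 * G r)"
    by (rule integral_nonneg) (auto intro!: integrable_continuous_real continuous_intros c1 mult_nonneg_nonneg G(2))
  then show "0 \<le> ?I" by (simp add: G_def \<psi>_def)
qed

lemma closed_simplex3: "closed (simplex3 k)"
proof -
  have "simplex3 k = {p. 0 \<le> fst p} \<inter> {p. 0 \<le> fst (snd p)} \<inter> {p. 0 \<le> snd (snd p)}
      \<inter> {p. fst p + fst (snd p) + snd (snd p) \<le> k}"
    by (auto simp: simplex3_def)
  then show ?thesis by (auto intro!: closed_Int closed_Collect_le continuous_intros)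
qed

text \<open>The horizontal slices are reached by substituting \<open>1 - r\<close> for \<open>z\<close>, the layers around the origin by substituting
  \<open>r - x - y\<close> for \<open>z\<close>; both substitutions preserve the measure on each vertical line.\<close>

lemma has_integral_simplex3:
  fixes g :: "real \<times> real \<times> real \<Rightarrow> real"
  assumes cont: "continuous_on (simplex3 1) g" and pos: "\<And>p. p \<in> simplex3 1 \<Longrightarrow> 0 \<le> g p"
  shows "(g has_integral apex_cone_integral 1 g) (simplex3 1)" 
    and "(g has_integral origin_cone_integral 1 g) (simplex3 1)"
proof -
  define g' where "g' = (\<lambda>p. indicat_real (simplex3 1) p * g p)"
  have g'm: "g' \<in> borel_measurable borel"
    using borel_measurable_continuous_on_indicator[OF _ cont] closed_simplex3 by (simp add: g'_def)
  have g'pos: "0 \<le> g' p" for p using pos by (simp add: g'_def indicator_def)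
  define G where "G = (\<lambda>x y z. ennreal (g' (x, y, z)))"
  have Gm [measurable (raw)]: "(\<lambda>x. G (a x) (b x) (c x)) \<in> borel_measurable M"
    if "a \<in> borel_measurable M" "b \<in> borel_measurable M" "c \<in> borel_measurable M" for a b c and M :: "'z measure"
  proof -
    have "(\<lambda>x. (a x, b x, c x)) \<in> M \<rightarrow>\<^sub>M borel \<Otimes>\<^sub>M borel \<Otimes>\<^sub>M borel"
      using that by measurable
    then have "(\<lambda>x. (a x, b x, c x)) \<in> M \<rightarrow>\<^sub>M borel" by (simp add: borel_prod)
    from measurable_compose[OF this g'm] show ?thesis by (simp add: G_def)
  qed
  have G0: "G x y z = 0" if "(x, y, z) \<notin> simplex3 1" for x y z
    using that by (simp add: G_def g'_def)
  have total: "(\<integral>\<^sup>+p. ennreal (g' p) \<partial>lborel) = (\<integral>\<^sup>+x. \<integral>\<^sup>+y. \<integral>\<^sup>+z. G x y z \<partial>lborel \<partial>lborel \<partial>lborel)"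
  proof -
    have m1: "(\<lambda>p. ennreal (g' p)) \<in> borel_measurable (lborel \<Otimes>\<^sub>M lborel)"
      using g'm by (simp add: lborel_prod)
    have m2: "(\<lambda>q. ennreal (g' (x, q))) \<in> borel_measurable (lborel \<Otimes>\<^sub>M lborel)" for x
      using measurable_compose[OF _ m1, of "\<lambda>q. (x, q)"] by (simp add: lborel_prod)
    have "(\<integral>\<^sup>+p. ennreal (g' p) \<partial>lborel) = (\<integral>\<^sup>+p. ennreal (g' p) \<partial>(lborel \<Otimes>\<^sub>M lborel))"
      by (simp add: lborel_prod)
    also have "\<dots> = (\<integral>\<^sup>+x. \<integral>\<^sup>+q. ennreal (g' (x, q)) \<partial>lborel \<partial>lborel)"
      by (rule lborel.nn_integral_fst[OF m1, symmetric])
    also have "\<dots> = (\<integral>\<^sup>+x. \<integral>\<^sup>+q. ennreal (g' (x, q)) \<partial>(lborel \<Otimes>\<^sub>M lborel) \<partial>lborel)"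
      by (simp add: lborel_prod)
    also have "\<dots> = (\<integral>\<^sup>+x. \<integral>\<^sup>+y. \<integral>\<^sup>+z. G x y z \<partial>lborel \<partial>lborel \<partial>lborel)"
      unfolding G_def by (intro nn_integral_cong lborel.nn_integral_fst[OF m2, symmetric])
    finally show ?thesis .
  qed
  \<comment> \<open>Both parametrisations foliate the tetrahedron by triangles, the one with parameter \<open>r\<close> projecting
    bijectively to \<open>simplex2 r\<close>; \<open>c r s\<close> is the third coordinate of its points with \<open>x + y = r * s\<close>.\<close>
  have slices: "(g has_integral integral {0..1} (\<lambda>r. r ^ 2 * integral {0..1} (\<lambda>s. s *
     integral {0..1} (\<lambda>u. g (r * s * u, r * s * (1 - u), c r s))))) (simplex3 1)"
    if eq: "(\<integral>\<^sup>+p. ennreal (g' p) \<partial>lborel) = (\<integral>\<^sup>+r\<in>{0..1}. (\<integral>\<^sup>+x. \<integral>\<^sup>+y. P r x y \<partial>lborel \<partial>lborel) \<partial>lborel)"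
      and Pm: "\<And>r. case_prod (P r) \<in> borel_measurable (borel \<Otimes>\<^sub>M borel)"
      and Psupp: "\<And>r x y. \<lbrakk>r \<in> {0..1}; (x, y) \<notin> simplex2 r\<rbrakk> \<Longrightarrow> P r x y = 0"
      and P: "\<And>r s u. P r (r * s * u) (r * s * (1 - u)) = G (r * s * u) (r * s * (1 - u)) (c r s)"
      and c: "continuous_on UNIV (\<lambda>x. c (fst x) (snd x))"
      and cin: "\<And>r s u. \<lbrakk>r \<in> {0..1}; s \<in> {0..1}; u \<in> {0..1}\<rbrakk> \<Longrightarrow> (r * s * u, r * s * (1 - u), c r s) \<in> simplex3 1"
    for P c
  proof -
    let ?F = "\<lambda>r s u. g (r * s * u, r * s * (1 - u), c r s)"
    have contF: "continuous_on (({0..1} \<times> {0..1}) \<times> {0..1}) (\<lambda>x. ?F (fst (fst x)) (snd (fst x)) (snd x))"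
      by (rule continuous_on_compose2[OF cont])
         (auto intro!: continuous_intros cin continuous_on_compose2[OF c, where f = fst, simplified])
    have posF: "0 \<le> ?F r s u" if "r \<in> {0..1}" "s \<in> {0..1}" "u \<in> {0..1}" for r s u
      using that by (intro pos cin)
    have "(\<integral>\<^sup>+p. ennreal (g' p) \<partial>lborel) = (\<integral>\<^sup>+r\<in>{0..1}. (\<integral>\<^sup>+x. \<integral>\<^sup>+y. P r x y \<partial>lborel \<partial>lborel) \<partial>lborel)"
      by (rule eq)
    also have "\<dots> = (\<integral>\<^sup>+r\<in>{0..1}. ennreal (r ^ 2) * (\<integral>\<^sup>+s\<in>{0..1}. ennreal s *
      (\<integral>\<^sup>+u\<in>{0..1}. ennreal (?F r s u) \<partial>lborel) \<partial>lborel) \<partial>lborel)"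
    proof (rule nn_integral_cong_AE, rule AE_mp[OF AE_lborel_singleton[of 0]], rule AE_I2, intro impI)
      fix r :: real assume r0: "r \<noteq> 0"
      show "(\<integral>\<^sup>+x. \<integral>\<^sup>+y. P r x y \<partial>lborel \<partial>lborel) * indicator {0..1} r = ennreal (r ^ 2) * (\<integral>\<^sup>+s\<in>{0..1}. ennreal s *
        (\<integral>\<^sup>+u\<in>{0..1}. ennreal (?F r s u) \<partial>lborel) \<partial>lborel) * indicator {0..1} r"
      proof (cases "r \<in> {0..1}")
        case True
        have "(\<integral>\<^sup>+x. \<integral>\<^sup>+y. P r x y \<partial>lborel \<partial>lborel) = ennreal (r ^ 2) * (\<integral>\<^sup>+s\<in>{0..1}. ennreal s *
           (\<integral>\<^sup>+u\<in>{0..1}. P r (r * s * u) (r * s * (1 - u)) \<partial>lborel) \<partial>lborel)"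
          using True r0 by (intro nn_integral_quadrant_polar Pm Psupp) auto
        also have "(\<integral>\<^sup>+s\<in>{0..1}. ennreal s * (\<integral>\<^sup>+u\<in>{0..1}. P r (r * s * u) (r * s * (1 - u)) \<partial>lborel) \<partial>lborel)
          = (\<integral>\<^sup>+s\<in>{0..1}. ennreal s * (\<integral>\<^sup>+u\<in>{0..1}. ennreal (?F r s u) \<partial>lborel) \<partial>lborel)"
          using True cin[OF True]
          by (intro set_nn_integral_cong refl arg_cong2[of _ _ _ _ "(*)"]) (simp_all add: P G_def g'_def)
        finally show ?thesis by simp
      qed simp
    qed
    also have "\<dots> = ennreal (integral {0..1} (\<lambda>r. r ^ 2 * integral {0..1} (\<lambda>s. s * integral {0..1} (?F r s))))"
      by (rule nn_integral_iterated_unit_cube(1)[OF contF posF])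
    finally have nn: "(\<integral>\<^sup>+p. ennreal (g' p) \<partial>lborel)
       = ennreal (integral {0..1} (\<lambda>r. r ^ 2 * integral {0..1} (\<lambda>s. s * integral {0..1} (?F r s))))" .
    have nonneg: "0 \<le> integral {0..1} (\<lambda>r. r ^ 2 * integral {0..1} (\<lambda>s. s * integral {0..1} (?F r s)))"
      by (rule nn_integral_iterated_unit_cube(2)[OF contF posF])
    have "(g' has_integral integral {0..1} (\<lambda>r. r ^ 2 * integral {0..1} (\<lambda>s. s * integral {0..1} (?F r s)))) UNIV"
      by (rule nn_integral_has_integral[OF g'm g'pos nn nonneg])
    moreover have "g' = (\<lambda>p. if p \<in> simplex3 1 then g p else 0)"
      by (auto simp: g'_def)
    ultimately show ?thesis by (simp add: has_integral_restrict_UNIV)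
  qed
  show "(g has_integral apex_cone_integral 1 g) (simplex3 1)"
  proof -
    have "(\<integral>\<^sup>+p. ennreal (g' p) \<partial>lborel) = (\<integral>\<^sup>+x. \<integral>\<^sup>+z. \<integral>\<^sup>+y. G x y z \<partial>lborel \<partial>lborel \<partial>lborel)"
      unfolding total by (intro nn_integral_cong lborel_pair.Fubini') simp
    also have "\<dots> = (\<integral>\<^sup>+z. \<integral>\<^sup>+x. \<integral>\<^sup>+y. G x y z \<partial>lborel \<partial>lborel \<partial>lborel)"
      by (rule lborel_pair.Fubini') simp
    also have "\<dots> = (\<integral>\<^sup>+r. \<integral>\<^sup>+x. \<integral>\<^sup>+y. G x y (1 - r) \<partial>lborel \<partial>lborel \<partial>lborel)"
      by (subst nn_integral_real_affine[where c = "-1" and t = 1]) simp_all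
    also have "\<dots> = (\<integral>\<^sup>+r\<in>{0..1}. (\<integral>\<^sup>+x. \<integral>\<^sup>+y. G x y (1 - r) \<partial>lborel \<partial>lborel) \<partial>lborel)"
    proof (intro nn_integral_cong)
      fix r :: real
      have "G x y (1 - r) = 0" if "r \<notin> {0..1}" for x y
        using that by (intro G0) (auto simp: simplex3_def)
      then show "(\<integral>\<^sup>+x. \<integral>\<^sup>+y. G x y (1 - r) \<partial>lborel \<partial>lborel)
        = (\<integral>\<^sup>+x. \<integral>\<^sup>+y. G x y (1 - r) \<partial>lborel \<partial>lborel) * indicator {0..1} r"
        by (cases "r \<in> {0..1}") auto
    qed
    finally have "(g has_integral integral {0..1} (\<lambda>r. r ^ 2 * integral {0..1} (\<lambda>s. s *
       integral {0..1} (\<lambda>u. g (r * s * u, r * s * (1 - u), 1 - r))))) (simplex3 1)"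
    proof (rule slices)
      show "(x, y) \<notin> simplex2 r \<Longrightarrow> G x y (1 - r) = 0" for r x y
        by (rule G0) (auto simp: simplex2_def simplex3_def)
    qed (use apex_point_in_simplex3[where k = 1] in \<open>auto intro!: continuous_intros\<close>)
    then show ?thesis by (simp add: apex_cone_integral_def)
  qed
  show "(g has_integral origin_cone_integral 1 g) (simplex3 1)"
  proof -
    have "(\<integral>\<^sup>+p. ennreal (g' p) \<partial>lborel) = (\<integral>\<^sup>+x. \<integral>\<^sup>+y. \<integral>\<^sup>+r. G x y (r - x - y) \<partial>lborel \<partial>lborel \<partial>lborel)"
      unfolding total
    proof (rule nn_integral_cong, rule nn_integral_cong)
      show "(\<integral>\<^sup>+z. G x y z \<partial>lborel) = (\<integral>\<^sup>+r. G x y (r - x - y) \<partial>lborel)" for x y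
        by (subst nn_integral_real_affine[where c = 1 and t = "- x - y"]) (simp_all add: algebra_simps)
    qed
    also have "\<dots> = (\<integral>\<^sup>+x. \<integral>\<^sup>+r. \<integral>\<^sup>+y. G x y (r - x - y) \<partial>lborel \<partial>lborel \<partial>lborel)"
      by (intro nn_integral_cong lborel_pair.Fubini') simp
    also have "\<dots> = (\<integral>\<^sup>+r. \<integral>\<^sup>+x. \<integral>\<^sup>+y. G x y (r - x - y) \<partial>lborel \<partial>lborel \<partial>lborel)"
      by (rule lborel_pair.Fubini') simp
    also have "\<dots> = (\<integral>\<^sup>+r\<in>{0..1}. (\<integral>\<^sup>+x. \<integral>\<^sup>+y. G x y (r - x - y) \<partial>lborel \<partial>lborel) \<partial>lborel)"
    proof (intro nn_integral_cong)
      fix r :: real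
      have "G x y (r - x - y) = 0" if "r \<notin> {0..1}" for x y
        using that by (intro G0) (auto simp: simplex3_def)
      then show "(\<integral>\<^sup>+x. \<integral>\<^sup>+y. G x y (r - x - y) \<partial>lborel \<partial>lborel)
        = (\<integral>\<^sup>+x. \<integral>\<^sup>+y. G x y (r - x - y) \<partial>lborel \<partial>lborel) * indicator {0..1} r"
        by (cases "r \<in> {0..1}") auto
    qed
    finally have "(g has_integral integral {0..1} (\<lambda>r. r ^ 2 * integral {0..1} (\<lambda>s. s *
       integral {0..1} (\<lambda>u. g (r * s * u, r * s * (1 - u), r * (1 - s)))))) (simplex3 1)"
    proof (rule slices)
      show "(x, y) \<notin> simplex2 r \<Longrightarrow> G x y (r - x - y) = 0" for r x y
        by (rule G0) (auto simp: simplex2_def simplex3_def)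
      have "r - r * s * u - r * s * (1 - u) = r * (1 - s)" for r s u :: real
        by (simp add: algebra_simps)
      then show "G (r * s * u) (r * s * (1 - u)) (r - r * s * u - r * s * (1 - u))
        = G (r * s * u) (r * s * (1 - u)) (r * (1 - s))" for r s u
        by simp
    qed (auto intro!: continuous_intros origin_point_in_simplex3)
    then show ?thesis by (simp add: origin_cone_integral_def)
  qed
qed

section \<open>Unimodular tetrahedra in space\<close>

definition pt :: "real \<Rightarrow> real \<Rightarrow> real \<Rightarrow> real ^ 2 option" where
  "pt x y z = append_coord (vector [x, y]) z"

lemma pt_nth [simp]: "pt x y z $ None = z" "pt x y z $ Some 1 = x" "pt x y z $ Some 2 = y"
  by (simp_all add: pt_def append_coord_def)

lemma UNIV_option2: "(UNIV :: 2 option set) = {None, Some 1, Some 2}"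
  by (simp add: UNIV_option_conv UNIV_2)

lemma all_option2: "(\<forall>i::2 option. P i) \<longleftrightarrow> P None \<and> P (Some 1) \<and> P (Some 2)"
  by (metis option.exhaust exhaust_2)

lemma sum_option2: "(\<Sum>i\<in>UNIV. g i) = g None + g (Some 1) + g (Some (2::2))"
  unfolding UNIV_option2 by (simp add: add.assoc)

lemma prod_option2: "(\<Prod>i\<in>UNIV. g i) = g None * g (Some 1) * (g (Some (2::2)) :: real)"
  unfolding UNIV_option2 by (simp add: mult.assoc)

lemma pt_collapse [simp]: "pt (v $ Some 1) (v $ Some 2) (v $ None) = v"
  by (simp add: vec_eq_iff all_option2)

lemma pt_eq_iff [simp]: "pt x y z = pt x' y' z' \<longleftrightarrow> x = x' \<and> y = y' \<and> z = z'"
  by (metis pt_nth)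

lemma pt_linear: "pt x y z + pt x' y' z' = pt (x + x') (y + y') (z + z')"
  "c *\<^sub>R pt x y z = pt (c * x) (c * y) (c * z)" "0 = pt 0 0 0"
  "pt x y z - pt x' y' z' = pt (x - x') (y - y') (z - z')"
  "- pt x y z = pt (- x) (- y) (- z)"
  by (simp_all add: vec_eq_iff all_option2)

lemma det_option2:
  fixes A :: "real ^ 2 option ^ 2 option"
  shows "det A =
    A $ None $ None * A $ Some 1 $ Some 1 * A $ Some 2 $ Some 2
    + A $ None $ Some 1 * A $ Some 1 $ Some 2 * A $ Some 2 $ None
    + A $ None $ Some 2 * A $ Some 1 $ None * A $ Some 2 $ Some 1
    - A $ None $ None * A $ Some 1 $ Some 2 * A $ Some 2 $ Some 1
    - A $ None $ Some 1 * A $ Some 1 $ None * A $ Some 2 $ Some 2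
    - A $ None $ Some 2 * A $ Some 1 $ Some 1 * A $ Some 2 $ None"
proof -
  have f3: "finite {Some 1, Some (2::2)}" "None \<notin> {Some 1, Some (2::2)}" by auto
  have f2: "finite {Some (2::2)}" "Some 1 \<notin> {Some (2::2)}" by auto
  show ?thesis
    unfolding det_def UNIV_option2
    unfolding sum_over_permutations_insert[OF f3]
    unfolding sum_over_permutations_insert[OF f2]
    unfolding permutes_sing
    by (simp add: sign_swap_id permutation_swap_id sign_compose sign_id swap_id_eq)
qed

abbreviation coords :: "real ^ 2 option \<Rightarrow> real \<times> real \<times> real" where
  "coords v \<equiv> (v $ Some 1, v $ Some 2, v $ None)"

lemma coords_pt: "coords (case p of (x, y, z) \<Rightarrow> pt x y z) = p"
  by (simp split: prod.splits)

lemma pt_coords: "(case coords v of (x, y, z) \<Rightarrow> pt x y z) = v"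
  by simp

lemma in_cbox_coords: "w \<in> cbox u v \<longleftrightarrow> coords w \<in> cbox (coords u) (coords v)"
  by (auto simp: mem_box_cart all_option2 cbox_Pair_eq)

lemma coords_image_cbox: "coords ` cbox u v = cbox (coords u) (coords v)"
proof (intro equalityI subsetI)
  fix p assume "p \<in> coords ` cbox u v"
  then obtain w where "w \<in> cbox u v" "p = coords w" by blast
  then show "p \<in> cbox (coords u) (coords v)" using in_cbox_coords by simp
next
  fix p assume "p \<in> cbox (coords u) (coords v)"
  then have "(case p of (x, y, z) \<Rightarrow> pt x y z) \<in> cbox u v"
    by (simp only: in_cbox_coords coords_pt)
  then show "p \<in> coords ` cbox u v" by (rule rev_image_eqI) (simp only: coords_pt)
qed

lemma pt_image_cbox: "\<exists>u v. (\<lambda>(x, y, z). pt x y z) ` cbox p q = cbox u v"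
proof -
  define u v where "u = (case p of (x, y, z) \<Rightarrow> pt x y z)" and "v = (case q of (x, y, z) \<Rightarrow> pt x y z)"
  have "cbox p q = coords ` cbox u v"
    by (simp only: coords_image_cbox u_def v_def coords_pt)
  then have "(\<lambda>(x, y, z). pt x y z) ` cbox p q = cbox u v"
    by (simp add: image_image)
  then show ?thesis by blast
qed

lemma content_coords: "measure lborel (coords ` cbox u v) = measure lborel (cbox u v)"
proof (cases "cbox u v = {}")
  case False
  then have le: "u $ i \<le> v $ i" for i by (simp add: interval_ne_empty_cart)
  show ?thesis
    using le by (simp add: coords_image_cbox content_cbox_cart[OF False] prod_option2 content_Pair)
qed simp

text \<open>The coordinate isomorphism maps boxes to boxes of the same volume.\<close>

lemma has_integral_coords:
  fixes g :: "real \<times> real \<times> real \<Rightarrow> real"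
  assumes "(g has_integral I) (simplex3 1)"
  shows "((\<lambda>v. g (coords v)) has_integral I) ((\<lambda>(x, y, z). pt x y z) ` simplex3 1)"
proof -
  let ?E = "\<lambda>(x, y, z). pt x y z"
  have sub: "simplex3 1 \<subseteq> cbox (0, 0, 0) (1, 1, 1)"
    by (auto simp: simplex3_def cbox_Pair_eq)
  have sub': "?E ` simplex3 1 \<subseteq> ?E ` cbox (0, 0, 0) (1, 1, 1)"
    using sub by (rule image_mono)
  have mem: "coords v \<in> simplex3 1 \<longleftrightarrow> v \<in> ?E ` simplex3 1" for v
  proof
    assume "coords v \<in> simplex3 1"
    then show "v \<in> ?E ` simplex3 1" by (rule rev_image_eqI) (simp only: pt_coords)
  next
    assume "v \<in> ?E ` simplex3 1"
    then show "coords v \<in> simplex3 1" by auto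
  qed
  have "((\<lambda>p. if p \<in> simplex3 1 then g p else 0) has_integral I) (cbox (0, 0, 0) (1, 1, 1))"
    using assms has_integral_restrict[OF sub, of g I] by simp
  then have "((\<lambda>v. if coords v \<in> simplex3 1 then g (coords v) else 0) has_integral (1 / 1) *\<^sub>R I)
      (?E ` cbox (0, 0, 0) (1, 1, 1))"
  proof (rule has_integral_twiddle[rotated -1])
    show "\<exists>w z. coords ` cbox u v = cbox w z" for u v
      using coords_image_cbox by blast
    show "\<exists>w z. ?E ` cbox u v = cbox w z" for u v
      using pt_image_cbox by blast
    show "measure lborel (coords ` cbox u v) = 1 * measure lborel (cbox u v)" for u v
      by (simp add: content_coords)
    show "continuous (at v) coords" for v
      by (intro continuous_intros)
    show "?E (coords v) = v" for v by (rule pt_coords)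
    show "coords (?E p) = p" for p by (rule coords_pt)
  qed simp
  then show ?thesis
    using has_integral_restrict[OF sub', of "\<lambda>v. g (coords v)" I] by (simp add: mem)
qed

text \<open>Sends \<open>simplex3 k\<close> to the tetrahedron spanned by the origin, \<open>k p\<close> and \<open>k q\<close> in the horizontal plane, and the
  point at height \<open>e k\<close> on the axis; the sign \<open>e\<close> selects the upper or the lower cone.\<close>

definition cone_map :: "real \<times> real \<Rightarrow> real \<times> real \<Rightarrow> real \<Rightarrow> real \<times> real \<times> real \<Rightarrow> real ^ 2 option" where
  "cone_map p q e = (\<lambda>(x, y, z). pt (x * fst p + y * fst q) (x * snd p + y * snd q) (e * z))"

lemma simplex3_scale:
  assumes "k > 0"
  shows "(\<lambda>p. k *\<^sub>R p) ` simplex3 1 = simplex3 k"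
proof (intro equalityI subsetI)
  fix p assume "p \<in> simplex3 k"
  then have "(1 / k) *\<^sub>R p \<in> simplex3 1"
    using assms by (auto simp: simplex3_def simp flip: add_divide_distrib)
  then show "p \<in> (\<lambda>p. k *\<^sub>R p) ` simplex3 1"
    using assms by (intro rev_image_eqI) auto
next
  fix p assume "p \<in> (\<lambda>p. k *\<^sub>R p) ` simplex3 1"
  then obtain x y z where p: "p = (k * x, k * y, k * z)" "(x, y, z) \<in> simplex3 1" by fastforce
  then have "k * (x + y + z) \<le> k * 1" using assms by (intro mult_left_mono) (auto simp: simplex3_def)
  then show "p \<in> simplex3 k"
    using p assms by (simp add: simplex3_def algebra_simps)
qed

text \<open>Linear change of variables with determinant \<open>k ^ 3 * e\<close>. The general change of variables formula is about
  functions with values in \<open>real ^ 'n\<close>, so \<open>f\<close> is regarded as a function to \<open>real ^ 1\<close> in between.\<close>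

lemma has_integral_cone_map_image:
  fixes f :: "real ^ 2 option \<Rightarrow> real"
  assumes det: "fst p * snd q - fst q * snd p = 1" and e: "\<bar>e\<bar> = 1" and k: "0 < k"
    and g: "((\<lambda>w. f (cone_map p q e (k *\<^sub>R w))) has_integral J) (simplex3 1)"
    and pos: "\<And>v. v \<in> cone_map p q e ` simplex3 k \<Longrightarrow> 0 \<le> f v"
  shows "(f has_integral k ^ 3 * J) (cone_map p q e ` simplex3 k)"
proof -
  define M where "M = (\<lambda>v. cone_map p q e (k *\<^sub>R coords v))"
  define S where "S = (\<lambda>(x, y, z). pt x y z) ` simplex3 1"
  define f1 where "f1 = (\<lambda>v. vec (f v) :: real ^ 1)"
  have lin: "linear M"
    by (rule linearI) (simp_all add: M_def cone_map_def pt_linear algebra_simps)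
  have "k * e * k * k * (fst p * snd q - fst q * snd p) = k ^ 3 * e"
    unfolding det by (simp add: power3_eq_cube)
  then have detM: "det (matrix M) = k ^ 3 * e"
    by (simp add: det_option2 matrix_def M_def cone_map_def axis_def algebra_simps power3_eq_cube)
  have im: "M ` S = cone_map p q e ` simplex3 k"
  proof -
    have "M (case w of (x, y, z) \<Rightarrow> pt x y z) = cone_map p q e (k *\<^sub>R w)" for w
      unfolding M_def coords_pt ..
    then have "M ` S = (\<lambda>w. cone_map p q e (k *\<^sub>R w)) ` simplex3 1"
      unfolding S_def image_image by simp
    then show ?thesis
      unfolding simplex3_scale[OF k, symmetric] image_image .
  qed
  have Mg: "((\<lambda>v. f (M v)) has_integral J) S"
    using has_integral_coords[OF g] by (simp add: M_def S_def)
  have f1M: "((\<lambda>v. \<bar>det (matrix M)\<bar> *\<^sub>R f1 (M v)) has_integral (vec (k ^ 3 * J))) S"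
  proof -
    have "((\<lambda>v. (k ^ 3 * f (M v))) has_integral k ^ 3 * J) S"
      by (rule has_integral_mult_right[OF Mg])
    then have "((vec :: real \<Rightarrow> real ^ 1) \<circ> (\<lambda>v. (k ^ 3 * f (M v))) has_integral vec (k ^ 3 * J)) S"
      by (rule has_integral_linear) (auto intro: linear_conv_bounded_linear[THEN iffD1] linear_vec)
    then show ?thesis
      using e k by (simp add: detM f1_def o_def vec_cmul abs_mult scalar_mult_eq_scaleR)
  qed
  have "(\<lambda>v. \<bar>det (matrix M)\<bar> *\<^sub>R f1 (M v)) absolutely_integrable_on S"
  proof (rule nonnegative_absolutely_integrable)
    show "(\<lambda>v. \<bar>det (matrix M)\<bar> *\<^sub>R f1 (M v)) integrable_on S"
      using f1M by blast
    show "0 \<le> (\<bar>det (matrix M)\<bar> *\<^sub>R f1 (M v)) \<bullet> b" if "v \<in> S" "b \<in> Basis" for v b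
    proof -
      have "0 \<le> f (M v)" using that pos[of "M v"] im by blast
      then show ?thesis using that by (auto simp: f1_def Basis_vec_def inner_axis)
    qed
  qed
  then have "f1 absolutely_integrable_on M ` S \<and> integral (M ` S) f1 = vec (k ^ 3 * J)"
    using has_absolute_integral_change_of_variables_linear[OF lin, where f = f1 and S = S and b = "vec (k ^ 3 * J)"]
      integral_unique[OF f1M] by blast
  then have "(f1 has_integral vec (k ^ 3 * J)) (M ` S)"
    using set_lebesgue_integral_eq_integral(1) has_integral_iff by blast
  from has_integral_linear[OF this bounded_linear_vec_nth[of 1]]
  show ?thesis by (simp add: im f1_def o_def)
qed

lemma has_integral_lattice_cone:
  fixes f :: "real ^ 2 option \<Rightarrow> real"
  assumes det: "fst p * snd q - fst q * snd p = 1" and e: "\<bar>e\<bar> = 1" and k: "0 < k"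
    and cont: "continuous_on (cone_map p q e ` simplex3 k) f"
    and pos: "\<And>v. v \<in> cone_map p q e ` simplex3 k \<Longrightarrow> 0 \<le> f v"
  shows "(f has_integral apex_cone_integral k (\<lambda>w. f (cone_map p q e w))) (cone_map p q e ` simplex3 k)"
    and "(f has_integral origin_cone_integral k (\<lambda>w. f (cone_map p q e w))) (cone_map p q e ` simplex3 k)"
proof -
  let ?L = "cone_map p q e"
  let ?g = "\<lambda>w. f (?L (k *\<^sub>R w))"
  have contL: "continuous_on X ?L" for X
  proof -
    have "linear ?L"
      by (rule linearI) (auto simp: cone_map_def pt_linear algebra_simps)
    then show ?thesis by (simp add: linear_continuous_on linear_conv_bounded_linear)
  qed
  have mem: "?L (k *\<^sub>R w) \<in> ?L ` simplex3 k" if "w \<in> simplex3 1" for w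
    using that simplex3_scale[OF k] by blast
  have cont': "continuous_on (simplex3 1) ?g"
    by (rule continuous_on_compose2[OF cont])
       (auto intro!: continuous_intros continuous_on_compose2[OF contL[of UNIV]] mem)
  have pos': "0 \<le> ?g w" if "w \<in> simplex3 1" for w
    using pos mem that by blast
  have "apex_cone_integral k (\<lambda>w. f (?L w)) = k ^ 3 * apex_cone_integral 1 ?g"
    "origin_cone_integral k (\<lambda>w. f (?L w)) = k ^ 3 * origin_cone_integral 1 ?g"
    by (simp_all add: apex_cone_integral_def origin_cone_integral_def mult.assoc)
  then show "(f has_integral apex_cone_integral k (\<lambda>w. f (?L w))) (?L ` simplex3 k)"
    and "(f has_integral origin_cone_integral k (\<lambda>w. f (?L w))) (?L ` simplex3 k)"
    using has_integral_cone_map_image[OF det e k has_integral_simplex3(1)[OF cont' pos'] pos]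
      has_integral_cone_map_image[OF det e k has_integral_simplex3(2)[OF cont' pos'] pos] by simp_all
qed

section \<open>Fans of unimodular triangles in the plane\<close>

text \<open>The determinant of two vectors of the plane. It reads off coordinates with respect to a unimodular basis, see
  \<open>cone_coordinates\<close> below.\<close>

definition cross :: "real \<times> real \<Rightarrow> real \<times> real \<Rightarrow> real" where
  "cross p q = fst p * snd q - snd p * fst q"

lemma cross_simps:
  "cross (p + p') q = cross p q + cross p' q" "cross p (q + q') = cross p q + cross p q'"
  "cross (c *\<^sub>R p) q = c * cross p q" "cross p (c *\<^sub>R q) = c * cross p q"
  "cross p p = 0" "cross p q = - cross q p"
  by (simp_all add: cross_def algebra_simps)

lemma convex_simplex2: "convex (simplex2 r)"
proof -
  have "simplex2 r = {p. (1, 0) \<bullet> p \<ge> 0} \<inter> {p. (0, 1) \<bullet> p \<ge> 0} \<inter> {p. (1, 1) \<bullet> p \<le> r}"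
    by (auto simp: simplex2_def inner_prod_def)
  then show ?thesis by (simp add: convex_Int convex_halfspace_ge convex_halfspace_le)
qed

lemma convex_simplex3: "convex (simplex3 r)"
proof -
  have "simplex3 r = {p. (1, 0, 0) \<bullet> p \<ge> 0} \<inter> {p. (0, 1, 0) \<bullet> p \<ge> 0} \<inter> {p. (0, 0, 1) \<bullet> p \<ge> 0}
      \<inter> {p. (1, 1, 1) \<bullet> p \<le> r}"
    by (auto simp: simplex3_def inner_prod_def)
  then show ?thesis by (simp add: convex_Int convex_halfspace_ge convex_halfspace_le)
qed

text \<open>A complete fan of unimodular cones whose rays are spanned by the boundary lattice points of a reflexive
  polygon. \<open>N\<close> is the gauge of that polygon, linear on each cone. The conditions \<open>cover\<close> and \<open>unique\<close> say that
  the half-open cones, which contain their first ray but not their second, partition the punctured plane;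
  this serves both to enumerate lattice points without repetition and to see that the closed cones overlap
  only in their boundaries. The upper bound on \<open>a\<close> is the one under which the apexes can be handled.\<close>

locale lattice_fan =
  fixes a :: nat and q :: "nat \<Rightarrow> real \<times> real" and N :: "real \<times> real \<Rightarrow> real"
  assumes a_bounds: "6 \<le> a" "a \<le> 9"
    and q_int: "fst (q i) \<in> \<int>" "snd (q i) \<in> \<int>"
    and q_cyclic: "q a = q 0"
    and q_sum: "(\<Sum>i<a. q i) = 0"
    and q_det: "i < a \<Longrightarrow> cross (q i) (q (Suc i)) = 1"
    and cover: "p \<noteq> 0 \<Longrightarrow> \<exists>i<a. \<exists>x>0. \<exists>y\<ge>0. p = x *\<^sub>R q i + y *\<^sub>R q (Suc i)"
    and unique: "\<lbrakk>i < a; j < a; 0 < x; 0 \<le> y; 0 < x'; 0 \<le> y';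
        x *\<^sub>R q i + y *\<^sub>R q (Suc i) = x' *\<^sub>R q j + y' *\<^sub>R q (Suc j)\<rbrakk> \<Longrightarrow> i = j"
    and N_cone: "\<lbrakk>i < a; 0 \<le> x; 0 \<le> y\<rbrakk> \<Longrightarrow> N (x *\<^sub>R q i + y *\<^sub>R q (Suc i)) = x + y"
    and N_convex: "convex_on UNIV N"
begin

lemma cone_coordinates:
  assumes "i < a"
  shows "cross (x *\<^sub>R q i + y *\<^sub>R q (Suc i)) (q (Suc i)) = x"
    and "cross (q i) (x *\<^sub>R q i + y *\<^sub>R q (Suc i)) = y"
  using q_det[OF assms] by (simp_all add: cross_simps(1-5))

lemma N_zero [simp]: "N 0 = 0"
  using N_cone[of 0 0 0] a_bounds by simp

lemma in_cone: "\<exists>i<a. \<exists>x\<ge>0. \<exists>y\<ge>0. p = x *\<^sub>R q i + y *\<^sub>R q (Suc i)"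
proof (cases "p = 0")
  case True
  then show ?thesis using a_bounds by (intro exI[of _ 0] conjI) auto
next
  case False
  from cover[OF this] obtain i x y where "i < a" "0 < x" "0 \<le> y" "p = x *\<^sub>R q i + y *\<^sub>R q (Suc i)"
    by blast
  then show ?thesis by (intro exI[of _ i] conjI exI[of _ x] exI[of _ y]) auto
qed

lemma N_nonneg: "0 \<le> N p"
  using in_cone[of p] N_cone by auto

lemma N_scale: "0 \<le> c \<Longrightarrow> N (c *\<^sub>R p) = c * N p"
proof -
  assume c: "0 \<le> c"
  obtain i x y where p: "i < a" "0 \<le> x" "0 \<le> y" "p = x *\<^sub>R q i + y *\<^sub>R q (Suc i)"
    using in_cone by blast
  have "c *\<^sub>R p = (c * x) *\<^sub>R q i + (c * y) *\<^sub>R q (Suc i)"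
    by (simp add: p(4) scaleR_right_distrib)
  then show ?thesis
    using p c by (simp add: N_cone distrib_left)
qed

definition disc :: "real \<Rightarrow> (real \<times> real) set" where
  "disc r = {p. N p \<le> r}"

text \<open>The sum over the lattice points on the boundary of \<open>disc j\<close>. The range \<open>v < j\<close> takes the lattice points of
  each edge segment except its end point, so that every point occurs once.\<close>

definition shell_sum :: "nat \<Rightarrow> (real \<times> real \<Rightarrow> real) \<Rightarrow> real" where
  "shell_sum j F = (\<Sum>i<a. \<Sum>v<j. F ((real j - real v) *\<^sub>R q i + real v *\<^sub>R q (Suc i)))"

definition lattice_sum :: "nat \<Rightarrow> (real \<times> real \<Rightarrow> real) \<Rightarrow> real" where
  "lattice_sum r F = F 0 + (\<Sum>j=1..r. shell_sum j F)"

text \<open>The integral of \<open>F\<close> over \<open>disc r\<close>, as a sum over the unimodular cones.\<close>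

definition disc_integral :: "real \<Rightarrow> (real \<times> real \<Rightarrow> real) \<Rightarrow> real" where
  "disc_integral r F = (\<Sum>i<a. triangle_integral r (\<lambda>(x, y). F (x *\<^sub>R q i + y *\<^sub>R q (Suc i))))"

lemma shell_points_in_disc:
  assumes "i < a" "v < j" "j \<le> r"
  shows "(real j - real v) *\<^sub>R q i + real v *\<^sub>R q (Suc i) \<in> disc (real r)"
  using assms by (simp add: disc_def N_cone)

lemma sum_cyclic:
  fixes g :: "real \<times> real \<Rightarrow> 'b::ab_group_add"
  shows "(\<Sum>i<a. g (q (Suc i))) = (\<Sum>i<a. g (q i))"
proof -
  have "g (q 0) + (\<Sum>i<a. g (q (Suc i))) = (\<Sum>i<Suc a. g (q i))"
    by (rule sum.lessThan_Suc_shift[symmetric])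
  also have "\<dots> = (\<Sum>i<a. g (q i)) + g (q a)"
    by (rule sum.lessThan_Suc)
  finally show ?thesis by (simp add: q_cyclic add.commute)
qed

text \<open>An end point of an edge segment is shared by two consecutive cones and has weight one half in each.\<close>

lemma sum_edge_sums:
  assumes "0 < j"
  shows "(\<Sum>i<a. edge_sum j (\<lambda>(x, y). F (x *\<^sub>R q i + y *\<^sub>R q (Suc i)))) = shell_sum j F"
proof -
  have "edge_sum j (\<lambda>(x, y). F (x *\<^sub>R q i + y *\<^sub>R q (Suc i)))
    = (\<Sum>v<j. F ((real j - real v) *\<^sub>R q i + real v *\<^sub>R q (Suc i)))
      + (F (real j *\<^sub>R q (Suc i)) - F (real j *\<^sub>R q i)) / 2" for i
  proof -
    have "{..<j} = insert 0 {1..<j}" using assms by auto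
    then have 1: "(\<Sum>v<j. F ((real j - real v) *\<^sub>R q i + real v *\<^sub>R q (Suc i)))
      = F (real j *\<^sub>R q i) + (\<Sum>v=1..<j. F ((real j - real v) *\<^sub>R q i + real v *\<^sub>R q (Suc i)))"
      by simp
    have 2: "(\<Sum>v=1..<j. F ((real j - real v) *\<^sub>R q i + real v *\<^sub>R q (Suc i)))
       = (\<Sum>v=1..<j. F (real v *\<^sub>R q i + (real j - real v) *\<^sub>R q (Suc i)))"
      by (rule sum.reindex_bij_witness[of _ "\<lambda>v. j - v" "\<lambda>v. j - v"]) (auto simp: of_nat_diff)
    have 3: "edge_sum j (\<lambda>(x, y). F (x *\<^sub>R q i + y *\<^sub>R q (Suc i))) = F (real j *\<^sub>R q (Suc i)) / 2
        + (\<Sum>v=1..<j. F (real v *\<^sub>R q i + (real j - real v) *\<^sub>R q (Suc i))) + F (real j *\<^sub>R q i) / 2"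
      by (simp add: edge_sum_def)
    have "e = x / 2 + S + y / 2 \<Longrightarrow> T = y + S' \<Longrightarrow> S' = S \<Longrightarrow> e = T + (x - y) / 2"
      for e x y S S' T :: real by (simp add: field_simps)
    from this[OF 3 1 2] show ?thesis .
  qed
  note edge = this
  have "(\<Sum>i<a. edge_sum j (\<lambda>(x, y). F (x *\<^sub>R q i + y *\<^sub>R q (Suc i))))
    = shell_sum j F + ((\<Sum>i<a. F (real j *\<^sub>R q (Suc i))) - (\<Sum>i<a. F (real j *\<^sub>R q i))) / 2"
    by (simp only: edge shell_sum_def sum.distrib sum_divide_distrib[symmetric] sum_subtractf)
  also have "\<dots> = shell_sum j F"
    by (simp add: sum_cyclic[of "\<lambda>p. F (real j *\<^sub>R p)"])
  finally show ?thesis .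
qed

lemma convex_disc: "convex (disc r)"
  unfolding convex_alt disc_def
proof safe
  fix p p' and u :: real assume p: "N p \<le> r" "N p' \<le> r" and u: "0 \<le> u" "u \<le> 1"
  have "N ((1 - u) *\<^sub>R p + u *\<^sub>R p') \<le> (1 - u) * N p + u * N p'"
    using convex_onD[OF N_convex] u by simp
  also have "\<dots> \<le> (1 - u) * r + u * r"
    using p u by (intro add_mono mult_left_mono) auto
  finally show "N ((1 - u) *\<^sub>R p + u *\<^sub>R p') \<le> r" by (simp add: algebra_simps)
qed

text \<open>For each \<open>v\<close>, the \<open>a\<close> points at position \<open>v\<close> on the edge segments have sum zero, so Jensen's inequality
  bounds the value at their centre of mass.\<close>

lemma center_le_shell_mean:
  assumes F: "convex_on (disc (real r)) F" and j: "j \<le> r"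
  shows "real (a * j) * F 0 \<le> shell_sum j F"
proof -
  have "real a * F 0 \<le> (\<Sum>i<a. F ((real j - real v) *\<^sub>R q i + real v *\<^sub>R q (Suc i)))" if v: "v < j" for v
  proof -
    let ?y = "\<lambda>i. (real j - real v) *\<^sub>R q i + real v *\<^sub>R q (Suc i)"
    have "(\<Sum>i<a. q (Suc i)) = 0"
      using sum_cyclic[of "\<lambda>p. p"] by (simp add: q_sum)
    moreover have "(\<Sum>i<a. ?y i) = (real j - real v) *\<^sub>R (\<Sum>i<a. q i) + real v *\<^sub>R (\<Sum>i<a. q (Suc i))"
      by (simp only: sum.distrib scaleR_right.sum)
    ultimately have "(\<Sum>i<a. ?y i) = 0"
      by (simp add: q_sum)
    moreover have "(\<Sum>i<a. (1 / real a) *\<^sub>R ?y i) = (1 / real a) *\<^sub>R (\<Sum>i<a. ?y i)"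
      by (rule scaleR_right.sum[symmetric])
    ultimately have "(\<Sum>i<a. (1 / real a) *\<^sub>R ?y i) = 0"
      by (simp only: scaleR_zero_right)
    moreover have "F (\<Sum>i<a. (1 / real a) *\<^sub>R ?y i) \<le> (\<Sum>i<a. (1 / real a) * F (?y i))"
      by (rule convex_on_sum[OF _ _ F])
         (use a_bounds v j shell_points_in_disc in \<open>auto simp: lessThan_empty_iff\<close>)
    ultimately have "F 0 \<le> (\<Sum>i<a. F (?y i)) / real a"
      by (simp add: sum_divide_distrib)
    then show ?thesis using a_bounds by (simp add: field_simps)
  qed
  then have "(\<Sum>v<j. real a * F 0) \<le> (\<Sum>v<j. \<Sum>i<a. F ((real j - real v) *\<^sub>R q i + real v *\<^sub>R q (Suc i)))"
    by (intro sum_mono) auto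
  also have "\<dots> = shell_sum j F"
    unfolding shell_sum_def by (rule sum.swap)
  finally show ?thesis by (simp add: mult.commute mult.left_commute)
qed

text \<open>By \<open>triangle_integral_le_edge_sums\<close>, the lattice points of \<open>disc r\<close> get weight one inside, \<open>a / 6\<close> at the centre
  and \<open>1 / 2 - 1 / (6 r)\<close> on the rim. The two excesses, \<open>a / 6 - 1\<close> at the centre and the multiple
  \<open>1 / (6 r\<^sup>2)\<close> of the integral, are each bounded by \<open>1 / (12 r)\<close> times the rim sum, which together is exactly
  what the rim is short of one half.\<close>

lemma disc_integral_le_lattice_sum:
  assumes conv: "convex_on (disc (real r)) F" and cont: "continuous_on (disc (real r)) F"
    and pos: "\<And>p. p \<in> disc (real r) \<Longrightarrow> 0 \<le> F p" and r: "0 < r"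
  shows "(1 + 1 / (6 * real r ^ 2)) * disc_integral (real r) F \<le> lattice_sum r F - shell_sum r F / 2"
proof -
  let ?H = "\<lambda>i (x, y). F (x *\<^sub>R q i + y *\<^sub>R q (Suc i))"
  let ?s = "shell_sum r F"
  have mem: "x *\<^sub>R q i + y *\<^sub>R q (Suc i) \<in> disc (real r)" if "(x, y) \<in> simplex2 (real r)" "i < a" for x y i
    using that by (simp add: disc_def N_cone simplex2_def)
  have convH: "convex_on (simplex2 (real r)) (?H i)" if "i < a" for i
  proof -
    have "convex_on (simplex2 (real r)) (\<lambda>p. F (fst p *\<^sub>R q i + snd p *\<^sub>R q (Suc i)))"
      by (rule convex_on_compose_affine[OF conv convex_simplex2])
         (use mem that in \<open>auto simp: algebra_simps\<close>)
    then show ?thesis by (simp add: case_prod_unfold)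
  qed
  have contH: "continuous_on (simplex2 (real r)) (?H i)" if "i < a" for i
    unfolding case_prod_unfold
    by (rule continuous_on_compose2[OF cont]) (use mem that in \<open>auto intro!: continuous_intros\<close>)
  have "disc_integral (real r) F \<le> (\<Sum>i<a. F 0 / 6 + (\<Sum>j=1..<r. edge_sum j (?H i))
      + (1 / 2 - 1 / (6 * real r)) * edge_sum r (?H i))"
    unfolding disc_integral_def
    using triangle_integral_le_edge_sums[OF convH contH r] by (intro sum_mono) simp
  also have "\<dots> = real a / 6 * F 0 + (\<Sum>j=1..<r. shell_sum j F) + (1 / 2 - 1 / (6 * real r)) * ?s"
  proof -
    have "(\<Sum>i<a. \<Sum>j=1..<r. edge_sum j (?H i)) = (\<Sum>j=1..<r. shell_sum j F)"
      by (subst sum.swap) (auto intro!: sum.cong simp: sum_edge_sums)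
    then show ?thesis
      by (simp only: sum.distrib sum_distrib_left[symmetric] sum_edge_sums[OF r]) simp
  qed
  finally have Y1: "disc_integral (real r) F
     \<le> real a / 6 * F 0 + (\<Sum>j=1..<r. shell_sum j F) + (1 / 2 - 1 / (6 * real r)) * ?s" .
  have "disc_integral (real r) F \<le> (\<Sum>i<a. real r ^ 2 / 6 * F 0 + real r / 3 * edge_sum r (?H i))"
    unfolding disc_integral_def
    using triangle_integral_le_chord[OF convH contH r] by (intro sum_mono) simp
  also have "\<dots> = real r ^ 2 / 6 * (real a * F 0) + real r / 3 * ?s"
    by (simp only: sum.distrib sum_distrib_left[symmetric] sum_edge_sums[OF r]) simp
  finally have Y2: "disc_integral (real r) F \<le> real r ^ 2 / 6 * (real a * F 0) + real r / 3 * ?s" .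
  have c: "real a * F 0 \<le> ?s / real r"
    using center_le_shell_mean[OF conv, of r] r by (simp add: field_simps)
  have F0: "0 \<le> F 0" using pos[of 0] by (simp add: disc_def)
  have "disc_integral (real r) F / (6 * real r ^ 2) \<le> real a * F 0 / 36 + ?s / (18 * real r)"
    using Y2 r by (simp add: field_simps power2_eq_square)
  also have "\<dots> \<le> ?s / (12 * real r)"
    using c by (simp add: field_simps)
  finally have small: "disc_integral (real r) F / (6 * real r ^ 2) \<le> ?s / (12 * real r)" .
  \<comment> \<open>This is \<open>a \<le> 12\<close>.\<close>
  have "(real a / 6 - 1) * F 0 \<le> real a / 12 * F 0"
    using a_bounds F0 by (intro mult_right_mono) auto
  also have "\<dots> \<le> ?s / (12 * real r)"
    using c by simp
  finally have "(real a / 6 - 1) * F 0 \<le> ?s / (12 * real r)" .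
  moreover have "?s / (6 * real r) = ?s / (12 * real r) + ?s / (12 * real r)"
    by simp
  moreover have "(\<Sum>j=1..r. shell_sum j F) = (\<Sum>j=1..<r. shell_sum j F) + ?s"
    using r by (cases r) (simp_all add: atLeastLessThanSuc_atLeastAtMost)
  moreover have "(1 + 1 / (6 * real r ^ 2)) * disc_integral (real r) F
      = disc_integral (real r) F + disc_integral (real r) F / (6 * real r ^ 2)"
    "(1 / 2 - 1 / (6 * real r)) * ?s = ?s / 2 - ?s / (6 * real r)"
    "(real a / 6 - 1) * F 0 = real a / 6 * F 0 - F 0"
    by (simp_all add: distrib_right left_diff_distrib)
  ultimately show ?thesis
    using Y1 small unfolding lattice_sum_def by linarith
qed

end

section \<open>The double cone over a fan\<close>

lemma convex_on_continuous_UNIV: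
  fixes f :: "'a::euclidean_space \<Rightarrow> real"
  shows "convex_on UNIV f \<Longrightarrow> continuous_on S f"
  using convex_on_continuous[OF open_UNIV] continuous_on_subset by blast

lemma cone_map_as_pt:
  "cone_map p q e (x, y, z)
    = pt (fst (x *\<^sub>R p + y *\<^sub>R q)) (snd (x *\<^sub>R p + y *\<^sub>R q)) (e * z)"
  by (simp add: cone_map_def)

lemma linear_cone_map: "linear (cone_map p q e)"
  by (rule linearI) (auto simp: cone_map_def pt_linear algebra_simps)

lemma edge_sum_cong:
  assumes "\<And>x y. x + y = real j \<Longrightarrow> H (x, y) = H' (x, y)"
  shows "edge_sum j H = edge_sum j H'"
  unfolding edge_sum_def using assms by (intro arg_cong2[of _ _ _ _ "(+)"] sum.cong) auto

definition slice :: "(real ^ 2 option \<Rightarrow> real) \<Rightarrow> real \<Rightarrow> real \<times> real \<Rightarrow> real" where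
  "slice f t p = f (pt (fst p) (snd p) t)"

context lattice_fan
begin

text \<open>The double cone over the polygon with gauge \<open>N\<close>, scaled by \<open>k\<close>.\<close>

definition solid :: "real \<Rightarrow> (real ^ 2 option) set" where
  "solid k = {v. N (v $ Some 1, v $ Some 2) + \<bar>v $ None\<bar> \<le> k}"

lemma pt_in_solid [simp]: "pt x y z \<in> solid k \<longleftrightarrow> N (x, y) + \<bar>z\<bar> \<le> k"
  by (simp add: solid_def)

abbreviation fan_map :: "nat \<Rightarrow> real \<Rightarrow> real \<times> real \<times> real \<Rightarrow> real ^ 2 option" where
  "fan_map i e \<equiv> cone_map (q i) (q (Suc i)) e"

lemma solid_eq_Union_cones:
  "solid k = (\<Union>(i, e)\<in>{..<a} \<times> {1, - 1}. fan_map i e ` simplex3 k)"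
proof (intro equalityI subsetI)
  fix v assume v: "v \<in> solid k"
  obtain i x y where p: "i < a" "0 \<le> x" "0 \<le> y" "(v $ Some 1, v $ Some 2) = x *\<^sub>R q i + y *\<^sub>R q (Suc i)"
    using in_cone by blast
  define e :: real where "e = (if 0 \<le> v $ None then 1 else - 1)"
  have e: "e \<in> {1, - 1}" "e * \<bar>v $ None\<bar> = v $ None" by (auto simp: e_def)
  have "v = fan_map i e (x, y, \<bar>v $ None\<bar>)"
    unfolding cone_map_as_pt p(4)[symmetric] e(2) by simp
  moreover have "(x, y, \<bar>v $ None\<bar>) \<in> simplex3 k"
    using v p by (simp add: solid_def simplex3_def N_cone)
  ultimately show "v \<in> (\<Union>(i, e)\<in>{..<a} \<times> {1, - 1}. fan_map i e ` simplex3 k)"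
    using p(1) e(1) by blast
next
  fix v assume "v \<in> (\<Union>(i, e)\<in>{..<a} \<times> {1, - 1}. fan_map i e ` simplex3 k)"
  then obtain i e w where *: "i < a" "e \<in> {1, - 1}" "v = fan_map i e w" "w \<in> simplex3 k"
    by blast
  obtain x y z where "w = (x, y, z)" by (cases w)
  with * have "i < a" "\<bar>e\<bar> = 1" "v = fan_map i e (x, y, z)" "(x, y, z) \<in> simplex3 k"
    by auto
  then show "v \<in> solid k"
    unfolding simplex3_def by (auto simp only: cone_map_as_pt pt_in_solid prod.collapse N_cone abs_mult)
qed

lemma fan_map_in_solid: "\<lbrakk>i < a; e \<in> {1, - 1}; w \<in> simplex3 k\<rbrakk> \<Longrightarrow> fan_map i e w \<in> solid k"
  unfolding solid_eq_Union_cones by blast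

lemma convex_solid: "convex (solid k)"
proof -
  have "convex_on UNIV (\<lambda>v :: real ^ 2 option. N (v $ Some 1, v $ Some 2))"
    by (rule convex_on_compose_affine[OF N_convex]) auto
  moreover have "convex_on UNIV (\<lambda>v :: real ^ 2 option. \<bar>v $ None\<bar>)"
  proof (rule convex_onI)
    fix t :: real and v w :: "real ^ 2 option" assume "0 < t" "t < 1"
    then show "\<bar>((1 - t) *\<^sub>R v + t *\<^sub>R w) $ None\<bar> \<le> (1 - t) * \<bar>v $ None\<bar> + t * \<bar>w $ None\<bar>"
      using abs_triangle_ineq[of "(1 - t) * v $ None" "t * w $ None"] by (simp add: abs_mult)
  qed simp
  ultimately have cv: "convex_on UNIV (\<lambda>v :: real ^ 2 option. N (v $ Some 1, v $ Some 2) + \<bar>v $ None\<bar>)"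
    by (rule convex_on_add)
  show ?thesis
    unfolding convex_alt solid_def
  proof safe
    fix v w :: "real ^ 2 option" and u :: real
    let ?G = "\<lambda>v :: real ^ 2 option. N (v $ Some 1, v $ Some 2) + \<bar>v $ None\<bar>"
    assume vw: "?G v \<le> k" "?G w \<le> k" and u: "0 \<le> u" "u \<le> 1"
    have "?G ((1 - u) *\<^sub>R v + u *\<^sub>R w) \<le> (1 - u) * ?G v + u * ?G w"
      using convex_onD[OF cv u] by blast
    also have "\<dots> \<le> (1 - u) * k + u * k"
      using vw u by (intro add_mono mult_left_mono) auto
    finally show "?G ((1 - u) *\<^sub>R v + u *\<^sub>R w) \<le> k" by (simp add: algebra_simps)
  qed
qed

lemma continuous_gauge: "continuous_on S (\<lambda>v :: real ^ 2 option. N (v $ Some 1, v $ Some 2) + \<bar>v $ None\<bar>)"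
  by (intro continuous_intros continuous_on_compose2[OF convex_on_continuous_UNIV[OF N_convex, of UNIV]]) auto

text \<open>A convex function on \<open>solid k\<close> may jump at the boundary. Its composition with a contraction towards the
  origin only sees values in the interior, where it is continuous.\<close>

lemma scaled_in_interior_solid:
  assumes k: "0 < k" and c: "0 \<le> c" "c < 1" and v: "v \<in> solid k"
  shows "c *\<^sub>R v \<in> interior (solid k)"
proof -
  let ?U = "{v :: real ^ 2 option. N (v $ Some 1, v $ Some 2) + \<bar>v $ None\<bar> < k}"
  have "open ?U"
    by (rule open_Collect_less[OF continuous_gauge continuous_on_const])
  moreover have "?U \<subseteq> solid k" by (auto simp: solid_def)
  moreover have "c *\<^sub>R v \<in> ?U"
  proof -
    have "N (c *\<^sub>R (v $ Some 1, v $ Some 2)) = c * N (v $ Some 1, v $ Some 2)"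
      using c by (intro N_scale)
    then have "N ((c *\<^sub>R v) $ Some 1, (c *\<^sub>R v) $ Some 2) + \<bar>(c *\<^sub>R v) $ None\<bar>
      = c * (N (v $ Some 1, v $ Some 2) + \<bar>v $ None\<bar>)"
      using c by (simp add: abs_mult distrib_left)
    also have "\<dots> \<le> c * k"
      using v c by (intro mult_left_mono) (auto simp: solid_def)
    also have "\<dots> < k" using c k by simp
    finally show ?thesis by simp
  qed
  ultimately show ?thesis by (meson interiorI)
qed

text \<open>A common point off the horizontal plane and off the vertical planes through the rays has
  positive coordinates in both cones, which contradicts the uniqueness of its half-open cone.\<close>

lemma negligible_cone_overlap:
  assumes ij: "i < a" "j < a" and e: "e \<in> {1, - 1}" "e' \<in> {1, - 1}" and ne: "(i, e) \<noteq> (j, e')"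
  shows "negligible (fan_map i e ` simplex3 k \<inter> fan_map j e' ` simplex3 k)"
proof -
  \<comment> \<open>The horizontal plane and the vertical planes through the rays.\<close>
  let ?Z = "{v :: real ^ 2 option. pt 0 0 1 \<bullet> v = 0}
    \<union> (\<Union>l<Suc a. {v :: real ^ 2 option. pt (- snd (q l)) (fst (q l)) 0 \<bullet> v = 0})"
  have inner: "pt x y z \<bullet> v = x * v $ Some 1 + y * v $ Some 2 + z * v $ None" for x y z v
    by (simp add: inner_vec_def sum_option2)
  have ql: "q l \<noteq> 0" if "l < Suc a" for l
    using q_det[of l] q_det[of 0] q_cyclic that a_bounds by (cases "l = a") (auto simp: cross_def)
  have "negligible ?Z"
    by (intro negligible_Un negligible_Union finite_imageI finite_lessThan)
       (use ql in \<open>auto intro!: negligible_hyperplane simp: pt_linear prod_eq_iff\<close>)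
  moreover have "fan_map i e ` simplex3 k \<inter> fan_map j e' ` simplex3 k \<subseteq> ?Z"
  proof (rule subsetI, rule ccontr)
    fix v assume v: "v \<in> fan_map i e ` simplex3 k \<inter> fan_map j e' ` simplex3 k" and nz: "v \<notin> ?Z"
    obtain x y z where 1: "v = fan_map i e (x, y, z)" "0 \<le> x" "0 \<le> y" "0 \<le> z"
      using v by (auto simp: simplex3_def)
    obtain x' y' z' where 2: "v = fan_map j e' (x', y', z')" "0 \<le> x'" "0 \<le> y'" "0 \<le> z'"
      using v by (auto simp: simplex3_def)
    define p where "p = (v $ Some 1, v $ Some 2)"
    have p: "p = x *\<^sub>R q i + y *\<^sub>R q (Suc i)" "p = x' *\<^sub>R q j + y' *\<^sub>R q (Suc j)"
      using 1(1) 2(1) by (auto simp: p_def cone_map_as_pt prod_eq_iff)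
    have "v $ None \<noteq> 0" using nz by (auto simp: inner)
    moreover have "v $ None = e * z" "v $ None = e' * z'"
      using 1(1) 2(1) by (auto simp: cone_map_as_pt)
    ultimately have ee: "e = e'"
      using e 1(4) 2(4) by auto
    have cr: "cross (q l) p \<noteq> 0" if "l < Suc a" for l
      using nz that by (auto simp: inner cross_def p_def algebra_simps)
    have "x = cross p (q (Suc i))" "y = cross (q i) p" "x' = cross p (q (Suc j))" "y' = cross (q j) p"
      using cone_coordinates[OF ij(1), of x y] cone_coordinates[OF ij(2), of x' y'] p by simp_all
    then have "x \<noteq> 0" "y \<noteq> 0" "x' \<noteq> 0" "y' \<noteq> 0"
      using cr ij cross_simps(6)[of p] by auto
    then have "i = j"
      using unique[OF ij, of x y x' y'] 1 2 p by auto
    with ee ne show False by simp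
  qed
  ultimately show ?thesis by (rule negligible_subset)
qed

lemma has_integral_solid:
  fixes f :: "real ^ 2 option \<Rightarrow> real"
  assumes k: "0 < k" and cont: "continuous_on (solid k) f"
    and pos: "\<And>v. v \<in> solid k \<Longrightarrow> 0 \<le> f v"
  shows "(f has_integral (\<Sum>e\<in>{1, - 1}. \<Sum>i<a. apex_cone_integral k (\<lambda>w. f (fan_map i e w)))) (solid k)"
    and "(f has_integral (\<Sum>e\<in>{1, - 1}. \<Sum>i<a. origin_cone_integral k (\<lambda>w. f (fan_map i e w)))) (solid k)"
proof -
  have sub: "fan_map i e ` simplex3 k \<subseteq> solid k" if "i < a" "e \<in> {1, - 1}" for i e
    using fan_map_in_solid that by blast
  have union: "(f has_integral (\<Sum>e\<in>{1, - 1}. \<Sum>i<a. J i e)) (solid k)"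
    if "\<And>i e. \<lbrakk>i < a; e \<in> {1, - 1}\<rbrakk> \<Longrightarrow> (f has_integral J i e) (fan_map i e ` simplex3 k)" for J
  proof -
    have "(f has_integral (\<Sum>(i, e)\<in>{..<a} \<times> {1, - 1}. J i e))
       (\<Union>x\<in>{..<a} \<times> {1, - 1}. fan_map (fst x) (snd x) ` simplex3 k)"
    proof (rule has_integral_UN)
      show "pairwise (\<lambda>x x'. negligible (fan_map (fst x) (snd x) ` simplex3 k \<inter> fan_map (fst x') (snd x') ` simplex3 k))
         ({..<a} \<times> {1, - 1})"
        by (auto simp: pairwise_def intro!: negligible_cone_overlap)
    qed (use that in auto)
    moreover have "(\<Sum>(i, e)\<in>{..<a} \<times> {1, - 1}. J i e) = (\<Sum>e\<in>{1, - 1}. \<Sum>i<a. J i e)"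
      by (simp add: sum.cartesian_product[symmetric] sum.distrib)
    ultimately show ?thesis
      by (simp add: solid_eq_Union_cones case_prod_unfold)
  qed
  have cone: "(f has_integral apex_cone_integral k (\<lambda>w. f (fan_map i e w))) (fan_map i e ` simplex3 k)"
    "(f has_integral origin_cone_integral k (\<lambda>w. f (fan_map i e w))) (fan_map i e ` simplex3 k)"
    if "i < a" "e \<in> {1, - 1}" for i e
  proof -
    have "fst (q i) * snd (q (Suc i)) - fst (q (Suc i)) * snd (q i) = 1"
      using q_det[OF that(1)] by (simp add: cross_def mult.commute)
    moreover have "\<bar>e\<bar> = 1" using that by auto
    ultimately show "(f has_integral apex_cone_integral k (\<lambda>w. f (fan_map i e w))) (fan_map i e ` simplex3 k)"
      "(f has_integral origin_cone_integral k (\<lambda>w. f (fan_map i e w))) (fan_map i e ` simplex3 k)"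
      using has_integral_lattice_cone[OF _ _ k continuous_on_subset[OF cont sub[OF that]]] pos sub[OF that] by blast+
  qed
  show "(f has_integral (\<Sum>e\<in>{1, - 1}. \<Sum>i<a. apex_cone_integral k (\<lambda>w. f (fan_map i e w)))) (solid k)"
    by (rule union[OF cone(1)])
  show "(f has_integral (\<Sum>e\<in>{1, - 1}. \<Sum>i<a. origin_cone_integral k (\<lambda>w. f (fan_map i e w)))) (solid k)"
    by (rule union[OF cone(2)])
qed

end

section \<open>Slices and lattice sums\<close>

text \<open>
  A function that is not integrable has integral \<open>0\<close>.
\<close>

lemma integral_nonneg':
  fixes f :: "'a::euclidean_space \<Rightarrow> real"
  assumes "\<And>x. x \<in> S \<Longrightarrow> 0 \<le> f x"
  shows "0 \<le> integral S f"
  using integral_nonneg[of f S] assms not_integrable_integral[of f S] by fastforce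

lemma triangle_integral_nonneg:
  assumes "\<And>p. p \<in> simplex2 r \<Longrightarrow> 0 \<le> H p" "0 \<le> r"
  shows "0 \<le> triangle_integral r H"
proof -
  have "0 \<le> edge_mean H (r * s)" if "s \<in> {0..1}" for s
    unfolding edge_mean_def
    by (intro integral_nonneg' assms(1) edge_point_in_simplex2) (use that assms(2) in \<open>auto simp: mult_left_le\<close>)
  then show ?thesis
    unfolding triangle_integral_def
    by (intro mult_nonneg_nonneg integral_nonneg') auto
qed

lemma sum_symmetric_int_interval:
  fixes g :: "int \<Rightarrow> real"
  shows "(\<Sum>t\<in>{- int k..int k}. g t) = (\<Sum>r<k. g (int (k - r))) + (\<Sum>r<k. g (- int (k - r))) + g 0"
proof (induction k)
  case (Suc k)
  have "{- int (Suc k)..int (Suc k)} = insert (int (Suc k)) (insert (- int (Suc k)) {- int k..int k})"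
    by auto
  then have "(\<Sum>t\<in>{- int (Suc k)..int (Suc k)}. g t)
    = g (int (Suc k)) + (g (- int (Suc k)) + (\<Sum>t\<in>{- int k..int k}. g t))"
    by simp
  then show ?case
    unfolding Suc.IH sum.lessThan_Suc_shift by simp
qed simp

context lattice_fan
begin

definition apex_sum :: "nat \<Rightarrow> (real ^ 2 option \<Rightarrow> real) \<Rightarrow> real" where
  "apex_sum k f = (\<Sum>e\<in>{1, - 1}. f (pt 0 0 (e * real k)))"

text \<open>The sum over the lattice points of the boundary of \<open>solid k\<close> other than the apexes, slice by slice: the slices
  at the heights \<open>k - r\<close> and \<open>r - k\<close> are copies of \<open>disc r\<close>, and the two slices with \<open>r = k\<close> coincide.\<close>

definition boundary_sum :: "nat \<Rightarrow> (real ^ 2 option \<Rightarrow> real) \<Rightarrow> real" where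
  "boundary_sum k f =
     (\<Sum>e\<in>{1, - 1}. \<Sum>r=1..<k. shell_sum r (slice f (e * (real k - real r)))) + shell_sum k (slice f 0)"

text \<open>The sum over all lattice points of \<open>solid k\<close>, see \<open>solid_lattice_enumeration\<close>. The apexes are the slices
  with \<open>r = 0\<close>.\<close>

definition lattice_total :: "nat \<Rightarrow> (real ^ 2 option \<Rightarrow> real) \<Rightarrow> real" where
  "lattice_total k f =
     (\<Sum>e\<in>{1, - 1}. \<Sum>r<k. lattice_sum r (slice f (e * (real k - real r)))) + lattice_sum k (slice f 0)"

lemma slice_convex_continuous:
  assumes "r + \<bar>t\<bar> \<le> k"
  shows "convex_on (solid k) f \<Longrightarrow> convex_on (disc r) (slice f t)"
    and "continuous_on (solid k) f \<Longrightarrow> continuous_on (disc r) (slice f t)"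
proof -
  have sub: "(\<lambda>p. pt (fst p) (snd p) t) ` disc r \<subseteq> solid k"
    using assms by (auto simp: disc_def)
  show "convex_on (disc r) (slice f t)" if "convex_on (solid k) f"
    unfolding slice_def
    by (rule convex_on_compose_affine[OF that convex_disc sub]) (simp add: pt_linear algebra_simps)
  have "linear (\<lambda>p. pt (fst p) (snd p) 0)"
    by (rule linearI) (simp_all add: pt_linear)
  then have "continuous_on (disc r) (\<lambda>p. pt (fst p) (snd p) 0 + pt 0 0 t)"
    by (intro continuous_intros linear_continuous_on) (simp add: linear_conv_bounded_linear)
  then have "continuous_on (disc r) (\<lambda>p. pt (fst p) (snd p) t)"
    by (simp add: pt_linear)
  then show "continuous_on (disc r) (slice f t)" if "continuous_on (solid k) f"
    unfolding slice_def by (rule continuous_on_compose2[OF that]) (rule sub)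
qed

lemma fan_map_slice:
  "f (fan_map i e (x, y, z)) = slice f (e * z) (x *\<^sub>R q i + y *\<^sub>R q (Suc i))"
  by (simp only: slice_def cone_map_as_pt)

lemma fan_map_convex_continuous:
  assumes "i < a" "e \<in> {1, - 1}"
  shows "convex_on (solid k) f \<Longrightarrow> convex_on (simplex3 k) (\<lambda>w. f (fan_map i e w))"
    and "continuous_on (solid k) f \<Longrightarrow> continuous_on (simplex3 k) (\<lambda>w. f (fan_map i e w))"
proof -
  have sub: "fan_map i e ` simplex3 k \<subseteq> solid k"
    using fan_map_in_solid[OF assms] by blast
  show "convex_on (simplex3 k) (\<lambda>w. f (fan_map i e w))" if "convex_on (solid k) f"
    by (rule convex_on_compose_affine[OF that convex_simplex3 sub])
       (simp add: linear_cone_map linear_add linear_scale)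
  show "continuous_on (simplex3 k) (\<lambda>w. f (fan_map i e w))" if "continuous_on (solid k) f"
    by (rule continuous_on_compose2[OF that _ sub])
       (intro linear_continuous_on linear_cone_map[unfolded linear_conv_bounded_linear])
qed

lemma lattice_sum_0 [simp]: "lattice_sum 0 F = F 0"
  by (simp add: lattice_sum_def)

lemma lattice_total_split:
  assumes "0 < k"
  shows "lattice_total k f = apex_sum k f
    + (\<Sum>e\<in>{1, - 1}. \<Sum>r=1..<k. lattice_sum r (slice f (e * (real k - real r)))) + lattice_sum k (slice f 0)"
proof -
  have "{..<k} = insert 0 {1..<k}" using assms by auto
  then show ?thesis
    by (simp add: lattice_total_def apex_sum_def slice_def)
qed

lemma disc_integral_nonneg:
  assumes "\<And>p. p \<in> disc r \<Longrightarrow> 0 \<le> F p" "0 \<le> r"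
  shows "0 \<le> disc_integral r F"
  unfolding disc_integral_def
proof (intro sum_nonneg triangle_integral_nonneg assms(2))
  fix i p assume "i \<in> {..<a}" "p \<in> simplex2 r"
  then show "0 \<le> (case p of (x, y) \<Rightarrow> F (x *\<^sub>R q i + y *\<^sub>R q (Suc i)))"
    using assms(1)[of "fst p *\<^sub>R q i + snd p *\<^sub>R q (Suc i)"]
    by (simp add: simplex2_def disc_def N_cone case_prod_unfold)
qed

text \<open>The horizontal slices of all tetrahedra of one half assemble to discs, so each slice strictly between
  the apex and the equator is bounded by \<open>disc_integral_le_lattice_sum\<close>, the factor \<open>1 + 1 / (6 r\<^sup>2)\<close> being absorbed there.
  The equator is reached from both halves, each time with a coefficient below one half. An apex belongs to \<open>a\<close>
  tetrahedra and has weight \<open>1 / 24\<close> in each.\<close>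

lemma integral_solid_le_lattice_total:
  assumes k: "0 < k" and conv: "convex_on (solid (real k)) f" and cont: "continuous_on (solid (real k)) f"
    and pos: "\<And>v. v \<in> solid (real k) \<Longrightarrow> 0 \<le> f v"
  shows "integral (solid (real k)) f \<le> lattice_total k f - boundary_sum k f / 2 - (1 - real a / 24) * apex_sum k f"
proof -
  let ?L = "\<lambda>r t. lattice_sum r (slice f t)"
  let ?s = "\<lambda>r t. shell_sum r (slice f t)"
  let ?Y = "\<lambda>r t. disc_integral (real r) (slice f t)"
  let ?c = "1 / 2 - 1 / (3 * real k) + 1 / (12 * real k ^ 2)"
  have slice: "(1 + 1 / (6 * real r ^ 2)) * ?Y r t \<le> ?L r t - ?s r t / 2"
    if "0 < r" "real r + \<bar>t\<bar> \<le> real k" for r t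
  proof (rule disc_integral_le_lattice_sum[OF slice_convex_continuous(1)[OF that(2) conv] slice_convex_continuous(2)[OF that(2) cont] _ that(1)])
    show "0 \<le> slice f t p" if "p \<in> disc (real r)" for p
      using that \<open>real r + \<bar>t\<bar> \<le> real k\<close> unfolding slice_def by (intro pos) (simp add: disc_def)
  qed
  have Y0: "0 \<le> ?Y k 0"
    by (rule disc_integral_nonneg) (auto simp: slice_def disc_def intro!: pos)
  have c: "2 * ?c \<le> 1 + 1 / (6 * real k ^ 2)"
    using k by (simp add: field_simps)
  have half: "(\<Sum>i<a. apex_cone_integral (real k) (\<lambda>w. f (fan_map i e w)))
      \<le> real a / 24 * f (pt 0 0 (e * real k))
        + (\<Sum>r=1..<k. ?L r (e * (real k - real r)) - ?s r (e * (real k - real r)) / 2) + ?c * ?Y k 0"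
    if e: "e \<in> {1, - 1}" for e :: real
  proof -
    have "apex_cone_integral (real k) (\<lambda>w. f (fan_map i e w)) \<le> f (pt 0 0 (e * real k)) / 24
      + (\<Sum>r=1..<k. (1 + 1 / (6 * real r ^ 2)) * triangle_integral (real r)
          (\<lambda>(x, y). slice f (e * (real k - real r)) (x *\<^sub>R q i + y *\<^sub>R q (Suc i))))
      + ?c * triangle_integral (real k) (\<lambda>(x, y). slice f 0 (x *\<^sub>R q i + y *\<^sub>R q (Suc i)))"
      if i: "i < a" for i
      using apex_cone_integral_le_slices[OF fan_map_convex_continuous(1)[OF i e conv] fan_map_convex_continuous(2)[OF i e cont] k]
      by (simp add: fan_map_slice) (simp add: slice_def)
    then have "(\<Sum>i<a. apex_cone_integral (real k) (\<lambda>w. f (fan_map i e w))) \<le> (\<Sum>i<a. f (pt 0 0 (e * real k)) / 24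
      + (\<Sum>r=1..<k. (1 + 1 / (6 * real r ^ 2)) * triangle_integral (real r)
          (\<lambda>(x, y). slice f (e * (real k - real r)) (x *\<^sub>R q i + y *\<^sub>R q (Suc i))))
      + ?c * triangle_integral (real k) (\<lambda>(x, y). slice f 0 (x *\<^sub>R q i + y *\<^sub>R q (Suc i))))"
      by (intro sum_mono) auto
    also have "\<dots> = real a / 24 * f (pt 0 0 (e * real k))
      + (\<Sum>r=1..<k. (1 + 1 / (6 * real r ^ 2)) * ?Y r (e * (real k - real r))) + ?c * ?Y k 0"
      unfolding disc_integral_def sum.distrib sum_distrib_left[symmetric]
      by (subst sum.swap) (simp add: sum_distrib_left)
    also have "(\<Sum>r=1..<k. (1 + 1 / (6 * real r ^ 2)) * ?Y r (e * (real k - real r)))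
      \<le> (\<Sum>r=1..<k. ?L r (e * (real k - real r)) - ?s r (e * (real k - real r)) / 2)"
      using e by (intro sum_mono slice) (auto simp: abs_mult of_nat_diff)
    finally show ?thesis by simp
  qed
  have "integral (solid (real k)) f = (\<Sum>e\<in>{1, - 1}. \<Sum>i<a. apex_cone_integral (real k) (\<lambda>w. f (fan_map i e w)))"
    using k by (intro integral_unique has_integral_solid(1) cont pos) auto
  also have "\<dots> \<le> (\<Sum>e\<in>{1, - 1}. real a / 24 * f (pt 0 0 (e * real k))
        + (\<Sum>r=1..<k. ?L r (e * (real k - real r)) - ?s r (e * (real k - real r)) / 2) + ?c * ?Y k 0)"
    by (intro sum_mono half)
  also have "\<dots> = real a / 24 * apex_sum k f
     + (\<Sum>e\<in>{1, - 1}. \<Sum>r=1..<k. ?L r (e * (real k - real r)))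
     - (\<Sum>e\<in>{1, - 1}. \<Sum>r=1..<k. ?s r (e * (real k - real r))) / 2 + (2 * ?c) * ?Y k 0"
    by (simp add: apex_sum_def sum_subtractf sum_divide_distrib[symmetric] algebra_simps add_divide_distrib)
  also have "(2 * ?c) * ?Y k 0 \<le> (1 + 1 / (6 * real k ^ 2)) * ?Y k 0"
    by (rule mult_right_mono[OF c Y0])
  also have "\<dots> \<le> ?L k 0 - ?s k 0 / 2"
    by (rule slice[OF k]) simp
  finally show ?thesis
    unfolding lattice_total_split[OF k] boundary_sum_def by (simp add: algebra_simps add_divide_distrib)
qed

text \<open>Seen from the origin, the outer face \<open>x + y + z = k\<close> of a tetrahedron is parametrised by a triangle whose
  vertex \<open>(0, 0)\<close> is the apex and whose layers \<open>x + y = r\<close> are the edges of the slices of size \<open>r\<close>. The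
  apex thus gets weight \<open>a / 6\<close>, every other boundary point at most one; points of the equator get at most one
  half from each side.\<close>

lemma integral_solid_le_boundary:
  assumes k: "0 < k" and conv: "convex_on (solid (real k)) f" and cont: "continuous_on (solid (real k)) f"
    and pos: "\<And>v. v \<in> solid (real k) \<Longrightarrow> 0 \<le> f v" and f0: "f 0 = 0"
  shows "integral (solid (real k)) f \<le> real k / 4 * (boundary_sum k f + real a / 6 * apex_sum k f)"
proof -
  let ?s = "\<lambda>r t. shell_sum r (slice f t)"
  have "0 \<le> slice f 0 p" if "p \<in> disc (real k)" for p
    using that unfolding slice_def by (intro pos) (simp add: disc_def)
  then have s0: "0 \<le> ?s k 0"
    unfolding shell_sum_def by (intro sum_nonneg) (simp add: shell_points_in_disc)
  have half: "(\<Sum>i<a. origin_cone_integral (real k) (\<lambda>w. f (fan_map i e w)))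
      \<le> real k / 4 * (real a / 6 * f (pt 0 0 (e * real k)) + (\<Sum>r=1..<k. ?s r (e * (real k - real r))) + ?s k 0 / 2)"
    if e: "e \<in> {1, - 1}" for e :: real
  proof -
    let ?E = "\<lambda>r i. edge_sum r (\<lambda>(x, y). slice f (e * (real k - real r)) (x *\<^sub>R q i + y *\<^sub>R q (Suc i)))"
    have "origin_cone_integral (real k) (\<lambda>w. f (fan_map i e w))
      \<le> real k / 4 * (f (pt 0 0 (e * real k)) / 6 + (\<Sum>r=1..<k. ?E r i) + (1 / 2 - 1 / (6 * real k)) * ?E k i)"
      if i: "i < a" for i
    proof -
      let ?h = "\<lambda>w. f (fan_map i e w)"
      let ?H = "\<lambda>p. ?h (fst p, snd p, real k - fst p - snd p)"
      note h = fan_map_convex_continuous(1)[OF i e conv] fan_map_convex_continuous(2)[OF i e cont]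
      have sub: "(\<lambda>p. (fst p, snd p, real k - fst p - snd p)) ` simplex2 (real k) \<subseteq> simplex3 (real k)"
        by (auto simp: simplex2_def simplex3_def)
      have convH: "convex_on (simplex2 (real k)) ?H"
        by (rule convex_on_compose_affine[OF h(1) convex_simplex2 sub]) (simp add: algebra_simps)
      have contH: "continuous_on (simplex2 (real k)) ?H"
        by (rule continuous_on_compose2[OF h(2) _ sub]) (intro continuous_intros)
      have "?h (0, 0, 0) = 0" by (simp add: cone_map_def f0 flip: pt_linear(3))
      from origin_cone_integral_le[OF h this]
      have "origin_cone_integral (real k) ?h \<le> real k / 4 * triangle_integral (real k) ?H"
        by (simp add: case_prod_unfold)
      also have "\<dots> \<le> real k / 4 * (?H (0, 0) / 6 + (\<Sum>j=1..<k. edge_sum j ?H) + (1 / 2 - 1 / (6 * real k)) * edge_sum k ?H)"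
        by (intro mult_left_mono triangle_integral_le_edge_sums[OF convH contH k]) simp
      finally have bound: "origin_cone_integral (real k) ?h \<le> real k / 4 * (?H (0, 0) / 6 + (\<Sum>j=1..<k. edge_sum j ?H) + (1 / 2 - 1 / (6 * real k)) * edge_sum k ?H)" .
      have edge: "edge_sum j ?H = ?E j i" for j
      proof (rule edge_sum_cong)
        fix x y assume "x + y = real j"
        then have "real k - x - y = real k - real j" by simp
        then show "?H (x, y) = (case (x, y) of (x, y) \<Rightarrow> slice f (e * (real k - real j)) (x *\<^sub>R q i + y *\<^sub>R q (Suc i)))"
          by (simp only: fst_conv snd_conv prod.case fan_map_slice)
      qed
      have apex: "?H (0, 0) = f (pt 0 0 (e * real k))" by (simp add: cone_map_def)
      show ?thesis using bound unfolding edge apex .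
    qed
    then have "(\<Sum>i<a. origin_cone_integral (real k) (\<lambda>w. f (fan_map i e w)))
      \<le> (\<Sum>i<a. real k / 4 * (f (pt 0 0 (e * real k)) / 6 + (\<Sum>r=1..<k. ?E r i) + (1 / 2 - 1 / (6 * real k)) * ?E k i))"
      by (intro sum_mono) auto
    also have "\<dots> = real k / 4 * (real a / 6 * f (pt 0 0 (e * real k))
      + (\<Sum>r=1..<k. \<Sum>i<a. ?E r i) + (1 / 2 - 1 / (6 * real k)) * (\<Sum>i<a. ?E k i))"
      unfolding sum.distrib sum_distrib_left[symmetric] by (subst sum.swap) simp
    also have "(\<Sum>r=1..<k. \<Sum>i<a. ?E r i) = (\<Sum>r=1..<k. ?s r (e * (real k - real r)))"
      by (intro sum.cong sum_edge_sums) auto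
    also have "(\<Sum>i<a. ?E k i) = ?s k 0"
      using sum_edge_sums[OF k, of "slice f 0"] by simp
    also have "(1 / 2 - 1 / (6 * real k)) * ?s k 0 \<le> ?s k 0 / 2"
      using mult_right_mono[OF _ s0, of "1 / 2 - 1 / (6 * real k)" "1 / 2"] by simp
    finally show ?thesis by (simp add: mult_left_mono)
  qed
  have "integral (solid (real k)) f = (\<Sum>e\<in>{1, - 1}. \<Sum>i<a. origin_cone_integral (real k) (\<lambda>w. f (fan_map i e w)))"
    using k by (intro integral_unique has_integral_solid(2) cont pos) auto
  also have "\<dots> \<le> (\<Sum>e\<in>{1, - 1}. real k / 4 * (real a / 6 * f (pt 0 0 (e * real k)) + (\<Sum>r=1..<k. ?s r (e * (real k - real r))) + ?s k 0 / 2))"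
    by (intro sum_mono half)
  also have "\<dots> = real k / 4 * (boundary_sum k f + real a / 6 * apex_sum k f)"
    by (simp add: boundary_sum_def apex_sum_def algebra_simps)
  finally show ?thesis .
qed

definition disc_lattice :: "real \<Rightarrow> (real \<times> real) set" where
  "disc_lattice r = {p. fst p \<in> \<int> \<and> snd p \<in> \<int> \<and> N p \<le> r}"

text \<open>In its half-open cone, a nonzero lattice point has integral coordinates \<open>(j - v, v)\<close>, because the cone is
  unimodular, and \<open>j\<close> is its gauge.\<close>

lemma disc_lattice_enumeration:
  fixes F :: "real \<times> real \<Rightarrow> real"
  shows "(\<Sum>p\<in>disc_lattice (real r). F p) = lattice_sum r F" "finite (disc_lattice (real r))"
proof -
  let ?\<phi> = "\<lambda>(i, j, v). (real j - real v) *\<^sub>R q i + real v *\<^sub>R q (Suc i)"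
  let ?I = "SIGMA i:{..<a}. SIGMA j:{1..r}. {..<j}"
  have inj: "inj_on ?\<phi> ?I"
  proof (rule inj_onI, clarsimp)
    fix i j v i' j' v'
    assume i: "i < a" "i' < a" and v: "v < j" "v' < j'"
      and eq: "(real j - real v) *\<^sub>R q i + real v *\<^sub>R q (Suc i) = (real j' - real v') *\<^sub>R q i' + real v' *\<^sub>R q (Suc i')"
    have ii: "i = i'"
      using unique[OF i, of "real j - real v" "real v" "real j' - real v'" "real v'"] v eq by simp
    have "real v = real v'" "real j - real v = real j' - real v'"
      using cone_coordinates[OF i(1)] eq unfolding ii by metis+
    with ii show "i = i' \<and> j = j' \<and> v = v'" by simp
  qed
  have zero: "0 \<notin> ?\<phi> ` ?I"
  proof
    assume "0 \<in> ?\<phi> ` ?I"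
    then obtain i j v where "i < a" "v < j" "0 = (real j - real v) *\<^sub>R q i + real v *\<^sub>R q (Suc i)"
      by auto
    then show False
      using N_cone[of i "real j - real v" "real v"] by simp
  qed
  have set: "disc_lattice (real r) = insert 0 (?\<phi> ` ?I)"
  proof (intro equalityI subsetI)
    fix p assume p: "p \<in> disc_lattice (real r)"
    show "p \<in> insert 0 (?\<phi> ` ?I)"
    proof (cases "p = 0")
      case False
      then obtain i x y where ixy: "i < a" "0 < x" "0 \<le> y" "p = x *\<^sub>R q i + y *\<^sub>R q (Suc i)"
        using cover by blast
      have "x = cross p (q (Suc i))" "y = cross (q i) p"
        using cone_coordinates[OF ixy(1)] ixy(4) by simp_all
      then have "x \<in> \<int>" "y \<in> \<int>"
        using p q_int by (auto simp: cross_def disc_lattice_def)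
      then obtain m n where mn: "x = real m" "y = real n"
        using ixy(2,3) by (metis Ints_cases int_eq_iff of_int_0_le_iff less_imp_le of_int_of_nat_eq nonneg_int_cases)
      have "x + y \<le> real r"
        using p N_cone[OF ixy(1)] ixy by (simp add: disc_lattice_def)
      then have "p = ?\<phi> (i, m + n, n)" "(i, m + n, n) \<in> ?I"
        using ixy mn by auto
      then show ?thesis by blast
    qed simp
  next
    fix p assume "p \<in> insert 0 (?\<phi> ` ?I)"
    then consider "p = 0" | i j v where "i < a" "v < j" "j \<le> r" "p = (real j - real v) *\<^sub>R q i + real v *\<^sub>R q (Suc i)"
      by auto
    then show "p \<in> disc_lattice (real r)"
    proof cases
      case 2
      then show ?thesis
        using shell_points_in_disc[OF 2(1-3)] q_int by (auto simp: disc_lattice_def disc_def)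
    qed (simp add: disc_lattice_def)
  qed
  have fin: "finite ?I" by simp
  show "finite (disc_lattice (real r))" unfolding set by simp
  have "(\<Sum>p\<in>disc_lattice (real r). F p) = F 0 + (\<Sum>x\<in>?I. F (?\<phi> x))"
    unfolding set by (subst sum.insert[OF finite_imageI[OF fin] zero]) (simp only: sum.reindex[OF inj] o_def)
  also have "(\<Sum>x\<in>?I. F (?\<phi> x)) = (\<Sum>i<a. \<Sum>j=1..r. \<Sum>v<j. F (?\<phi> (i, j, v)))"
    by (simp add: sum.Sigma case_prod_unfold)
  also have "\<dots> = (\<Sum>j=1..r. shell_sum j F)"
    unfolding shell_sum_def by (subst sum.swap) simp
  finally show "(\<Sum>p\<in>disc_lattice (real r). F p) = lattice_sum r F"
    by (simp add: lattice_sum_def)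
qed

lemma solid_lattice_enumeration:
  fixes f :: "real ^ 2 option \<Rightarrow> real"
  shows "(\<Sum>v\<in>solid (real k) \<inter> int_lattice. f v) = lattice_total k f" "finite (solid (real k) \<inter> int_lattice)"
proof -
  let ?T = "{- int k..int k}"
  let ?S = "SIGMA t:?T. disc_lattice (real (k - nat \<bar>t\<bar>))"
  let ?\<phi> = "\<lambda>(t, p). pt (fst p) (snd p) (real_of_int t)"
  have inj: "inj_on ?\<phi> ?S" by (auto simp: inj_on_def prod_eq_iff)
  have rk: "real (k - nat \<bar>t\<bar>) = real k - \<bar>real_of_int t\<bar>" if "t \<in> ?T" for t
    using that by (auto simp: of_nat_diff nat_le_iff)
  have set: "solid (real k) \<inter> int_lattice = ?\<phi> ` ?S"
  proof (intro equalityI subsetI)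
    fix v assume v: "v \<in> solid (real k) \<inter> int_lattice"
    then have "v $ None \<in> \<int>" "v $ Some 1 \<in> \<int>" "v $ Some 2 \<in> \<int>" by (auto simp: int_lattice_def)
    then obtain t where t: "v $ None = real_of_int t" by (auto elim: Ints_cases)
    have Nv: "N (v $ Some 1, v $ Some 2) + \<bar>real_of_int t\<bar> \<le> real k"
      using v by (simp add: solid_def t)
    then have "\<bar>real_of_int t\<bar> \<le> real k" using N_nonneg[of "(v $ Some 1, v $ Some 2)"] by linarith
    then have tT: "t \<in> ?T" by auto
    have "(t, (v $ Some 1, v $ Some 2)) \<in> ?S"
      using tT Nv \<open>v $ Some 1 \<in> \<int>\<close> \<open>v $ Some 2 \<in> \<int>\<close> by (simp add: disc_lattice_def rk[OF tT])
    moreover have "v = ?\<phi> (t, (v $ Some 1, v $ Some 2))"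
      by (simp flip: t)
    ultimately show "v \<in> ?\<phi> ` ?S" by blast
  next
    fix v assume "v \<in> ?\<phi> ` ?S"
    then obtain t p where "t \<in> ?T" "p \<in> disc_lattice (real (k - nat \<bar>t\<bar>))" "v = pt (fst p) (snd p) (real_of_int t)"
      by auto
    then show "v \<in> solid (real k) \<inter> int_lattice"
      using rk[of t] by (auto simp: disc_lattice_def int_lattice_def all_option2)
  qed
  have fin: "finite ?S" by (intro finite_SigmaI disc_lattice_enumeration) simp
  then show "finite (solid (real k) \<inter> int_lattice)" unfolding set by simp
  have "(\<Sum>v\<in>solid (real k) \<inter> int_lattice. f v) = (\<Sum>x\<in>?S. f (?\<phi> x))"
    unfolding set by (simp add: sum.reindex[OF inj])
  also have "\<dots> = (\<Sum>t\<in>?T. \<Sum>p\<in>disc_lattice (real (k - nat \<bar>t\<bar>)). slice f (real_of_int t) p)"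
    by (subst sum.Sigma) (auto simp: disc_lattice_enumeration slice_def case_prod_unfold)
  also have "\<dots> = (\<Sum>t\<in>?T. lattice_sum (k - nat \<bar>t\<bar>) (slice f (real_of_int t)))"
    by (simp add: disc_lattice_enumeration)
  also have "\<dots> = lattice_total k f"
  proof -
    have "k - nat \<bar>int (k - r)\<bar> = r" "k - nat \<bar>- int (k - r)\<bar> = r" "real (k - r) = real k - real r"
      if "r < k" for r
      using that by auto
    then show ?thesis
      unfolding sum_symmetric_int_interval lattice_total_def
      by (simp del: abs_minus_cancel of_nat_diff abs_of_nat cong: sum.cong_simp)
  qed
  finally show "(\<Sum>v\<in>solid (real k) \<inter> int_lattice. f v) = lattice_total k f" .
qed

end

section \<open>The stability inequality\<close>

lemma absolutely_integrable_on_open_bounded: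
  fixes g :: "'a::euclidean_space \<Rightarrow> real"
  assumes S: "open S" "bounded S" and cont: "continuous_on S g" and M: "\<And>x. x \<in> S \<Longrightarrow> \<bar>g x\<bar> \<le> M"
  shows "g absolutely_integrable_on S"
proof (rule measurable_bounded_by_integrable_imp_absolutely_integrable)
  have Sl: "S \<in> lmeasurable"
    using S by (simp add: lmeasurable_open)
  then show "S \<in> sets lebesgue" by blast
  then show "g \<in> borel_measurable (lebesgue_on S)"
    by (rule continuous_imp_measurable_on_sets_lebesgue[OF cont])
  show "(\<lambda>_. M) integrable_on S"
    using Sl by (rule integrable_on_const)
qed (use M in auto)

context lattice_fan
begin

definition vertices :: "real \<Rightarrow> (real ^ 2 option) set" where
  "vertices k = {pt 0 0 k, pt 0 0 (- k)} \<union> (\<lambda>i. pt (k * fst (q i)) (k * snd (q i)) 0) ` {..<a}"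

lemma N_q: "i < a \<Longrightarrow> 0 \<le> c \<Longrightarrow> N (c *\<^sub>R q i) = c"
  using N_cone[of i c 0] by simp

lemma vertices_in_solid:
  assumes "0 \<le> k"
  shows "vertices k \<subseteq> solid k"
proof -
  have "N (k * fst (q i), k * snd (q i)) = k" if "i < a" for i
    using N_q[OF that assms] by (simp add: scaleR_prod_def)
  moreover have "N (0, 0) = 0" using N_zero by (simp add: zero_prod_def)
  ultimately show ?thesis
    using assms by (auto simp: vertices_def)
qed

text \<open>Every point of a tetrahedron is a convex combination of its four vertices, and the origin is the midpoint of
  the two apexes.\<close>

lemma solid_eq_hull:
  assumes k: "0 < k"
  shows "solid k = convex hull (vertices k)"
proof
  show "convex hull (vertices k) \<subseteq> solid k"
    using k by (intro hull_minimal vertices_in_solid convex_solid) auto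
  let ?C = "convex hull (vertices k)"
  have C: "convex ?C" by simp
  have apex: "pt 0 0 (e * k) \<in> ?C" if "e \<in> {1, - 1}" for e
    using that by (intro hull_inc) (auto simp: vertices_def)
  have rim: "pt (k * fst (q i)) (k * snd (q i)) 0 \<in> ?C" if "i < Suc a" for i
    using that q_cyclic a_bounds
    by (cases "i = a") (auto intro!: hull_inc simp: vertices_def image_iff intro: bexI[of _ 0])
  have "(1 / 2) *\<^sub>R pt 0 0 k + (1 / 2) *\<^sub>R pt 0 0 (- k) \<in> ?C"
    using apex[of 1] apex[of "- 1"] by (intro convexD[OF C]) auto
  then have zero: "0 \<in> ?C" by (simp add: pt_linear)
  show "solid k \<subseteq> ?C"
  proof
    fix v assume "v \<in> solid k"
    then obtain i e w where w: "i < a" "e \<in> {1, - 1}" "v = fan_map i e w" "w \<in> simplex3 k"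
      unfolding solid_eq_Union_cones by blast
    obtain x y z where xyz: "w = (x, y, z)" by (cases w)
    define c :: "nat \<Rightarrow> real" where "c = (\<lambda>n. [x / k, y / k, z / k, 1 - (x + y + z) / k] ! n)"
    define P where "P = (\<lambda>n. [pt (k * fst (q i)) (k * snd (q i)) 0,
      pt (k * fst (q (Suc i))) (k * snd (q (Suc i))) 0, pt 0 0 (e * k), 0] ! n)"
    have I: "{..<4} = {0, 1, 2, 3::nat}" by auto
    have "(\<Sum>n<4. c n *\<^sub>R P n) \<in> ?C"
    proof (rule convex_sum[OF _ C])
      show "(\<Sum>n<4. c n) = 1"
        using k by (simp add: I c_def add_divide_distrib)
      show "0 \<le> c n" "P n \<in> ?C" if "n \<in> {..<4}" for n
        using that w k rim[of i] rim[of "Suc i"] apex[OF w(2)] zero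
        by (auto simp: I c_def P_def xyz simplex3_def)
    qed simp
    moreover have "(\<Sum>n<4. c n *\<^sub>R P n) = v"
      using k by (simp add: I c_def P_def w(3) xyz cone_map_def pt_linear(1,2))
    ultimately show "v \<in> ?C" by simp
  qed
qed

lemma zero_in_solid: "0 \<le> k \<Longrightarrow> 0 \<in> solid k"
  using N_zero by (simp add: pt_linear(3) zero_prod_def)

lemma bounded_solid: "0 < k \<Longrightarrow> bounded (solid k)"
  unfolding solid_eq_hull
  by (intro bounded_convex_hull finite_imp_bounded) (simp add: vertices_def)

lemma interior_solid_negligible:
  "negligible (solid k - interior (solid k))"
  by (rule negligible_subset[OF negligible_convex_frontier[OF convex_solid]])
     (auto simp: frontier_def intro: closure_subset[THEN subsetD])

lemma convex_bounded_on_solid: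
  assumes k: "0 < k" and conv: "convex_on (solid k) f"
  obtains M where "\<And>v. v \<in> solid k \<Longrightarrow> f v \<le> M"
proof -
  have "\<forall>v\<in>vertices k. f v \<le> Max (f ` vertices k)"
    by (intro ballI Max_ge) (auto simp: vertices_def)
  from convex_on_convex_hull_bound[OF conv[unfolded solid_eq_hull[OF k]] this] that show ?thesis
    unfolding solid_eq_hull[OF k] by blast
qed

lemma apex_boundary_le_total:
  assumes k: "0 < k" and pos: "\<And>v. v \<in> solid (real k) \<Longrightarrow> 0 \<le> f v"
  shows "0 \<le> apex_sum k f" "0 \<le> boundary_sum k f" "apex_sum k f + boundary_sum k f \<le> lattice_total k f"
proof -
  have slice: "0 \<le> slice f t p" if "p \<in> disc (real r)" "real r + \<bar>t\<bar> \<le> real k" for p r t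
    using that unfolding slice_def by (intro pos) (simp add: disc_def)
  have shell: "0 \<le> shell_sum j (slice f t)" if "j \<le> r" "real r + \<bar>t\<bar> \<le> real k" for j r t
    unfolding shell_sum_def
    by (intro sum_nonneg slice[OF shell_points_in_disc that(2)]) (use that in auto)
  have lat: "shell_sum r (slice f t) \<le> lattice_sum r (slice f t)" if "0 < r" "real r + \<bar>t\<bar> \<le> real k" for r t
  proof -
    have "shell_sum r (slice f t) \<le> (\<Sum>j=1..r. shell_sum j (slice f t))"
      using that by (intro member_le_sum shell) auto
    moreover have "0 \<le> slice f t 0"
      using that by (intro slice[of 0 r]) (auto simp: disc_def)
    ultimately show ?thesis by (simp add: lattice_sum_def)
  qed
  have in_range: "real r + \<bar>e * (real k - real r)\<bar> \<le> real k" if "e \<in> {1, - 1}" "r < k" for e r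
    using that by auto
  have "0 \<le> N (0, 0)" "N (0, 0) = 0" using N_zero by (simp_all add: zero_prod_def)
  then show "0 \<le> apex_sum k f"
    unfolding apex_sum_def by (intro sum_nonneg pos) auto
  show "0 \<le> boundary_sum k f"
    unfolding boundary_sum_def
    by (intro add_nonneg_nonneg sum_nonneg shell[OF order_refl] in_range) auto
  have "boundary_sum k f \<le> (\<Sum>e\<in>{1, - 1}. \<Sum>r=1..<k. lattice_sum r (slice f (e * (real k - real r)))) + lattice_sum k (slice f 0)"
    unfolding boundary_sum_def
    by (intro add_mono sum_mono lat in_range) (use k in auto)
  then show "apex_sum k f + boundary_sum k f \<le> lattice_total k f"
    unfolding lattice_total_split[OF k] by simp
qed

lemma sums_diff:
  "apex_sum k (\<lambda>v. f v - g v) = apex_sum k f - apex_sum k g"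
  "boundary_sum k (\<lambda>v. f v - g v) = boundary_sum k f - boundary_sum k g"
  "lattice_total k (\<lambda>v. f v - g v) = lattice_total k f - lattice_total k g"
proof -
  have slice: "slice (\<lambda>v. f v - g v) t = (\<lambda>p. slice f t p - slice g t p)" for t
    by (simp add: slice_def fun_eq_iff)
  have shell: "shell_sum j (\<lambda>p. F p - G p) = shell_sum j F - shell_sum j G" for j F G
    by (simp only: shell_sum_def sum_subtractf)
  have lat: "lattice_sum r (\<lambda>p. F p - G p) = lattice_sum r F - lattice_sum r G" for r F G
    by (simp add: lattice_sum_def shell sum_subtractf)
  show "apex_sum k (\<lambda>v. f v - g v) = apex_sum k f - apex_sum k g"
    by (simp only: apex_sum_def sum_subtractf)
  show "boundary_sum k (\<lambda>v. f v - g v) = boundary_sum k f - boundary_sum k g"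
    unfolding boundary_sum_def slice shell sum_subtractf by simp
  show "lattice_total k (\<lambda>v. f v - g v) = lattice_total k f - lattice_total k g"
    unfolding lattice_total_def slice lat sum_subtractf by simp
qed

text \<open>Both inequalities hold for the continuous functions \<open>f (c v)\<close> with \<open>c < 1\<close>. These are dominated by \<open>f\<close> on
  \<open>solid k\<close>, and both right-hand sides are increasing in \<open>f\<close>, so that the values of \<open>f\<close> at boundary points do not
  have to be limits. In the interior \<open>f (c v)\<close> tends to \<open>f v\<close> as \<open>c\<close> tends to one.\<close>

lemma integral_solid_bounds:
  assumes k: "0 < k" and conv: "convex_on (solid (real k)) f"
    and pos: "\<And>v. v \<in> solid (real k) \<Longrightarrow> 0 \<le> f v" and f0: "f 0 = 0"
  shows "f absolutely_integrable_on solid (real k)"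
    and "integral (solid (real k)) f \<le> lattice_total k f - boundary_sum k f / 2 - (1 - real a / 24) * apex_sum k f"
    and "integral (solid (real k)) f \<le> real k / 4 * (boundary_sum k f + real a / 6 * apex_sum k f)"
proof -
  let ?S = "solid (real k)" and ?U = "interior (solid (real k))"
  obtain M where M: "\<And>v. v \<in> ?S \<Longrightarrow> f v \<le> M"
    using convex_bounded_on_solid[OF _ conv] k by auto
  have US: "?U \<subseteq> ?S" by (rule interior_subset)
  have contU: "continuous_on ?U f"
    by (rule convex_on_continuous[OF open_interior convex_on_subset[OF conv US convex_interior[OF convex_solid]]])
  have boundedU: "bounded ?U"
    using bounded_solid[of "real k"] k US by (meson bounded_subset of_nat_0_less_iff)
  have neg: "negligible {v \<in> ?S - ?U. g v \<noteq> 0}" "negligible {v \<in> ?U - ?S. g v \<noteq> 0}" for g :: "real ^ 2 option \<Rightarrow> real"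
    using US by (auto intro: negligible_subset[OF interior_solid_negligible])
  have "f absolutely_integrable_on ?U"
    by (rule absolutely_integrable_on_open_bounded[OF open_interior boundedU contU, where M = M])
       (use M pos US in force)
  then show "f absolutely_integrable_on ?S"
    by (rule absolutely_integrable_spike_set) (use neg in blast)+
  \<comment> \<open>A sequence in \<open>{0..<1}\<close> with limit one.\<close>
  define c where "c = (\<lambda>n. real (Suc n) / real (Suc (Suc n)))"
  have c: "0 \<le> c n" "c n < 1" for n by (auto simp: c_def)
  define fc where "fc = (\<lambda>n v. f (c n *\<^sub>R v))"
  have cS: "c n *\<^sub>R v \<in> ?U" if "v \<in> ?S" for n v
    using scaled_in_interior_solid[OF _ c that] k by simp
  have fc_conv: "convex_on ?S (fc n)" for n
    unfolding fc_def
    by (rule convex_on_compose_affine[OF conv convex_solid]) (use cS US in \<open>auto simp: algebra_simps\<close>)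
  have fc_cont: "continuous_on ?S (fc n)" for n
    unfolding fc_def
    by (rule continuous_on_compose2[OF contU]) (use cS in \<open>auto intro!: continuous_intros\<close>)
  have fc_pos: "0 \<le> fc n v" if "v \<in> ?S" for n v
    unfolding fc_def using cS[OF that] US pos by blast
  have fc_le: "fc n v \<le> f v" if v: "v \<in> ?S" for n v
  proof -
    have "f ((1 - c n) *\<^sub>R 0 + c n *\<^sub>R v) \<le> (1 - c n) * f 0 + c n * f v"
      using c[of n] by (intro convex_onD[OF conv]) (auto simp: zero_in_solid v)
    also have "\<dots> \<le> f v"
      using pos[OF v] c[of n] by (simp add: f0 mult_left_le_one_le)
    finally show ?thesis by (simp add: fc_def)
  qed
  have lim: "(\<lambda>n. integral ?S (fc n)) \<longlonglongrightarrow> integral ?S f"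
  proof -
    have "(\<lambda>n. integral ?U (fc n)) \<longlonglongrightarrow> integral ?U f"
    proof (rule dominated_convergence(2))
      show "fc n integrable_on ?U" for n
        by (rule set_lebesgue_integral_eq_integral(1),
            rule absolutely_integrable_on_open_bounded[OF open_interior boundedU continuous_on_subset[OF fc_cont US], where M = M])
           (use fc_pos fc_le M US in \<open>smt (verit) subsetD\<close>)
      show "(\<lambda>_. M) integrable_on ?U"
        using boundedU by (intro integrable_on_const lmeasurable_open) auto
      show "norm (fc n v) \<le> M" if "v \<in> ?U" for n v
        using that fc_pos[of v n] fc_le[of v n] M[of v] US by auto
      fix v assume v: "v \<in> ?U"
      have "c \<longlonglongrightarrow> 1"
        unfolding c_def by (rule LIMSEQ_Suc[OF LIMSEQ_n_over_Suc_n])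
      then have "(\<lambda>n. c n *\<^sub>R v) \<longlonglongrightarrow> 1 *\<^sub>R v"
        by (intro tendsto_intros)
      moreover have "isCont f v"
        using contU v by (simp add: continuous_on_eq_continuous_at)
      ultimately show "(\<lambda>n. fc n v) \<longlonglongrightarrow> f v"
        unfolding fc_def using isCont_tendsto_compose[of v f "\<lambda>n. c n *\<^sub>R v" sequentially] by simp
    qed
    moreover have "integral ?U g = integral ?S g" for g :: "real ^ 2 option \<Rightarrow> real"
      by (rule integral_spike_set) (use neg in blast)+
    ultimately show ?thesis by simp
  qed
  let ?R = "\<lambda>g. lattice_total k g - boundary_sum k g / 2 - (1 - real a / 24) * apex_sum k g"
  have le: "?R (fc n) \<le> ?R f" "apex_sum k (fc n) \<le> apex_sum k f" "boundary_sum k (fc n) \<le> boundary_sum k f" for n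
  proof -
    have g: "0 \<le> f v - fc n v" if "v \<in> ?S" for v using fc_le[OF that] by simp
    note g = apex_boundary_le_total[OF k, where f = "\<lambda>v. f v - fc n v", OF g, unfolded sums_diff]
    have "0 \<le> (real a / 24) * (apex_sum k f - apex_sum k (fc n))"
      using g(1) by simp
    then show "?R (fc n) \<le> ?R f" "apex_sum k (fc n) \<le> apex_sum k f" "boundary_sum k (fc n) \<le> boundary_sum k f"
      using g by (simp_all add: algebra_simps)
  qed
  have "integral ?S (fc n) \<le> ?R f" for n
    using integral_solid_le_lattice_total[OF k fc_conv fc_cont fc_pos, of n] le(1)[of n] by simp
  then show "integral ?S f \<le> ?R f"
    by (intro LIMSEQ_le_const2[OF lim]) auto
  have "integral ?S (fc n) \<le> real k / 4 * (boundary_sum k f + real a / 6 * apex_sum k f)" for n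
  proof -
    have "integral ?S (fc n) \<le> real k / 4 * (boundary_sum k (fc n) + real a / 6 * apex_sum k (fc n))"
      by (rule integral_solid_le_boundary[OF k fc_conv fc_cont fc_pos]) (simp_all add: fc_def f0)
    also have "\<dots> \<le> real k / 4 * (boundary_sum k f + real a / 6 * apex_sum k f)"
      using le[of n] by (intro mult_left_mono add_mono) auto
    finally show ?thesis .
  qed
  then show "integral ?S f \<le> real k / 4 * (boundary_sum k f + real a / 6 * apex_sum k f)"
    by (intro LIMSEQ_le_const2[OF lim]) auto
qed

lemma volume_solid:
  assumes k: "0 < k"
  shows "measure lebesgue (solid k) = real a * k ^ 3 / 3" "solid k \<in> lmeasurable"
proof -
  have pw: "integral {0..1::real} (\<lambda>s. s ^ d * C) = C / real (Suc d)" for d C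
    using integral_unique[OF has_integral_mult_left[OF has_integral_power_segment[of 0 1 d], of C]] by simp
  have "apex_cone_integral k (\<lambda>_. 1) = k ^ 3 / 6"
    using pw[of 1 1] pw[of 2 "1/2"] by (simp add: apex_cone_integral_def)
  then have "(\<Sum>e\<in>{1, - 1 :: real}. \<Sum>i<a. apex_cone_integral k (\<lambda>_. 1)) = real a * k ^ 3 / 3"
    by simp
  then have *: "((\<lambda>_. 1) has_integral real a * k ^ 3 / 3) (solid k)"
    using has_integral_solid(1)[OF k, of "\<lambda>_. 1"] by (metis continuous_on_const zero_le_one)
  then show S: "solid k \<in> lmeasurable"
    by (auto simp: lmeasurable_iff_integrable_on)
  show "measure lebesgue (solid k) = real a * k ^ 3 / 3"
    using lmeasure_integral[OF S] integral_unique[OF *] by simp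
qed

lemma card_solid_lattice:
  "real (card (solid (real k) \<inter> int_lattice))
    = real a * (real k ^ 3 / 3 + real k ^ 2 / 2 + real k / 6) + 2 * real k + 1"
proof -
  have shell: "shell_sum j (slice (\<lambda>_. 1) t) = real a * real j" for j t
    by (simp add: shell_sum_def slice_def)
  have lat: "lattice_sum r (slice (\<lambda>_. 1) t) = 1 + real a * (real r * (real r + 1) / 2)" for r t
    unfolding lattice_sum_def shell
    by (induction r) (simp_all add: slice_def field_simps)
  have sum: "(\<Sum>r<k. 1 + real a * (real r * (real r + 1) / 2)) = real k + real a * (real k ^ 3 - real k) / 6"
    by (induction k) (simp_all add: field_simps power3_eq_cube)
  have "real (card (solid (real k) \<inter> int_lattice)) = lattice_total k (\<lambda>_. 1)"
    using solid_lattice_enumeration(1)[where k = k and f = "\<lambda>_. 1"] by simp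
  also have "\<dots> = 2 * (real k + real a * (real k ^ 3 - real k) / 6) + (1 + real a * (real k * (real k + 1) / 2))"
    unfolding lattice_total_def lat sum by simp
  finally show ?thesis by (simp add: field_simps power2_eq_square power3_eq_cube)
qed

lemma vertices_in_lattice: "vertices (real k) \<subseteq> int_lattice"
  using q_int by (auto simp: vertices_def int_lattice_def all_option2)

text \<open>In terms of \<open>V\<close>, \<open>L\<close>, \<open>J\<close>, \<open>T\<close>, \<open>A\<close> and \<open>B\<close> below, the two sides are \<open>J / V\<close> and \<open>T / L\<close> up to the constant \<open>f 0\<close>. The
  excess \<open>(L - V) J\<close> is estimated by \<open>integral_solid_bounds(3)\<close> and absorbed by \<open>integral_solid_bounds(2)\<close>, with
  a positive multiple of \<open>A + B\<close> to spare.\<close>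

lemma Chow_inequality_solid:
  assumes k: "20 \<le> k" and conv: "convex_on (solid (real k)) f"
    and min: "\<And>v. v \<in> solid (real k) \<Longrightarrow> f 0 \<le> f v"
  shows "continuous_average (solid (real k)) f \<le> lattice_average (solid (real k)) f"
    and "continuous_average (solid (real k)) f = lattice_average (solid (real k)) f
      \<Longrightarrow> v \<in> solid (real k) \<Longrightarrow> f v = f 0"
proof -
  let ?S = "solid (real k)"
  define g where "g = (\<lambda>v. f v - f 0)"
  define V where "V = measure lebesgue ?S"
  define L where "L = real (card (?S \<inter> int_lattice))"
  define J where "J = integral ?S g"
  define T where "T = lattice_total k g"
  define A where "A = apex_sum k g"
  define B where "B = boundary_sum k g"
  have k0: "0 < k" "0 < real k" using k by auto
  have V: "V = real a * real k ^ 3 / 3" and Sl: "?S \<in> lmeasurable"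
    using volume_solid[OF k0(2)] by (auto simp: V_def)
  have card: "L = real a * (real k ^ 3 / 3 + real k ^ 2 / 2 + real k / 6) + 2 * real k + 1"
    unfolding L_def by (rule card_solid_lattice)
  have V0: "0 < V" using k0 a_bounds by (simp add: V)
  have L0: "0 < L" unfolding card by (intro add_nonneg_pos) auto
  have g_conv: "convex_on ?S g"
    unfolding g_def diff_conv_add_uminus by (intro convex_on_add conv) (simp add: convex_on_const convex_solid)
  have g_pos: "0 \<le> g v" if "v \<in> ?S" for v using min[OF that] by (simp add: g_def)
  note bounds = integral_solid_bounds[OF k0(1) g_conv g_pos, folded J_def T_def A_def B_def]
  note AB = apex_boundary_le_total[OF k0(1), where f = g, OF g_pos, folded T_def A_def B_def]
  have J0: "0 \<le> J" unfolding J_def by (rule integral_nonneg') (rule g_pos)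
  have lat: "lattice_average ?S f = T / L + f 0"
  proof -
    have "(\<Sum>v\<in>?S \<inter> int_lattice. f v) = T + L * f 0"
      unfolding T_def solid_lattice_enumeration(1)[symmetric] by (simp add: g_def sum_subtractf L_def)
    then show ?thesis using L0 by (simp add: lattice_average_def L_def[symmetric] field_simps)
  qed
  have cont: "continuous_average ?S f = J / V + f 0"
  proof -
    have const: "(\<lambda>_. f 0) absolutely_integrable_on ?S"
      using Sl by (simp add: absolutely_integrable_on_const)
    have "f = (\<lambda>v. g v + f 0)" by (simp add: g_def)
    moreover have "(LINT v:?S|lebesgue. g v + f 0) = J + f 0 * V"
    proof -
      have "(LINT v:?S|lebesgue. g v + f 0) = (LINT v:?S|lebesgue. g v) + (LINT v:?S|lebesgue. f 0)"
        using bounds(1) const by (intro set_integral_add(2)) (auto simp: g_def)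
      moreover have "(LINT v:?S|lebesgue. g v) = J"
        unfolding J_def by (rule set_lebesgue_integral_eq_integral(2)) (use bounds(1) in \<open>simp add: g_def\<close>)
      moreover have "(LINT v:?S|lebesgue. f 0) = f 0 * V"
        using integral_mult_right[of ?S "f 0" "\<lambda>_. 1"] Sl
        by (simp add: V_def set_lebesgue_integral_eq_integral(2)[OF const] lmeasure_integral)
      ultimately show ?thesis by simp
    qed
    ultimately show ?thesis using V0 unfolding continuous_average_def V_def[symmetric] by (simp add: field_simps)
  qed
  \<comment> \<open>The limit of \<open>(L - V) * k / (4 * V)\<close> is \<open>3 / 8\<close>. Any bound below \<open>5 / 12\<close> would do, by the estimate of \<open>A\<close>
    for \<open>a = 9\<close>; the bound \<open>2 / 5\<close> holds from \<open>k = 20\<close> on.\<close>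
  have excess: "(L - V) * (real k / 4) \<le> 2 / 5 * V"
  proof -
    have k20: "20 \<le> real k" using k by simp
    have "real a * real k ^ 2 * 20 \<le> real a * real k ^ 2 * real k"
      using k20 by (intro mult_left_mono) auto
    moreover have "6 * real k ^ 2 \<le> real a * real k ^ 2"
      using a_bounds by (intro mult_right_mono) auto
    moreover have "real k * 1 \<le> real k * real k"
      using k20 by (intro mult_left_mono) auto
    ultimately show ?thesis
      unfolding card V by (simp add: algebra_simps power2_eq_square power3_eq_cube)
  qed
  define W where "W = B + real a / 6 * A"
  have W0: "0 \<le> W" using AB a_bounds by (simp add: W_def)
  have "L - V \<ge> 0" unfolding card V by (simp add: algebra_simps)
  then have "(L - V) * J \<le> (L - V) * (real k / 4 * W)"
    using bounds(3) by (intro mult_left_mono) (auto simp: W_def g_def)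
  also have "\<dots> \<le> 2 / 5 * V * W"
    using mult_right_mono[OF excess W0] by (simp add: mult.assoc)
  finally have "L * J \<le> V * (J + 2 / 5 * W)" by (simp add: algebra_simps)
  also have "\<dots> \<le> V * (T - B / 10 - A / 40)"
  proof (rule mult_left_mono)
    \<comment> \<open>\<open>a / 24 + (2 / 5) * (a / 6) = 13 * a / 120\<close>, and \<open>1 - 117 / 120 = 1 / 40\<close>.\<close>
    have "(13 * real a / 120) * A \<le> (117 / 120) * A"
      using a_bounds AB by (intro mult_right_mono) auto
    then show "J + 2 / 5 * W \<le> T - B / 10 - A / 40"
      using bounds(2) by (simp add: W_def g_def algebra_simps)
  qed (use V0 in simp)
  finally have main: "J / V \<le> (T - B / 10 - A / 40) / L"
    using V0 L0 by (simp add: field_simps)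
  also have "\<dots> \<le> T / L"
    using AB L0 by (intro divide_right_mono) auto
  finally show "continuous_average ?S f \<le> lattice_average ?S f"
    by (simp add: lat cont)
  assume "continuous_average ?S f = lattice_average ?S f" and v: "v \<in> ?S"
  then have eq: "J / V = T / L" by (simp add: lat cont)
  with main have "T / L \<le> (T - B / 10 - A / 40) / L" by simp
  then have "B / 10 + A / 40 \<le> 0" using L0 by (simp add: divide_le_cancel)
  then have "A = 0" "B = 0" using AB(1,2) by linarith+
  then have "J = 0" using bounds(3) J0 by (simp add: g_def)
  then have "T = 0" using eq L0 by simp
  then have "(\<Sum>v\<in>?S \<inter> int_lattice. g v) = 0"
    by (simp add: T_def solid_lattice_enumeration(1))
  then have "\<forall>v\<in>?S \<inter> int_lattice. g v = 0"
    using g_pos by (subst (asm) sum_nonneg_eq_0_iff) (auto simp: solid_lattice_enumeration(2))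
  then have "\<forall>v\<in>vertices (real k). g v \<le> 0"
    using vertices_in_lattice vertices_in_solid[of "real k"] by fastforce
  from convex_on_convex_hull_bound[OF g_conv[unfolded solid_eq_hull[OF k0(2)]] this]
  have "g v \<le> 0" using v unfolding solid_eq_hull[OF k0(2)] by blast
  with g_pos[OF v] show "f v = f 0" by (simp add: g_def)
qed

end

section \<open>Criterion for polystability\<close>

context lattice_fan
begin

lemma dilate_solid:
  assumes "0 < k"
  shows "dilate k (solid 1) = solid (real k)"
proof -
  have "(*\<^sub>R) (real k) ` vertices 1 = vertices (real k)"
    by (auto simp: vertices_def pt_linear(2) image_Un image_image)
  then show ?thesis
    using assms convex_hull_scaling[of "real k" "vertices 1"]
    by (simp add: dilate_def solid_eq_hull)
qed

text \<open>The polygon may be given by its corners alone; the other boundary lattice points \<open>q i\<close> need only lie in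
  their convex hull.\<close>

lemma double_cone_eq_solid:
  assumes W: "W \<subseteq> (\<lambda>i. vector [fst (q i), snd (q i)]) ` {..<a}"
    and hull: "\<And>i. i < a \<Longrightarrow> vector [fst (q i), snd (q i)] \<in> convex hull W"
  shows "double_cone (convex hull W) = solid 1"
proof -
  let ?emb = "\<lambda>p :: real ^ 2. append_coord p 0"
  let ?ap = "{append_coord 0 1, append_coord 0 (- 1)} :: (real ^ 2 option) set"
  have lin: "linear ?emb"
    by (rule linearI) (auto simp: vec_eq_iff append_coord_def split: option.split)
  have emb: "?emb (vector [x, y]) = pt x y 0" for x y
    by (simp add: pt_def)
  have "vector [0, 0] = (0 :: real ^ 2)" by (simp add: vec_eq_iff forall_2)
  then have ap: "?ap = {pt 0 0 1, pt 0 0 (- 1)}" by (simp add: pt_def)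
  have "double_cone (convex hull W) = convex hull (?ap \<union> convex hull (?emb ` W))"
    unfolding double_cone_def convex_hull_linear_image[OF lin] ..
  also have "\<dots> = convex hull (?ap \<union> ?emb ` W)"
    by (rule hull_Un_right[symmetric])
  also have "\<dots> = convex hull (vertices 1)"
  proof (rule hull_unique)
    have rim: "pt (fst (q i)) (snd (q i)) 0 \<in> convex hull (?ap \<union> ?emb ` W)" if "i < a" for i
    proof -
      have "?emb (vector [fst (q i), snd (q i)]) \<in> ?emb ` (convex hull W)"
        using hull[OF that] by (rule imageI)
      also have "\<dots> = convex hull (?emb ` W)" by (rule convex_hull_linear_image[OF lin])
      also have "\<dots> \<subseteq> convex hull (?ap \<union> ?emb ` W)" by (rule hull_mono) (rule Un_upper2)
      finally show ?thesis by (simp only: emb)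
    qed
    show "?ap \<union> ?emb ` W \<subseteq> convex hull (vertices 1)"
      using W by (intro subset_trans[OF _ hull_subset]) (auto simp: ap vertices_def emb)
    show "convex (convex hull (vertices 1))" by simp
    fix T assume T: "?ap \<union> ?emb ` W \<subseteq> T" "convex T"
    have "vertices 1 \<subseteq> convex hull (?ap \<union> ?emb ` W)"
    proof -
      have "?ap \<subseteq> convex hull (?ap \<union> ?emb ` W)"
        using hull_subset[of "?ap \<union> ?emb ` W" convex] by blast
      then show ?thesis using rim unfolding vertices_def ap by auto
    qed
    also have "\<dots> \<subseteq> T" using T by (rule hull_minimal)
    finally show "convex hull (vertices 1) \<subseteq> T" using T(2) by (rule hull_minimal)
  qed
  finally show ?thesis by (simp add: solid_eq_hull)
qed

text \<open>Averaging over the rotation \<open>R\<close> moves \<open>v\<close> to the point of the axis at the same height, and averaging over \<open>S\<close>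
  moves that point to the origin; by convexity and invariance \<open>f\<close> does not increase.\<close>

lemma min_at_origin:
  assumes R: "R \<in> sym_group (solid 1)" and S: "S \<in> sym_group (solid 1)" and n: "0 < n"
    and rot: "\<And>v. (\<Sum>j<n. ((*v) R ^^ j) v) = pt 0 0 (real n * v $ None)"
    and flip: "\<And>z. S *v pt 0 0 z = pt 0 0 (- z)"
    and k: "0 < k" and f: "invariant_convex (solid 1) k f" and v: "v \<in> solid (real k)"
  shows "f 0 \<le> f v"
proof -
  let ?z = "v $ None"
  have conv: "convex_on (solid (real k)) f"
    and inv: "A \<in> sym_group (solid 1) \<Longrightarrow> w \<in> solid (real k) \<Longrightarrow> f (A *v w) = f w" for A w
    using f k by (auto simp: invariant_convex_def dilate_solid)
  have stable: "A *v w \<in> solid (real k)" if "A \<in> sym_group (solid 1)" "w \<in> solid (real k)" for A w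
  proof -
    obtain u where u: "u \<in> solid 1" "w = real k *\<^sub>R u"
      using \<open>w \<in> solid (real k)\<close> unfolding dilate_solid[OF k, symmetric] dilate_def by blast
    have "A *v u \<in> solid 1" using that u by (auto simp: sym_group_def)
    then have "real k *\<^sub>R (A *v u) \<in> dilate k (solid 1)" unfolding dilate_def by (rule imageI)
    then show ?thesis
      by (simp add: u(2) dilate_solid[OF k] matrix_vector_mult_scaleR)
  qed
  have iter: "((*v) R ^^ j) v \<in> solid (real k) \<and> f (((*v) R ^^ j) v) = f v" for j
    by (induction j) (auto simp: v stable[OF R] inv[OF R])
  have "f (\<Sum>j<n. (1 / real n) *\<^sub>R ((*v) R ^^ j) v) \<le> (\<Sum>j<n. (1 / real n) * f (((*v) R ^^ j) v))"
    by (rule convex_on_sum[OF _ _ conv]) (use n iter in \<open>auto simp: lessThan_empty_iff\<close>)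
  moreover have "(\<Sum>j<n. (1 / real n) *\<^sub>R ((*v) R ^^ j) v) = pt 0 0 ?z"
    using n by (simp only: scaleR_right.sum[symmetric] rot) (simp add: pt_linear(2))
  ultimately have axis: "f (pt 0 0 ?z) \<le> f v"
    using n iter by simp
  have "N (0, 0) = 0" using N_zero by (simp add: zero_prod_def)
  then have ax_in: "pt 0 0 ?z \<in> solid (real k)" "pt 0 0 (- ?z) \<in> solid (real k)"
    using v N_nonneg[of "(v $ Some 1, v $ Some 2)"] by (auto simp: solid_def)
  have "f ((1 - 1 / 2) *\<^sub>R pt 0 0 ?z + (1 / 2) *\<^sub>R pt 0 0 (- ?z)) \<le> (1 - 1 / 2) * f (pt 0 0 ?z) + (1 / 2) * f (pt 0 0 (- ?z))"
    by (intro convex_onD[OF conv] ax_in) auto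
  moreover have "(1 - 1 / 2) *\<^sub>R pt 0 0 ?z + (1 / 2) *\<^sub>R pt 0 0 (- ?z) = 0"
    by (simp add: pt_linear(1,2)) (simp add: pt_linear(3))
  moreover have "f (pt 0 0 (- ?z)) = f (pt 0 0 ?z)"
    using inv[OF S ax_in(1)] by (simp add: flip)
  ultimately show ?thesis using axis by simp
qed

lemma Chow_polystable_solid:
  assumes "\<And>k f v. \<lbrakk>0 < k; invariant_convex (solid 1) k f; v \<in> solid (real k)\<rbrakk> \<Longrightarrow> f 0 \<le> f v"
  shows "asymptotically_Chow_polystable (solid 1)"
  unfolding asymptotically_Chow_polystable_def
proof (intro conjI exI[of _ 20] allI impI)
  show "integral_polytope (solid 1)"
    unfolding integral_polytope_def
    using vertices_in_lattice[of 1] solid_eq_hull[of 1]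
    by (intro exI[of _ "vertices 1"]) (simp add: vertices_def)
  have "0 *\<^sub>R 0 \<in> interior (solid 1)"
    by (rule scaled_in_interior_solid) (simp_all add: zero_in_solid)
  then have "aff_dim (solid 1) = int DIM(real ^ 2 option)"
    by (intro aff_dim_nonempty_interior) auto
  then show "aff_dim (solid 1) = int CARD(2 option)" by simp
  fix k f assume k: "20 \<le> k" and f: "invariant_convex (solid 1) k f"
  then have k0: "0 < k" by simp
  have conv: "convex_on (solid (real k)) f"
    using f by (simp add: invariant_convex_def dilate_solid[OF k0])
  have min: "f 0 \<le> f v" if "v \<in> solid (real k)" for v
    by (rule assms[OF k0 f that])
  note ineq = Chow_inequality_solid[OF k conv min, folded dilate_solid[OF k0]]
  show "continuous_average (dilate k (solid 1)) f \<le> lattice_average (dilate k (solid 1)) f"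
    by (rule ineq(1))
  assume "continuous_average (dilate k (solid 1)) f = lattice_average (dilate k (solid 1)) f"
  then have "\<forall>v\<in>dilate k (solid 1). f v = f 0" using ineq(2) by blast
  then show "affine_fun_on (dilate k (solid 1)) f"
    unfolding affine_fun_on_def by (intro exI[of _ 0] exI[of _ "f 0"]) simp
qed

text \<open>Periodicity makes \<open>L\<close> invertible on \<open>solid 1\<close>, so it is enough that \<open>L\<close> maps \<open>solid 1\<close> into itself.\<close>

lemma sym_groupI:
  fixes L :: "real ^ 2 option \<Rightarrow> real ^ 2 option"
  assumes lin: "linear L" and L_int: "\<And>i j. L (axis j 1) $ i \<in> \<int>" and det: "det (matrix L) = 1"
    and stable: "\<And>v. v \<in> solid 1 \<Longrightarrow> L v \<in> solid 1"
    and periodic: "\<And>v. (L ^^ n) v = v" and n: "0 < n"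
  shows "matrix L \<in> sym_group (solid 1)" "(*v) (matrix L) = L"
proof -
  show LM: "(*v) (matrix L) = L"
    using lin by (simp add: fun_eq_iff matrix_works)
  have iter: "(L ^^ j) v \<in> solid 1" if "v \<in> solid 1" for j v
    by (induction j) (auto simp: that stable)
  have "v \<in> L ` solid 1" if "v \<in> solid 1" for v
  proof -
    obtain m where "n = Suc m" using n by (cases n) auto
    then have "v = L ((L ^^ m) v)" using periodic[of v] by simp
    then show ?thesis using iter[OF that, of m] by blast
  qed
  then have "L ` solid 1 = solid 1" using stable by blast
  moreover have "(matrix L) $ i $ j \<in> \<int>" for i j
    by (simp add: matrix_def L_int)
  ultimately show "matrix L \<in> sym_group (solid 1)"
    by (simp add: sym_group_def SL_int_def det LM)
qed

end

lemma convex_on_max: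
  fixes g h :: "'a::real_vector \<Rightarrow> real"
  assumes "convex_on S g" "convex_on S h"
  shows "convex_on S (\<lambda>x. max (g x) (h x))"
proof (rule convex_onI)
  show "convex S" using assms(1) by (rule convex_on_imp_convex)
  fix t x y assume t: "0 < t" "t < (1::real)" and xy: "x \<in> S" "y \<in> S"
  let ?m = "\<lambda>x. max (g x) (h x)"
  have le: "u \<le> (1 - t) * ?m x + t * ?m y"
    if "u \<le> (1 - t) * p + t * r" "p \<le> ?m x" "r \<le> ?m y" for u p r
  proof -
    have "(1 - t) * p + t * r \<le> (1 - t) * ?m x + t * ?m y"
      using that t by (intro add_mono mult_left_mono) auto
    with that show ?thesis by linarith
  qed
  show "?m ((1 - t) *\<^sub>R x + t *\<^sub>R y) \<le> (1 - t) * ?m x + t * ?m y"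
    using le[OF convex_onD[OF assms(1), of t x y]] le[OF convex_onD[OF assms(2), of t x y]] t xy
    by simp
qed

lemma convex_on_linear:
  assumes "linear (l :: 'a::real_vector \<Rightarrow> real)"
  shows "convex_on UNIV l"
  by (rule convex_onI) (simp_all add: linear_add[OF assms] linear_scale[OF assms])

lemma segment_in_hull:
  fixes W :: "(real ^ 2) set"
  assumes "vector [x, y] \<in> convex hull W" "vector [x', y'] \<in> convex hull W" "0 \<le> u" "u \<le> 1"
    "vector [(1 - u) * x + u * x', (1 - u) * y + u * y'] = (p :: real ^ 2)"
  shows "p \<in> convex hull W"
proof -
  have "(1 - u) *\<^sub>R vector [x, y] + u *\<^sub>R vector [x', y'] \<in> convex hull W"
    using assms by (intro convexD_alt) auto
  also have "(1 - u) *\<^sub>R vector [x, y] + u *\<^sub>R vector [x', y'] = p"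
    by (simp add: vec_eq_iff forall_2 flip: assms(5))
  finally show ?thesis .
qed

section \<open>The square and the triangle\<close>

definition q8 :: "nat \<Rightarrow> real \<times> real" where
  "q8 i = [(1, 0), (1, 1), (0, 1), (- 1, 1), (- 1, 0), (- 1, - 1), (0, - 1), (1, - 1)] ! (i mod 8)"

text \<open>The gauge of the square, as a maximum over its four edges.\<close>

definition N8 :: "real \<times> real \<Rightarrow> real" where
  "N8 p = max (max (fst p) (- fst p)) (max (snd p) (- snd p))"

lemma less_8_cases: "i < 8 \<Longrightarrow> i = 0 \<or> i = 1 \<or> i = 2 \<or> i = 3 \<or> i = 4 \<or> i = 5 \<or> i = 6 \<or> i = (7::nat)"
  by auto

lemma q8_simps [simp]:
  "q8 0 = (1, 0)" "q8 (Suc 0) = (1, 1)" "q8 (Suc (Suc 0)) = (0, 1)" "q8 2 = (0, 1)" "q8 3 = (- 1, 1)" "q8 4 = (- 1, 0)"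
  "q8 5 = (- 1, - 1)" "q8 6 = (0, - 1)" "q8 7 = (1, - 1)" "q8 8 = (1, 0)"
  by (simp_all add: q8_def)

text \<open>The index of the half-open cone that contains \<open>p\<close>.\<close>

definition sector8 :: "real \<times> real \<Rightarrow> nat" where
  "sector8 p = (let (s, t) = p in
     if 0 \<le> t \<and> t < s then 0 else if 0 < s \<and> s \<le> t then 1
     else if s \<le> 0 \<and> - s < t then 2 else if 0 < t \<and> t \<le> - s then 3
     else if t \<le> 0 \<and> s < t then 4 else if s < 0 \<and> t \<le> s then 5
     else if 0 \<le> s \<and> t < - s then 6 else 7)"

interpretation F8: lattice_fan 8 q8 N8
proof
  show "6 \<le> (8::nat)" "8 \<le> (9::nat)" by simp_all
  show "fst (q8 i) \<in> \<int>" "snd (q8 i) \<in> \<int>" for i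
    using less_8_cases[of "i mod 8"] by (auto simp: q8_def)
  show "q8 8 = q8 0" by simp
  show "(\<Sum>i<8. q8 i) = 0"
    by (simp add: lessThan_nat_numeral lessThan_Suc zero_prod_def)
  show "cross (q8 i) (q8 (Suc i)) = 1" if "i < 8" for i
    using less_8_cases[OF that] by (auto simp: cross_def)
  show "convex_on UNIV N8"
    unfolding N8_def by (intro convex_on_max convex_on_linear linearI) simp_all
  show "N8 (x *\<^sub>R q8 i + y *\<^sub>R q8 (Suc i)) = x + y" if "i < 8" "0 \<le> x" "0 \<le> y" for i x y
    using less_8_cases[OF that(1)] that(2,3) by (elim disjE) (simp_all add: N8_def)
  show "\<exists>i<8. \<exists>x>0. \<exists>y\<ge>0. p = x *\<^sub>R q8 i + y *\<^sub>R q8 (Suc i)" if "p \<noteq> 0" for p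
  proof -
    obtain s t where p: "p = (s, t)" by (cases p)
    have w: ?thesis if "i < 8" "0 < cross p (q8 (Suc i))" "0 \<le> cross (q8 i) p"
      "p = cross p (q8 (Suc i)) *\<^sub>R q8 i + cross (q8 i) p *\<^sub>R q8 (Suc i)" for i
      using that by blast
    have "s \<noteq> 0 \<or> t \<noteq> 0" using that p by (simp add: zero_prod_def)
    then consider "0 \<le> t" "t < s" | "0 < s" "s \<le> t" | "s \<le> 0" "- s < t" | "0 < t" "t \<le> - s"
      | "t \<le> 0" "s < t" | "s < 0" "t \<le> s" | "0 \<le> s" "t < - s" | "t < 0" "- t \<le> s"
      by linarith
    then show ?thesis
    proof cases
      case 1 then show ?thesis by (intro w[of 0]) (simp_all add: p cross_def) next
      case 2 then show ?thesis by (intro w[of 1]) (simp_all add: p cross_def) next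
      case 3 then show ?thesis by (intro w[of 2]) (simp_all add: p cross_def) next
      case 4 then show ?thesis by (intro w[of 3]) (simp_all add: p cross_def) next
      case 5 then show ?thesis by (intro w[of 4]) (simp_all add: p cross_def) next
      case 6 then show ?thesis by (intro w[of 5]) (simp_all add: p cross_def) next
      case 7 then show ?thesis by (intro w[of 6]) (simp_all add: p cross_def) next
      case 8 then show ?thesis by (intro w[of 7]) (simp_all add: p cross_def)
    qed
  qed
  show "i = j"
    if ij: "i < 8" "j < 8" and pos: "0 < x" "0 \<le> y" "0 < x'" "0 \<le> y'"
      and eq: "x *\<^sub>R q8 i + y *\<^sub>R q8 (Suc i) = x' *\<^sub>R q8 j + y' *\<^sub>R q8 (Suc j)" for i j x y x' y'
  proof -
    have "sector8 (x *\<^sub>R q8 i + y *\<^sub>R q8 (Suc i)) = i" if "i < 8" "0 < x" "0 \<le> y" for i x y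
      using less_8_cases[OF that(1)] that(2,3) by (elim disjE) (simp_all add: sector8_def)
    then show ?thesis using ij pos eq by metis
  qed
qed

definition q9 :: "nat \<Rightarrow> real \<times> real" where
  "q9 i = [(1, 0), (0, 1), (- 1, 2), (- 1, 1), (- 1, 0), (- 1, - 1), (0, - 1), (1, - 1), (2, - 1)] ! (i mod 9)"

text \<open>The gauge of the triangle, as a maximum over its three edges.\<close>

definition N9 :: "real \<times> real \<Rightarrow> real" where
  "N9 p = max (max (- fst p) (- snd p)) (fst p + snd p)"

lemma less_9_cases:
  "i < 9 \<Longrightarrow> i = 0 \<or> i = 1 \<or> i = 2 \<or> i = 3 \<or> i = 4 \<or> i = 5 \<or> i = 6 \<or> i = 7 \<or> i = (8::nat)"
  by auto

lemma q9_simps [simp]: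
  "q9 0 = (1, 0)" "q9 (Suc 0) = (0, 1)" "q9 (Suc (Suc 0)) = (- 1, 2)" "q9 2 = (- 1, 2)" "q9 3 = (- 1, 1)" "q9 4 = (- 1, 0)" "q9 5 = (- 1, - 1)" "q9 6 = (0, - 1)" "q9 7 = (1, - 1)" "q9 8 = (2, - 1)" "q9 9 = (1, 0)"
  by (simp_all add: q9_def)

text \<open>The index of the half-open cone that contains \<open>p\<close>.\<close>

definition sector9 :: "real \<times> real \<Rightarrow> nat" where
  "sector9 p = (let (s, t) = p in
     if 0 < s \<and> 0 \<le> t then 0 else if s \<le> 0 \<and> 0 < t + 2 * s then 1
     else if 0 < s + t \<and> t \<le> - 2 * s then 2 else if 0 < t \<and> t \<le> - s then 3
     else if t \<le> 0 \<and> s < t then 4 else if s < 0 \<and> t \<le> s then 5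
     else if 0 \<le> s \<and> s + t < 0 then 6 else if 0 \<le> s + t \<and> s < - 2 * t then 7 else 8)"

interpretation F9: lattice_fan 9 q9 N9
proof
  show "6 \<le> (9::nat)" "9 \<le> (9::nat)" by simp_all
  show "fst (q9 i) \<in> \<int>" "snd (q9 i) \<in> \<int>" for i
    using less_9_cases[of "i mod 9"] by (auto simp: q9_def)
  show "q9 9 = q9 0" by simp
  show "(\<Sum>i<9. q9 i) = 0"
    by (simp add: lessThan_nat_numeral lessThan_Suc zero_prod_def)
  show "cross (q9 i) (q9 (Suc i)) = 1" if "i < 9" for i
    using less_9_cases[OF that] by (auto simp: cross_def)
  show "convex_on UNIV N9"
    unfolding N9_def by (intro convex_on_max convex_on_linear linearI) (simp_all add: distrib_left)
  show "N9 (x *\<^sub>R q9 i + y *\<^sub>R q9 (Suc i)) = x + y" if "i < 9" "0 \<le> x" "0 \<le> y" for i x y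
    using less_9_cases[OF that(1)] that(2,3) by (elim disjE) (simp_all add: N9_def)
  show "\<exists>i<9. \<exists>x>0. \<exists>y\<ge>0. p = x *\<^sub>R q9 i + y *\<^sub>R q9 (Suc i)" if "p \<noteq> 0" for p
  proof -
    obtain s t where p: "p = (s, t)" by (cases p)
    have w: ?thesis if "i < 9" "0 < cross p (q9 (Suc i))" "0 \<le> cross (q9 i) p"
      "p = cross p (q9 (Suc i)) *\<^sub>R q9 i + cross (q9 i) p *\<^sub>R q9 (Suc i)" for i
      using that by blast
    have "s \<noteq> 0 \<or> t \<noteq> 0" using that p by (simp add: zero_prod_def)
    then consider "0 < s" "0 \<le> t" | "s \<le> 0" "0 < t + 2 * s" | "0 < s + t" "t \<le> - 2 * s" | "0 < t" "t \<le> - s"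
      | "t \<le> 0" "s < t" | "s < 0" "t \<le> s" | "0 \<le> s" "s + t < 0" | "0 \<le> s + t" "s < - 2 * t" | "t < 0" "- 2 * t \<le> s"
      by linarith
    then show ?thesis
    proof cases
      case 1 then show ?thesis by (intro w[of 0]) (simp_all add: p cross_def) next
      case 2 then show ?thesis by (intro w[of 1]) (simp_all add: p cross_def) next
      case 3 then show ?thesis by (intro w[of 2]) (simp_all add: p cross_def) next
      case 4 then show ?thesis by (intro w[of 3]) (simp_all add: p cross_def) next
      case 5 then show ?thesis by (intro w[of 4]) (simp_all add: p cross_def) next
      case 6 then show ?thesis by (intro w[of 5]) (simp_all add: p cross_def) next
      case 7 then show ?thesis by (intro w[of 6]) (simp_all add: p cross_def) next
      case 8 then show ?thesis by (intro w[of 7]) (simp_all add: p cross_def) next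
      case 9 then show ?thesis by (intro w[of 8]) (simp_all add: p cross_def)
    qed
  qed
  show "i = j"
    if ij: "i < 9" "j < 9" and pos: "0 < x" "0 \<le> y" "0 < x'" "0 \<le> y'"
      and eq: "x *\<^sub>R q9 i + y *\<^sub>R q9 (Suc i) = x' *\<^sub>R q9 j + y' *\<^sub>R q9 (Suc j)" for i j x y x' y'
  proof -
    have "sector9 (x *\<^sub>R q9 i + y *\<^sub>R q9 (Suc i)) = i" if "i < 9" "0 < x" "0 \<le> y" for i x y
      using less_9_cases[OF that(1)] that(2,3) by (elim disjE) (simp_all add: sector9_def)
    then show ?thesis using ij pos eq by metis
  qed
qed


text \<open>Exchanging the two plane coordinates has determinant \<open>-1\<close> and preserves both polygons; combined with the
  reflection of the axis it becomes an element of the special linear group.\<close>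

lemma swap_reflection:
  defines "L \<equiv> \<lambda>v :: real ^ 2 option. pt (v $ Some 2) (v $ Some 1) (- v $ None)"
  shows "linear L" "L (axis j 1) $ i \<in> \<int>" "det (matrix L) = 1" "(L ^^ 2) v = v"
proof -
  show "linear L" by (rule linearI) (simp_all add: L_def pt_linear(1,2))
  have "\<forall>i j. L (axis j 1) $ i \<in> \<int>" by (simp add: all_option2 L_def axis_def)
  then show "L (axis j 1) $ i \<in> \<int>" by blast
  show "det (matrix L) = 1" by (simp add: det_option2 matrix_def L_def axis_def)
  show "(L ^^ 2) v = v" by (simp add: L_def numeral_2_eq_2)
qed

lemma double_cone_X8: "double_cone X8 = F8.solid 1"
  unfolding X8_def
proof (rule F8.double_cone_eq_solid)
  let ?W = "{vector [1, 1], vector [1, - 1], vector [- 1, 1], vector [- 1, - 1]} :: (real ^ 2) set"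
  show "?W \<subseteq> (\<lambda>i. vector [fst (q8 i), snd (q8 i)]) ` {..<8}"
    by (auto intro: image_eqI[of _ _ 1] image_eqI[of _ _ 3] image_eqI[of _ _ 5] image_eqI[of _ _ 7])
  have corner: "vector [1, 1] \<in> convex hull ?W" "vector [1, - 1] \<in> convex hull ?W"
    "vector [- 1, 1] \<in> convex hull ?W" "vector [- 1, - 1] \<in> convex hull ?W"
    by (intro hull_inc; simp)+
  have mid: "vector [1, 0] \<in> convex hull ?W" "vector [0, 1] \<in> convex hull ?W"
    "vector [- 1, 0] \<in> convex hull ?W" "vector [0, - 1] \<in> convex hull ?W"
    using segment_in_hull[OF corner(1,2) _ _ refl, of "1 / 2"]
      segment_in_hull[OF corner(1,3) _ _ refl, of "1 / 2"]
      segment_in_hull[OF corner(3,4) _ _ refl, of "1 / 2"]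
      segment_in_hull[OF corner(2,4) _ _ refl, of "1 / 2"]
    by simp_all
  fix i :: nat assume "i < 8"
  from less_8_cases[OF this] show "vector [fst (q8 i), snd (q8 i)] \<in> convex hull ?W"
    by (elim disjE) (simp_all add: corner mid)
qed

lemma double_cone_X9: "double_cone X9 = F9.solid 1"
  unfolding X9_def
proof (rule F9.double_cone_eq_solid)
  let ?W = "{vector [- 1, - 1], vector [2, - 1], vector [- 1, 2]} :: (real ^ 2) set"
  show "?W \<subseteq> (\<lambda>i. vector [fst (q9 i), snd (q9 i)]) ` {..<9}"
    by (auto intro: image_eqI[of _ _ 2] image_eqI[of _ _ 5] image_eqI[of _ _ 8])
  have corner: "vector [- 1, - 1] \<in> convex hull ?W" "vector [2, - 1] \<in> convex hull ?W" "vector [- 1, 2] \<in> convex hull ?W"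
    by (intro hull_inc; simp)+
  have third: "vector [1, 0] \<in> convex hull ?W" "vector [0, 1] \<in> convex hull ?W"
    "vector [- 1, 1] \<in> convex hull ?W" "vector [- 1, 0] \<in> convex hull ?W"
    "vector [0, - 1] \<in> convex hull ?W" "vector [1, - 1] \<in> convex hull ?W"
    using segment_in_hull[OF corner(2,3) _ _ refl, of "1 / 3"] segment_in_hull[OF corner(2,3) _ _ refl, of "2 / 3"]
      segment_in_hull[OF corner(3,1) _ _ refl, of "1 / 3"] segment_in_hull[OF corner(3,1) _ _ refl, of "2 / 3"]
      segment_in_hull[OF corner(1,2) _ _ refl, of "1 / 3"] segment_in_hull[OF corner(1,2) _ _ refl, of "2 / 3"]
    by simp_all
  fix i :: nat assume "i < 9"
  from less_9_cases[OF this] show "vector [fst (q9 i), snd (q9 i)] \<in> convex hull ?W"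
    by (elim disjE) (simp_all add: corner third)
qed

text \<open>The rotation is the half turn about the axis.\<close>

lemma Chow_polystable_X8: "asymptotically_Chow_polystable (double_cone X8)"
  unfolding double_cone_X8
proof (rule F8.Chow_polystable_solid)
  define R where "R = (\<lambda>v :: real ^ 2 option. pt (- v $ Some 1) (- v $ Some 2) (v $ None))"
  define S where "S = (\<lambda>v :: real ^ 2 option. pt (v $ Some 2) (v $ Some 1) (- v $ None))"
  have "\<forall>i j. R (axis j 1) $ i \<in> \<int>" by (simp add: all_option2 R_def axis_def)
  then have R: "matrix R \<in> sym_group (F8.solid 1)" "(*v) (matrix R) = R"
    by (intro F8.sym_groupI[where n = 2];
        simp add: R_def linearI pt_linear(1,2) det_option2 matrix_def axis_def F8.solid_def N8_def numeral_2_eq_2 max.commute)+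
  have S: "matrix S \<in> sym_group (F8.solid 1)" "(*v) (matrix S) = S"
    using swap_reflection[folded S_def]
    by (intro F8.sym_groupI[where n = 2]; simp add: F8.solid_def S_def N8_def max.commute)+
  show "f 0 \<le> f v" if "0 < k" "invariant_convex (F8.solid 1) k f" "v \<in> F8.solid (real k)" for k f v
  proof (rule F8.min_at_origin[OF R(1) S(1) _ _ _ that])
    show "0 < (2 :: nat)" by simp
    show "(\<Sum>j<2. ((*v) (matrix R) ^^ j) w) = pt 0 0 (real 2 * w $ None)" for w
    proof -
      have "(\<Sum>j<2. (R ^^ j) w) = w + R w" by (simp add: numeral_2_eq_2)
      then show ?thesis unfolding R(2) by (simp add: R_def vec_eq_iff all_option2)
    qed
    show "matrix S *v pt 0 0 z = pt 0 0 (- z)" for z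
      unfolding S(2) by (simp add: S_def)
  qed
qed

text \<open>The rotation has order three and permutes the corners \<open>(-1, -1)\<close>, \<open>(2, -1)\<close>, \<open>(-1, 2)\<close> cyclically.\<close>

lemma Chow_polystable_X9: "asymptotically_Chow_polystable (double_cone X9)"
  unfolding double_cone_X9
proof (rule F9.Chow_polystable_solid)
  define R where "R = (\<lambda>v :: real ^ 2 option. pt (- v $ Some 1 - v $ Some 2) (v $ Some 1) (v $ None))"
  define S where "S = (\<lambda>v :: real ^ 2 option. pt (v $ Some 2) (v $ Some 1) (- v $ None))"
  have "\<forall>i j. R (axis j 1) $ i \<in> \<int>" by (simp add: all_option2 R_def axis_def)
  then have R: "matrix R \<in> sym_group (F9.solid 1)" "(*v) (matrix R) = R"
    by (intro F9.sym_groupI[where n = 3];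
        simp add: R_def linearI pt_linear(1,2) det_option2 matrix_def axis_def F9.solid_def N9_def eval_nat_numeral algebra_simps)+
  have S: "matrix S \<in> sym_group (F9.solid 1)" "(*v) (matrix S) = S"
    using swap_reflection[folded S_def]
    by (intro F9.sym_groupI[where n = 2]; simp add: F9.solid_def S_def N9_def max.commute add.commute)+
  show "f 0 \<le> f v" if "0 < k" "invariant_convex (F9.solid 1) k f" "v \<in> F9.solid (real k)" for k f v
  proof (rule F9.min_at_origin[OF R(1) S(1) _ _ _ that])
    show "0 < (3 :: nat)" by simp
    show "(\<Sum>j<3. ((*v) (matrix R) ^^ j) w) = pt 0 0 (real 3 * w $ None)" for w
    proof -
      have "(\<Sum>j<3. (R ^^ j) w) = w + R w + R (R w)" by (simp add: numeral_3_eq_3)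
      then show ?thesis unfolding R(2) by (simp add: R_def vec_eq_iff all_option2)
    qed
    show "matrix S *v pt 0 0 z = pt 0 0 (- z)" for z
      unfolding S(2) by (simp add: S_def)
  qed
qed

theorem corollary1p6:
  shows "asymptotically_Chow_polystable (double_cone X8) \<and>
         asymptotically_Chow_polystable (double_cone X9)"
  by (rule conjI[OF Chow_polystable_X8 Chow_polystable_X9])

end
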